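(* Let $d\ge1$, $0<p,q\le\infty$ and $t\in\mathbb{R}$ be fixed. If $0<p_0,q_0\le\infty$ and $t_0\in\mathbb{R}$ are such that $S^{t_0}_{p_0,q_0}B(\mathbb{R}^d)\hookrightarrow B^t_{p,q}(\mathbb{R}^d)$, then $S^{t_0}_{p_0,q_0}B(\mathbb{R}^d)\hookrightarrow S^t_{p,q}B(\mathbb{R}^d)$. (That is, within all spaces $S^{t_0}_{p_0,q_0}B(\mathbb{R}^d)$ continuously embedded into $B^t_{p,q}(\mathbb{R}^d)$, the class $S^t_{p,q}B(\mathbb{R}^d)$ is the largest one.)
   Context: Isotropic Besov spaces: let $\psi_0\in C_0^\infty(\mathbb{R}^d)$ with $\psi_0(x)=1$ if $\max_i|x_i|\le1$ and $\psi_0(x)=0$ if $\max_i|x_i|\ge 3/2$, and $\psi_j(x)=\psi_0(2^{-j}x)-\psi_0(2^{-j+1}x)$, $j\in\mathbb{N}$. For $t\in\mathbb{R}$, $0<p,q\le\infty$, $B^t_{p,q}(\mathbb{R}^d)$ is the set of tempered distributions $f$ with $\big(\sum_{j\ge0}2^{jtq}\|\mathcal{F}^{-1}[\psi_j\mathcal{F}f]\|_{L_p}^q\big)^{1/q}<\infty$ (modification if $q=\infty$), $\mathcal{F}$ the Fourier transform. Dominating mixed spaces: let $\varphi_0\in C_0^\infty(\mathbb{R})$ with $\varphi_0=1$ on $[-1,1]$, $\operatorname{supp}\varphi_0\subset[-3/2,3/2]$, $\varphi_j(s)=\varphi_0(2^{-j}s)-\varphi_0(2^{-j+1}s)$, and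 $\varphi_{\bar k}(x)=\prod_{i=1}^d\varphi_{k_i}(x_i)$, $|\bar k|=k_1+\dots+k_d$. $S^t_{p,q}B(\mathbb{R}^d)$ is the set of tempered distributions $f$ with $\big(\sum_{\bar k\in\mathbb{N}_0^d}2^{|\bar k|tq}\|\mathcal{F}^{-1}[\varphi_{\bar k}\mathcal{F}f]\|_{L_p}^q\big)^{1/q}<\infty$. $\hookrightarrow$ is a continuous embedding. *)

theory Defs
  imports "HOL-Analysis.Analysis"
begin

definition pd :: "'d::finite \<Rightarrow> (real^'d \<Rightarrow> 'b::real_normed_vector) \<Rightarrow> real^'d \<Rightarrow> 'b" where
  "pd i g x = vector_derivative (\<lambda>s. g (x + s *\<^sub>R axis i 1)) (at 0)"

fun iter_pd :: "'d::finite list \<Rightarrow> (real^'d \<Rightarrow> 'b::real_normed_vector) \<Rightarrow> real^'d \<Rightarrow> 'b" where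
  "iter_pd [] g = g"
| "iter_pd (i # is) g = pd i (iter_pd is g)"

definition smooth_fun :: "(real^'d::finite \<Rightarrow> 'b::real_normed_vector) \<Rightarrow> bool" where
  "smooth_fun g \<longleftrightarrow>
     (\<forall>is. continuous_on UNIV (iter_pd is g)) \<and>
     (\<forall>is i x. ((\<lambda>s. iter_pd is g (x + s *\<^sub>R axis i 1))
                   has_vector_derivative iter_pd (i # is) g x) (at 0))"

definition smooth_fun1 :: "(real \<Rightarrow> real) \<Rightarrow> bool" where
  "smooth_fun1 g \<longleftrightarrow> (\<forall>n x. ((deriv ^^ n) g has_real_derivative (deriv ^^ Suc n) g x) (at x))"

definition schwartz :: "(real^'d::finite \<Rightarrow> complex) \<Rightarrow> bool" where
  "schwartz \<phi> \<longleftrightarrow> smooth_fun \<phi> \<and>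
     (\<forall>is (n::nat). bounded (range (\<lambda>x. (1 + norm x) ^ n * norm (iter_pd is \<phi> x))))"

definition schwartz_seminorm :: "nat \<Rightarrow> (real^'d::finite \<Rightarrow> complex) \<Rightarrow> real" where
  "schwartz_seminorm N \<phi> =
     (\<Sum>is\<in>{is::'d list. length is \<le> N}. \<Sum>n\<le>N.
        (SUP x. (1 + norm x) ^ n * norm (iter_pd is \<phi> x)))"

text \<open>Tempered distributions: continuous linear functionals on the Schwartz space
  (only their values on Schwartz functions matter).\<close>
definition tempered :: "((real^'d::finite \<Rightarrow> complex) \<Rightarrow> complex) \<Rightarrow> bool" where
  "tempered T \<longleftrightarrow>
     (\<forall>\<phi> \<psi> a b. schwartz \<phi> \<longrightarrow> schwartz \<psi> \<longrightarrow>
         T (\<lambda>x. a * \<phi> x + b * \<psi> x) = a * T \<phi> + b * T \<psi>) \<and>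
     (\<exists>C N. \<forall>\<phi>. schwartz \<phi> \<longrightarrow> norm (T \<phi>) \<le> C * schwartz_seminorm N \<phi>)"

text \<open>Inverse Fourier transform of a (compactly supported smooth) function, with the
  convention F g (xi) = integral of g(x) exp(-2 pi i x.xi) dx.\<close>
definition inv_fourier :: "(real^'d::finite \<Rightarrow> complex) \<Rightarrow> real^'d \<Rightarrow> complex" where
  "inv_fourier h y = (LINT \<xi>|lborel. cis (2 * pi * (y \<bullet> \<xi>)) * h \<xi>)"

text \<open>For a tempered distribution f and a compactly supported smooth multiplier m,
  F^{-1}[m F f] is the smooth function x |-> f( y |-> (F^{-1} m)(x - y) ).\<close>
definition fourier_mult :: "(real^'d::finite \<Rightarrow> complex) \<Rightarrow> ((real^'d \<Rightarrow> complex) \<Rightarrow> complex)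
    \<Rightarrow> real^'d \<Rightarrow> complex" where
  "fourier_mult m f x = f (\<lambda>y. inv_fourier m (x - y))"

definition enn_powr :: "ennreal \<Rightarrow> real \<Rightarrow> ennreal" where
  "enn_powr a r = (if a = \<infinity> then \<infinity> else ennreal (enn2real a powr r))"

definition Lp_qnorm :: "ennreal \<Rightarrow> ('a::euclidean_space \<Rightarrow> complex) \<Rightarrow> ennreal" where
  "Lp_qnorm p g =
     (if p = \<infinity> then Inf {C. AE x in lborel. ennreal (norm (g x)) \<le> C}
      else enn_powr (\<integral>\<^sup>+ x. ennreal (norm (g x) powr enn2real p) \<partial>lborel) (1 / enn2real p))"

definition lq_qnorm :: "ennreal \<Rightarrow> ('i \<Rightarrow> ennreal) \<Rightarrow> ennreal" where
  "lq_qnorm q a =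
     (if q = \<infinity> then (SUP k. a k)
      else enn_powr (\<integral>\<^sup>+ k. enn_powr (a k) (enn2real q) \<partial>count_space UNIV) (1 / enn2real q))"

definition iso_admissible :: "(real^'d::finite \<Rightarrow> real) \<Rightarrow> bool" where
  "iso_admissible \<psi>0 \<longleftrightarrow> smooth_fun \<psi>0 \<and>
     (\<forall>x. (\<forall>i. \<bar>x $ i\<bar> \<le> 1) \<longrightarrow> \<psi>0 x = 1) \<and>
     (\<forall>x. (\<exists>i. \<bar>x $ i\<bar> \<ge> 3/2) \<longrightarrow> \<psi>0 x = 0)"

definition iso_piece :: "(real^'d::finite \<Rightarrow> real) \<Rightarrow> nat \<Rightarrow> real^'d \<Rightarrow> real" where
  "iso_piece \<psi>0 j x = (if j = 0 then \<psi>0 x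
      else \<psi>0 ((2 powr (- real j)) *\<^sub>R x) - \<psi>0 ((2 powr (1 - real j)) *\<^sub>R x))"

definition besov_qnorm :: "(real^'d::finite \<Rightarrow> real) \<Rightarrow> real \<Rightarrow> ennreal \<Rightarrow> ennreal
    \<Rightarrow> ((real^'d \<Rightarrow> complex) \<Rightarrow> complex) \<Rightarrow> ennreal" where
  "besov_qnorm \<psi>0 t p q f =
     lq_qnorm q (\<lambda>j::nat. ennreal (2 powr (real j * t)) *
        Lp_qnorm p (fourier_mult (\<lambda>x. complex_of_real (iso_piece \<psi>0 j x)) f))"

definition besov_space :: "(real^'d::finite \<Rightarrow> real) \<Rightarrow> real \<Rightarrow> ennreal \<Rightarrow> ennreal
    \<Rightarrow> ((real^'d \<Rightarrow> complex) \<Rightarrow> complex) set" where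
  "besov_space \<psi>0 t p q = {f. tempered f \<and> besov_qnorm \<psi>0 t p q f < \<infinity>}"

definition mixed_admissible :: "(real \<Rightarrow> real) \<Rightarrow> bool" where
  "mixed_admissible \<phi>0 \<longleftrightarrow> smooth_fun1 \<phi>0 \<and>
     (\<forall>s. \<bar>s\<bar> \<le> 1 \<longrightarrow> \<phi>0 s = 1) \<and> (\<forall>s. \<bar>s\<bar> > 3/2 \<longrightarrow> \<phi>0 s = 0)"

definition mixed_piece1 :: "(real \<Rightarrow> real) \<Rightarrow> nat \<Rightarrow> real \<Rightarrow> real" where
  "mixed_piece1 \<phi>0 j s = (if j = 0 then \<phi>0 s
      else \<phi>0 (2 powr (- real j) * s) - \<phi>0 (2 powr (1 - real j) * s))"

definition mixed_piece :: "(real \<Rightarrow> real) \<Rightarrow> nat^'d::finite \<Rightarrow> real^'d \<Rightarrow> real" where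
  "mixed_piece \<phi>0 k x = (\<Prod>i\<in>UNIV. mixed_piece1 \<phi>0 (k $ i) (x $ i))"

definition mixed_qnorm :: "(real \<Rightarrow> real) \<Rightarrow> real \<Rightarrow> ennreal \<Rightarrow> ennreal
    \<Rightarrow> ((real^'d::finite \<Rightarrow> complex) \<Rightarrow> complex) \<Rightarrow> ennreal" where
  "mixed_qnorm \<phi>0 t p q f =
     lq_qnorm q (\<lambda>k::nat^'d. ennreal (2 powr (real (\<Sum>i\<in>UNIV. k $ i) * t)) *
        Lp_qnorm p (fourier_mult (\<lambda>x. complex_of_real (mixed_piece \<phi>0 k x)) f))"

definition mixed_space :: "(real \<Rightarrow> real) \<Rightarrow> real \<Rightarrow> ennreal \<Rightarrow> ennreal
    \<Rightarrow> ((real^'d::finite \<Rightarrow> complex) \<Rightarrow> complex) set" where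
  "mixed_space \<phi>0 t p q = {f. tempered f \<and> mixed_qnorm \<phi>0 t p q f < \<infinity>}"

definition cont_embed :: "'a set \<Rightarrow> ('a \<Rightarrow> ennreal) \<Rightarrow> 'a set \<Rightarrow> ('a \<Rightarrow> ennreal) \<Rightarrow> bool" where
  "cont_embed X nX Y nY \<longleftrightarrow> X \<subseteq> Y \<and> (\<exists>C::real. \<forall>f\<in>X. nY f \<le> ennreal C * nX f)"

end

theory Submission
  imports Defs "HOL-Probability.Characteristic_Functions" "HOL-Probability.Sinc_Integral"
begin

text \<open>
  Testing the assumed embedding on dilated low-frequency functions forces \<open>p0 \<le> p\<close>. Testing it on sums
  of bumps at the frequencies \<open>2 ^ j\<close> along one coordinate axis, where each summand has a single nonzero
  piece in both decompositions, forces \<open>\<delta> = (t0 - 1/p0) - (t - 1/p) \<ge> 0\<close>, with strict inequality if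
  \<open>q < q0\<close>. Conversely, if \<open>p0 \<le> p\<close>, Nikol'skii's inequality bounds the \<open>k\<close>-th summand of the target
  norm by \<open>2 ^ (- \<delta> |k|)\<close> times the \<open>k\<close>-th summand of the source norm, up to a constant, and the
  embedding follows by summation over \<open>k\<close>.

  In the theorem the conclusion is polymorphic in a dimension of its own, not tied to the type of
  \<open>\<psi>0\<close>. This is harmless because the conditions above do not involve the dimension, but it means that
  Nikol'skii's inequality has to be proved outright and cannot be read off from the hypothesis.
\<close>

section \<open>Fourier inversion on the line\<close>

lemma cis_measurable[measurable]: "cis \<in> borel_measurable borel"
  by (intro borel_measurable_continuous_onI continuous_on_cis continuous_on_id)

lemma Fubini_bounded_kernel:
  fixes a :: "'a::euclidean_space \<Rightarrow> complex" and b :: "'b::euclidean_space \<Rightarrow> complex"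
  assumes a: "integrable lborel a" and b: "integrable lborel b"
    and K[measurable]: "(\<lambda>(x, y). K x y) \<in> borel_measurable (borel \<Otimes>\<^sub>M borel)"
    and K1: "\<And>x y. norm (K x y) \<le> (1::real)"
  shows "(LINT x|lborel. a x * (LINT y|lborel. K x y * b y)) =
    (LINT y|lborel. b y * (LINT x|lborel. K x y * a x))"
proof -
  have [measurable]: "a \<in> borel_measurable borel" "b \<in> borel_measurable borel"
    using a b by (auto dest: borel_measurable_integrable)
  have Kx: "(\<lambda>y. K x y) \<in> borel_measurable borel" and Ky: "(\<lambda>x. K x y) \<in> borel_measurable borel"
    for x y by measurable
  have intb: "integrable lborel (\<lambda>y. K x y * b y)" for x
    by (rule Bochner_Integration.integrable_bound[OF b])
      (use K1 Kx[of x] in \<open>auto simp: norm_mult mult_left_le_one_le\<close>)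
  have inta: "integrable lborel (\<lambda>x. K x y * a x)" for y
    by (rule Bochner_Integration.integrable_bound[OF a])
      (use K1 Ky[of y] in \<open>auto simp: norm_mult mult_left_le_one_le\<close>)
  have meas: "(\<lambda>(x, y). a x * (K x y * b y)) \<in> borel_measurable (lborel \<Otimes>\<^sub>M lborel)"
    by measurable
  have int: "integrable (lborel \<Otimes>\<^sub>M lborel) (\<lambda>(x, y). a x * (K x y * b y))"
  proof (rule Bochner_Integration.integrable_bound[where f = "\<lambda>(x, y). a x * b y"])
    show "integrable (lborel \<Otimes>\<^sub>M lborel) (\<lambda>(x, y). a x * b y)"
    proof (rule lborel_pair.Fubini_integrable)
      show "(\<lambda>(x, y). a x * b y) \<in> borel_measurable (lborel \<Otimes>\<^sub>M lborel)"
        by measurable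
      show "integrable lborel (\<lambda>x. LINT y|lborel. norm (case (x, y) of (x, y) \<Rightarrow> a x * b y))"
        using a by (simp add: norm_mult)
      show "AE x in lborel. integrable lborel (\<lambda>y. case (x, y) of (x, y) \<Rightarrow> a x * b y)"
        using b by simp
    qed
    show "AE z in lborel \<Otimes>\<^sub>M lborel.
        norm (case z of (x, y) \<Rightarrow> a x * (K x y * b y)) \<le> norm (case z of (x, y) \<Rightarrow> a x * b y)"
      by (intro AE_I2) (use K1 in \<open>auto simp: norm_mult mult_left_le_one_le intro!: mult_left_mono\<close>)
  qed (rule meas)
  have "(LINT x|lborel. a x * (LINT y|lborel. K x y * b y)) =
      (LINT x|lborel. LINT y|lborel. a x * (K x y * b y))"
    by simp
  also have "\<dots> = (LINT y|lborel. LINT x|lborel. a x * (K x y * b y))"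
    using lborel_pair.Fubini_integral[OF int] by simp
  also have "\<dots> = (LINT y|lborel. LINT x|lborel. b y * (K x y * a x))"
    by (simp add: algebra_simps)
  also have "\<dots> = (LINT y|lborel. b y * (LINT x|lborel. K x y * a x))"
    by simp
  finally show ?thesis .
qed

definition inv_fourier1 :: "(real \<Rightarrow> complex) \<Rightarrow> real \<Rightarrow> complex" where
  "inv_fourier1 h s = (LINT \<xi>|lborel. cis (2 * pi * (s * \<xi>)) * h \<xi>)"

lemma integrable_gaussian:
  assumes "e > 0"
  shows "integrable lborel (\<lambda>u. complex_of_real (exp (- ((e * u)\<^sup>2) / 2)))"
proof -
  have "integrable lborel (\<lambda>x. sqrt (2 * pi) * std_normal_density x)"
    by (intro integrable_mult_right integrable_normal_density) auto
  also have "(\<lambda>x. sqrt (2 * pi) * std_normal_density x) = (\<lambda>x. exp (- (x\<^sup>2) / 2))"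
    by (auto simp: fun_eq_iff std_normal_density_def)
  finally have "integrable lborel (\<lambda>u. exp (- ((0 + e * u)\<^sup>2) / 2))"
    using lborel_integrable_real_affine[of "\<lambda>x. exp (- (x\<^sup>2) / 2)" e 0] assms by simp
  then show ?thesis
    by (intro integrable_of_real) simp
qed

lemma gaussian_fourier:
  assumes e: "e > 0"
  shows "(LINT u|lborel. cis (a * u) * complex_of_real (exp (- ((e * u)\<^sup>2) / 2))) =
    complex_of_real (sqrt (2 * pi) / e * exp (- ((a / e)\<^sup>2) / 2))"
proof -
  have "complex_of_real (exp (- ((a / e)\<^sup>2) / 2)) = char std_normal_distribution (a / e)"
    by (simp add: char_std_normal_distribution)
  also have "\<dots> = (LINT x|lborel. std_normal_density x *\<^sub>R iexp (a / e * x))"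
    unfolding char_def by (subst integral_density) auto
  also have "\<dots> = (LINT x|lborel. complex_of_real (1 / sqrt (2 * pi)) *
      (cis (a / e * x) * complex_of_real (exp (- (x\<^sup>2) / 2))))"
    by (intro Bochner_Integration.integral_cong refl)
      (simp add: std_normal_density_def scaleR_conv_of_real cis_conv_exp)
  also have "\<dots> = complex_of_real (1 / sqrt (2 * pi)) *
      (LINT x|lborel. cis (a / e * x) * complex_of_real (exp (- (x\<^sup>2) / 2)))"
    by simp
  also have "(LINT x|lborel. cis (a / e * x) * complex_of_real (exp (- (x\<^sup>2) / 2))) =
      e *\<^sub>R (LINT u|lborel. cis (a * u) * complex_of_real (exp (- ((e * u)\<^sup>2) / 2)))"
    using e by (subst lborel_integral_real_affine[where c = e and t = 0]) (auto simp: scaleR_conv_of_real)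
  finally show ?thesis
    using e by (simp add: field_simps scaleR_conv_of_real)
qed

lemma inv_fourier1_measurable:
  assumes "integrable lborel h"
  shows "inv_fourier1 h \<in> borel_measurable borel"
proof -
  have [measurable]: "h \<in> borel_measurable borel"
    using assms by (auto dest: borel_measurable_integrable)
  show ?thesis
    unfolding inv_fourier1_def by measurable
qed

text \<open>Regularise with a Gaussian of width \<open>1/e\<close>; on the frequency side this averages \<open>h\<close>
  against a normal law concentrating at \<open>\<xi>\<close> as \<open>e\<close> tends to 0.\<close>

lemma fourier_inversion1:
  assumes cont: "continuous_on UNIV h" and bound: "\<And>x. norm (h x) \<le> B"
    and int: "integrable lborel h" and int': "integrable lborel (inv_fourier1 h)"
  shows "(LINT u|lborel. cis (- (2 * pi * (u * \<xi>))) * inv_fourier1 h u) = h \<xi>"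
proof -
  have [measurable]: "h \<in> borel_measurable borel" "inv_fourier1 h \<in> borel_measurable borel"
    using int int' by (auto dest: borel_measurable_integrable)
  define e where "e n = 1 / real (Suc n)" for n
  have e0: "e n > 0" for n by (simp add: e_def)
  have elim: "e \<longlonglongrightarrow> 0"
    unfolding e_def by (rule LIMSEQ_Suc[OF lim_1_over_n])
  define L where "L n = (LINT u|lborel. (cis (- (2 * pi * (u * \<xi>))) * inv_fourier1 h u) *
      complex_of_real (exp (- ((e n * u)\<^sup>2) / 2)))" for n
  have "L \<longlonglongrightarrow> (LINT u|lborel. cis (- (2 * pi * (u * \<xi>))) * inv_fourier1 h u)"
    unfolding L_def
  proof (rule integral_dominated_convergence[where w = "\<lambda>u. norm (inv_fourier1 h u)"])
    show "integrable lborel (\<lambda>u. norm (inv_fourier1 h u))" using int' by simp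
    show "AE u in lborel. (\<lambda>n. (cis (- (2 * pi * (u * \<xi>))) * inv_fourier1 h u) *
      complex_of_real (exp (- ((e n * u)\<^sup>2) / 2)))
      \<longlonglongrightarrow> cis (- (2 * pi * (u * \<xi>))) * inv_fourier1 h u"
    proof (intro AE_I2)
      fix u
      have "(\<lambda>n. (cis (- (2 * pi * (u * \<xi>))) * inv_fourier1 h u) *
          complex_of_real (exp (- ((e n * u)\<^sup>2) / 2)))
        \<longlonglongrightarrow> (cis (- (2 * pi * (u * \<xi>))) * inv_fourier1 h u) *
          complex_of_real (exp (- ((0 * u)\<^sup>2) / 2))"
        by (intro tendsto_intros elim) auto
      then show "(\<lambda>n. (cis (- (2 * pi * (u * \<xi>))) * inv_fourier1 h u) *
          complex_of_real (exp (- ((e n * u)\<^sup>2) / 2)))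
        \<longlonglongrightarrow> cis (- (2 * pi * (u * \<xi>))) * inv_fourier1 h u" by simp
    qed
    show "AE u in lborel. norm ((cis (- (2 * pi * (u * \<xi>))) * inv_fourier1 h u) *
      complex_of_real (exp (- ((e n * u)\<^sup>2) / 2))) \<le> norm (inv_fourier1 h u)" for n
      by (intro AE_I2) (simp add: norm_mult mult_left_le)
  qed measurable
  moreover have "L n = (LINT v|lborel. std_normal_density v *\<^sub>R h (\<xi> + e n / (2 * pi) * v))" for n
  proof -
    let ?g = "\<lambda>u. complex_of_real (exp (- ((e n * u)\<^sup>2) / 2))"
    let ?K = "\<lambda>u \<eta>. cis (2 * pi * (u * (\<eta> - \<xi>)))"
    have "L n = (LINT u|lborel. ?g u * (LINT \<eta>|lborel. ?K u \<eta> * h \<eta>))"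
      unfolding L_def
    proof (intro Bochner_Integration.integral_cong refl)
      fix u
      have "cis (- (2 * pi * (u * \<xi>))) * inv_fourier1 h u =
          (LINT \<eta>|lborel. cis (- (2 * pi * (u * \<xi>))) * (cis (2 * pi * (u * \<eta>)) * h \<eta>))"
        unfolding inv_fourier1_def by simp
      also have "\<dots> = (LINT \<eta>|lborel. ?K u \<eta> * h \<eta>)"
        unfolding mult.assoc[symmetric] cis_mult by (simp add: algebra_simps)
      finally show "cis (- (2 * pi * (u * \<xi>))) * inv_fourier1 h u * ?g u =
          ?g u * (LINT \<eta>|lborel. ?K u \<eta> * h \<eta>)" by simp
    qed
    also have "\<dots> = (LINT \<eta>|lborel. h \<eta> * (LINT u|lborel. ?K u \<eta> * ?g u))"
      by (rule Fubini_bounded_kernel[OF integrable_gaussian[OF e0] int]) auto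
    also have "\<dots> = (LINT \<eta>|lborel. h \<eta> *
        complex_of_real (sqrt (2 * pi) / e n * exp (- ((2 * pi * (\<eta> - \<xi>) / e n)\<^sup>2) / 2)))"
      using gaussian_fourier[OF e0[of n], of "2 * pi * (_ - \<xi>)"]
      by (simp add: mult_ac)
    also have "\<dots> = (e n / (2 * pi)) *\<^sub>R (LINT v|lborel. h (\<xi> + e n / (2 * pi) * v) *
        complex_of_real (sqrt (2 * pi) / e n * exp (- (v\<^sup>2) / 2)))"
      using e0[of n]
      by (subst lborel_integral_real_affine[where c = "e n / (2 * pi)" and t = \<xi>])
        (auto simp: field_simps)
    also have "\<dots> = (LINT v|lborel. (e n / (2 * pi)) *\<^sub>R (h (\<xi> + e n / (2 * pi) * v) *
        complex_of_real (sqrt (2 * pi) / e n * exp (- (v\<^sup>2) / 2))))"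
      by simp
    also have "\<dots> = (LINT v|lborel. std_normal_density v *\<^sub>R h (\<xi> + e n / (2 * pi) * v))"
    proof (intro Bochner_Integration.integral_cong refl)
      fix v
      have "sqrt (2 * pi) / (2 * pi) = 1 / sqrt (2 * pi)"
        by (simp add: field_simps)
      then have "(e n / (2 * pi)) * (sqrt (2 * pi) / e n * exp (- (v\<^sup>2) / 2)) = std_normal_density v"
        using e0[of n] by (simp add: std_normal_density_def field_simps)
      then show "(e n / (2 * pi)) *\<^sub>R (h (\<xi> + e n / (2 * pi) * v) *
          complex_of_real (sqrt (2 * pi) / e n * exp (- (v\<^sup>2) / 2))) =
          std_normal_density v *\<^sub>R h (\<xi> + e n / (2 * pi) * v)"
        by (simp only: scaleR_conv_of_real mult.commute[of "h _"] mult.assoc[symmetric] of_real_mult[symmetric])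
    qed
    finally show ?thesis .
  qed
  moreover have "(\<lambda>n. LINT v|lborel. std_normal_density v *\<^sub>R h (\<xi> + e n / (2 * pi) * v))
      \<longlonglongrightarrow> (LINT v|lborel. std_normal_density v *\<^sub>R h \<xi>)"
  proof (rule integral_dominated_convergence[where w = "\<lambda>v. std_normal_density v * B"])
    show "integrable lborel (\<lambda>v. std_normal_density v * B)"
      by (intro integrable_mult_left integrable_normal_density) auto
    show "AE v in lborel. (\<lambda>n. std_normal_density v *\<^sub>R h (\<xi> + e n / (2 * pi) * v))
        \<longlonglongrightarrow> std_normal_density v *\<^sub>R h \<xi>"
    proof (intro AE_I2)
      fix v
      have "(\<lambda>n. \<xi> + e n / (2 * pi) * v) \<longlonglongrightarrow> \<xi> + 0 / (2 * pi) * v"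
        by (intro tendsto_intros elim) auto
      then have "(\<lambda>n. h (\<xi> + e n / (2 * pi) * v)) \<longlonglongrightarrow> h \<xi>"
        using cont by (intro isCont_tendsto_compose[of _ h]) (auto simp: continuous_on_eq_continuous_at)
      then show "(\<lambda>n. std_normal_density v *\<^sub>R h (\<xi> + e n / (2 * pi) * v))
        \<longlonglongrightarrow> std_normal_density v *\<^sub>R h \<xi>"
        by (intro tendsto_intros)
    qed
    show "AE v in lborel. norm (std_normal_density v *\<^sub>R h (\<xi> + e n / (2 * pi) * v))
        \<le> std_normal_density v * B" for n
      using bound by (auto intro!: mult_left_mono)
  qed measurable
  moreover have "(LINT v|lborel. std_normal_density v *\<^sub>R h \<xi>) = h \<xi>"
    using integral_normal_density[of 1 0] by simp
  ultimately show ?thesis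
    by (metis (no_types, lifting) LIMSEQ_unique ext)
qed

section \<open>Decay of transforms of smooth compactly supported functions\<close>

definition bump :: "real \<Rightarrow> (real \<Rightarrow> real) \<Rightarrow> bool" where
  "bump R h \<longleftrightarrow> (\<exists>D. D 0 = h \<and> (\<forall>n x. (D n has_real_derivative D (Suc n) x) (at x))) \<and>
     (\<forall>x. \<bar>x\<bar> > R \<longrightarrow> h x = 0)"

lemma bump_smooth_fun1:
  assumes "smooth_fun1 h" "\<And>x. \<bar>x\<bar> > R \<Longrightarrow> h x = 0"
  shows "bump R h"
  unfolding bump_def
  using assms by (intro conjI exI[of _ "\<lambda>n. (deriv ^^ n) h"]) (auto simp: smooth_fun1_def)

lemma bump_mono: "bump R h \<Longrightarrow> R \<le> R' \<Longrightarrow> bump R' h"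
  unfolding bump_def by force

lemma bump_affine:
  assumes "bump R h" and a: "a > 0"
  shows "bump ((R + \<bar>b\<bar>) / a) (\<lambda>x. h (a * x + b))"
proof -
  obtain D where D: "D 0 = h" "\<And>n x. (D n has_real_derivative D (Suc n) x) (at x)"
    and z: "\<And>x. \<bar>x\<bar> > R \<Longrightarrow> h x = 0"
    using assms unfolding bump_def by metis
  have "((\<lambda>x. a ^ n * D n (a * x + b)) has_real_derivative a ^ Suc n * D (Suc n) (a * x + b)) (at x)"
    for n x
    by (auto intro!: derivative_eq_intros DERIV_chain2[OF D(2)])
  moreover have "h (a * x + b) = 0" if "\<bar>x\<bar> > (R + \<bar>b\<bar>) / a" for x
  proof (rule z)
    have "\<bar>a * x\<bar> > R + \<bar>b\<bar>"
      using that a by (simp add: abs_mult field_simps)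
    then show "\<bar>a * x + b\<bar> > R" by linarith
  qed
  ultimately show ?thesis
    unfolding bump_def by (intro conjI exI[of _ "\<lambda>n x. a ^ n * D n (a * x + b)"]) (auto simp: D(1))
qed

lemma bump_diff:
  assumes "bump R g" "bump R h"
  shows "bump R (\<lambda>x. g x - h x)"
proof -
  obtain D E where "D 0 = g" "\<And>n x. (D n has_real_derivative D (Suc n) x) (at x)"
    "E 0 = h" "\<And>n x. (E n has_real_derivative E (Suc n) x) (at x)"
    using assms unfolding bump_def by metis
  then show ?thesis
    using assms unfolding bump_def
    by (intro conjI exI[of _ "\<lambda>n x. D n x - E n x"]) (auto intro!: derivative_intros)
qed

lemma bump_continuous: "bump R h \<Longrightarrow> continuous_on UNIV h"
  unfolding bump_def by (metis DERIV_isCont continuous_at_imp_continuous_on)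

lemma bump_deriv:
  assumes "bump R h"
  obtains h' where "bump R h'" "\<And>x. (h has_real_derivative h' x) (at x)"
proof -
  obtain D where D: "D 0 = h" "\<And>n x. (D n has_real_derivative D (Suc n) x) (at x)"
    and z: "\<And>x. \<bar>x\<bar> > R \<Longrightarrow> h x = 0"
    using assms unfolding bump_def by metis
  have "D 1 x = 0" if "\<bar>x\<bar> > R" for x
  proof (rule DERIV_unique)
    show "(h has_real_derivative D 1 x) (at x)" using D by (metis One_nat_def)
    have "open {x. \<bar>x\<bar> > R}"
      by (intro open_Collect_less continuous_intros)
    then have "eventually (\<lambda>y. \<bar>y\<bar> > R) (nhds x)"
      using that eventually_nhds by blast
    then have "eventually (\<lambda>y. 0 = h y) (nhds x)"
      by eventually_elim (use z in simp)
    moreover have "((\<lambda>_. 0::real) has_real_derivative 0) (at x)" by simp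
    ultimately show "(h has_real_derivative 0) (at x)"
      by (subst (asm) DERIV_cong_ev[OF refl _ refl]) auto
  qed
  then have "bump R (D 1)"
    unfolding bump_def using D(2) by (intro conjI exI[of _ "\<lambda>n. D (Suc n)"]) auto
  with that D show ?thesis by (metis One_nat_def)
qed

lemma bump_integrable:
  assumes "bump R h"
  shows "integrable lborel (\<lambda>x. complex_of_real (h x))"
proof -
  have "integrable lborel (\<lambda>x. indicator {-R..R} x *\<^sub>R h x)"
    by (intro borel_integrable_compact continuous_on_subset[OF bump_continuous[OF assms]]) auto
  moreover have "(\<lambda>x. indicator {-R..R} x *\<^sub>R h x) = h"
  proof
    fix x
    have "x \<in> {-R..R}" if "h x \<noteq> 0"
      using assms that by (force simp: bump_def not_less abs_le_iff)
    then show "indicator {-R..R} x *\<^sub>R h x = h x"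
      by (cases "h x = 0") auto
  qed
  ultimately show ?thesis by (intro integrable_of_real) simp
qed

lemma bump_bounded:
  assumes "bump R h"
  obtains B where "\<And>x. \<bar>h x\<bar> \<le> B"
proof -
  have "compact (h ` {-R..R})"
    by (intro compact_continuous_image continuous_on_subset[OF bump_continuous[OF assms]]) auto
  then obtain B where B: "\<And>y. y \<in> h ` {-R..R} \<Longrightarrow> norm y \<le> B"
    using compact_imp_bounded bounded_iff by metis
  have "\<bar>h x\<bar> \<le> \<bar>B\<bar>" for x
  proof (cases "\<bar>x\<bar> > R")
    case True
    then show ?thesis using assms by (auto simp: bump_def)
  next
    case False
    then have "x \<in> {-R..R}" by auto
    then show ?thesis using B[of "h x"] by auto
  qed
  with that show ?thesis by blast
qed

lemma inv_fourier1_deriv: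
  assumes h: "bump R h" and h': "bump R h'" and d: "\<And>x. (h has_real_derivative h' x) (at x)"
  shows "inv_fourier1 (\<lambda>x. complex_of_real (h' x)) s =
    - (2 * pi * s * \<i>) * inv_fourier1 (\<lambda>x. complex_of_real (h x)) s"
proof -
  let ?c = "\<lambda>\<xi>. cis (2 * pi * (s * \<xi>))"
  let ?F = "\<lambda>\<xi>. ?c \<xi> * complex_of_real (h \<xi>)"
  let ?f = "\<lambda>\<xi>. ?c \<xi> * complex_of_real (h' \<xi>) + (2 * pi * s * \<i>) * (?c \<xi> * complex_of_real (h \<xi>))"
  have int: "integrable lborel (\<lambda>\<xi>. ?c \<xi> * complex_of_real (g \<xi>))" if "bump R g" for g
    by (rule Bochner_Integration.integrable_bound[OF bump_integrable[OF that]])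
      (use bump_integrable[OF that] in \<open>auto simp: norm_mult dest: borel_measurable_integrable\<close>)
  have D: "(?F has_vector_derivative ?f \<xi>) (at \<xi>)" for \<xi>
  proof -
    have "(?c has_vector_derivative ((2 * pi * s) *\<^sub>R (\<i> * ?c \<xi>))) (at \<xi>)"
      unfolding has_vector_derivative_def
      by (rule has_derivative_eq_rhs, (rule derivative_intros)+) (auto simp: fun_eq_iff scaleR_conv_of_real)
    moreover have "((\<lambda>\<xi>. complex_of_real (h \<xi>)) has_vector_derivative complex_of_real (h' \<xi>)) (at \<xi>)"
      using d has_vector_derivative_of_real by blast
    ultimately have "(?F has_vector_derivative
        (?c \<xi> * complex_of_real (h' \<xi>) + (2 * pi * s) *\<^sub>R (\<i> * ?c \<xi>) * complex_of_real (h \<xi>))) (at \<xi>)"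
      by (rule has_vector_derivative_mult)
    then show ?thesis by (simp add: scaleR_conv_of_real mult_ac)
  qed
  have z: "h x = 0" "h' x = 0" if "\<bar>x\<bar> > R" for x
    using h h' that by (auto simp: bump_def)
  define S where "S = \<bar>R\<bar> + 1"
  have cont: "continuous_on UNIV ?f"
    using bump_continuous[OF h] bump_continuous[OF h'] by (intro continuous_intros) auto
  have "(LINT \<xi>|lborel. indicator {-S..S} \<xi> *\<^sub>R ?f \<xi>) = ?F S - ?F (-S)"
    by (rule integral_FTC_atLeastAtMost)
      (use D cont in \<open>auto simp: S_def has_vector_derivative_at_within intro: continuous_on_subset\<close>)
  also have "\<dots> = 0" by (simp add: z S_def)
  also have "(\<lambda>\<xi>. indicator {-S..S} \<xi> *\<^sub>R ?f \<xi>) = ?f"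
    using z by (auto simp: fun_eq_iff indicator_def S_def)
  finally have "(LINT \<xi>|lborel. ?f \<xi>) = 0" .
  moreover have "(LINT \<xi>|lborel. ?f \<xi>) = inv_fourier1 (\<lambda>x. complex_of_real (h' x)) s +
      (2 * pi * s * \<i>) * inv_fourier1 (\<lambda>x. complex_of_real (h x)) s"
    unfolding inv_fourier1_def using int[OF h] int[OF h']
    by (subst Bochner_Integration.integral_add) auto
  ultimately show ?thesis by (simp add: add_eq_0_iff)
qed

lemma norm_inv_fourier1_le:
  "norm (inv_fourier1 h s) \<le> (LINT \<xi>|lborel. norm (h \<xi>))"
proof -
  have "norm (inv_fourier1 h s) \<le> (LINT \<xi>|lborel. norm (cis (2 * pi * (s * \<xi>)) * h \<xi>))"
    unfolding inv_fourier1_def by (rule integral_norm_bound)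
  then show ?thesis by (simp add: norm_mult)
qed

lemma inv_fourier1_decay_power:
  assumes "bump R h"
  shows "\<exists>C. \<forall>s. \<bar>s\<bar> ^ n * norm (inv_fourier1 (\<lambda>x. complex_of_real (h x)) s) \<le> C"
  using assms
proof (induction n arbitrary: h)
  case 0
  then show ?case using norm_inv_fourier1_le by auto
next
  case (Suc n)
  obtain h' where h': "bump R h'" "\<And>x. (h has_real_derivative h' x) (at x)"
    using bump_deriv[OF Suc.prems] by blast
  obtain C where C: "\<And>s. \<bar>s\<bar> ^ n * norm (inv_fourier1 (\<lambda>x. complex_of_real (h' x)) s) \<le> C"
    using Suc.IH[OF h'(1)] by blast
  have "\<bar>s\<bar> ^ Suc n * norm (inv_fourier1 (\<lambda>x. complex_of_real (h x)) s) \<le> C" for s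
  proof -
    have "norm (inv_fourier1 (\<lambda>x. complex_of_real (h' x)) s) =
        (2 * pi) * (\<bar>s\<bar> * norm (inv_fourier1 (\<lambda>x. complex_of_real (h x)) s))"
      by (simp add: inv_fourier1_deriv[OF Suc.prems h'] norm_mult abs_mult)
    moreover have "1 * (\<bar>s\<bar> * norm (inv_fourier1 (\<lambda>x. complex_of_real (h x)) s)) \<le>
        (2 * pi) * (\<bar>s\<bar> * norm (inv_fourier1 (\<lambda>x. complex_of_real (h x)) s))"
      using pi_gt3 by (intro mult_right_mono) auto
    ultimately have "\<bar>s\<bar> ^ n * (\<bar>s\<bar> * norm (inv_fourier1 (\<lambda>x. complex_of_real (h x)) s))
        \<le> \<bar>s\<bar> ^ n * norm (inv_fourier1 (\<lambda>x. complex_of_real (h' x)) s)"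
      by (intro mult_left_mono) auto
    with C[of s] show ?thesis by (simp add: mult_ac)
  qed
  then show ?case by blast
qed

lemma inv_fourier1_decay:
  assumes "bump R h"
  shows "\<exists>C. \<forall>s. (1 + \<bar>s\<bar>) ^ n * norm (inv_fourier1 (\<lambda>x. complex_of_real (h x)) s) \<le> C"
proof -
  let ?k = "inv_fourier1 (\<lambda>x. complex_of_real (h x))"
  obtain C0 where C0: "\<And>s. \<bar>s\<bar> ^ 0 * norm (?k s) \<le> C0"
    using inv_fourier1_decay_power[OF assms] by meson
  obtain C where C: "\<And>s. \<bar>s\<bar> ^ n * norm (?k s) \<le> C"
    using inv_fourier1_decay_power[OF assms] by meson
  have "(1 + \<bar>s\<bar>) ^ n * norm (?k s) \<le> 2 ^ n * (C0 + C)" for s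
  proof -
    have "(1 + \<bar>s\<bar>) ^ n \<le> (2 * max 1 \<bar>s\<bar>) ^ n"
      by (intro power_mono) auto
    also have "\<dots> = 2 ^ n * max 1 \<bar>s\<bar> ^ n" by (simp add: power_mult_distrib)
    also have "\<dots> \<le> 2 ^ n * (1 + \<bar>s\<bar> ^ n)" by (intro mult_left_mono) (auto simp: max_def)
    finally have "(1 + \<bar>s\<bar>) ^ n * norm (?k s) \<le> 2 ^ n * (1 + \<bar>s\<bar> ^ n) * norm (?k s)"
      by (intro mult_right_mono) auto
    also have "\<dots> = 2 ^ n * (\<bar>s\<bar> ^ 0 * norm (?k s) + \<bar>s\<bar> ^ n * norm (?k s))"
      by (simp add: algebra_simps)
    also have "\<dots> \<le> 2 ^ n * (C0 + C)"
      using C0 C by (intro mult_left_mono add_mono) auto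
    finally show ?thesis .
  qed
  then show ?thesis by blast
qed

lemma integrable_inverse_1_plus_abs_square: "integrable lborel (\<lambda>s::real. inverse (1 + \<bar>s\<bar>) ^ 2)"
proof (rule Bochner_Integration.integrable_bound)
  show "integrable lborel (\<lambda>s::real. inverse (1 + s\<^sup>2))"
    using integrable_inverse_1_plus_square by (simp add: set_integrable_def einterval_def)
  show "AE s::real in lborel. norm (inverse (1 + \<bar>s\<bar>) ^ 2) \<le> norm (inverse (1 + s\<^sup>2))"
  proof (intro AE_I2)
    fix s :: real
    have "1 + s\<^sup>2 \<le> (1 + \<bar>s\<bar>)\<^sup>2" by (simp add: power2_eq_square algebra_simps)
    moreover have "0 < 1 + s\<^sup>2" by (simp add: add_pos_nonneg)
    ultimately show "norm (inverse (1 + \<bar>s\<bar>) ^ 2) \<le> norm (inverse (1 + s\<^sup>2))"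
      by (simp add: power_inverse le_imp_inverse_le)
  qed
qed measurable

section \<open>Tensor product multipliers\<close>

lemma Basis_eq_range_axis: "(Basis :: (real^'d::finite) set) = range (\<lambda>i. axis i 1)"
  by (auto simp: Basis_vec_def)

lemma inj_axis_one: "inj (\<lambda>i. axis i (1::real) :: real^'d::finite)"
  by (auto simp: inj_on_def axis_eq_axis)

lemma
  fixes f :: "'d::finite \<Rightarrow> real \<Rightarrow> 'b::{real_normed_field,banach,second_countable_topology}"
  assumes f: "\<And>i. integrable lborel (f i)"
  shows integrable_lborel_tensor: "integrable lborel (\<lambda>x::real^'d. \<Prod>i\<in>UNIV. f i (x $ i))" (is ?A)
    and integral_lborel_tensor:
      "(LINT x|lborel. (\<Prod>i\<in>UNIV. f i ((x::real^'d) $ i))) = (\<Prod>i\<in>UNIV. (LINT s|lborel. f i s))" (is ?B)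
proof -
  interpret product_sigma_finite "\<lambda>_::real^'d. lborel :: real measure"
    by standard
  let ?e = "\<lambda>i. axis i (1::real) :: real^'d"
  let ?S = "\<lambda>f. \<Sum>b\<in>(Basis :: (real^'d) set). f b *\<^sub>R b"
  define g where "g b = f (inv ?e b)" for b
  have g: "g (?e i) = f i" for i
    unfolding g_def by (subst inv_f_f[OF inj_axis_one]) (rule refl)
  have S: "?S v $ i = v (?e i)" for v :: "real^'d \<Rightarrow> real" and i
  proof -
    have "?S v $ i = ?S v \<bullet> ?e i"
      by (simp add: cart_eq_inner_axis)
    also have "\<dots> = v (?e i)"
      by (intro inner_sum_left_Basis) (auto simp: Basis_eq_range_axis)
    finally show ?thesis .
  qed
  have eq: "(\<Prod>i\<in>UNIV. f i (?S v $ i)) = (\<Prod>b\<in>Basis. g b (v b))" for v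
    unfolding S by (simp add: Basis_eq_range_axis prod.reindex[OF inj_axis_one] g)
  have [measurable]: "f i \<in> borel_measurable borel" for i
    using f[of i] by (auto dest: borel_measurable_integrable)
  have gi: "integrable lborel (g b)" for b
    by (simp add: g_def f)
  have m: "?S \<in> measurable (\<Pi>\<^sub>M b\<in>(Basis :: (real^'d) set). lborel) borel"
    by measurable
  have fm: "(\<lambda>x::real^'d. \<Prod>i\<in>UNIV. f i (x $ i)) \<in> borel_measurable borel"
    by measurable
  have lb: "(lborel :: (real^'d) measure) = distr (\<Pi>\<^sub>M b\<in>Basis. lborel) borel ?S"
    by (rule lborel_eq)
  show ?A
    by (subst lb, subst integrable_distr_eq[OF m fm], unfold eq, rule product_integrable_prod)
      (auto simp: gi)
  have "(LINT x|lborel. (\<Prod>i\<in>UNIV. f i ((x::real^'d) $ i))) = (\<Prod>b\<in>Basis. (LINT s|lborel. g b s))"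
    by (subst lb, subst integral_distr[OF m fm], unfold eq, rule product_integral_prod)
      (auto simp: gi)
  also have "\<dots> = (\<Prod>i\<in>UNIV. (LINT s|lborel. f i s))"
    by (simp add: Basis_eq_range_axis prod.reindex[OF inj_axis_one] g)
  finally show ?B .
qed

lemma cis_sum: "finite I \<Longrightarrow> cis (\<Sum>i\<in>I. f i) = (\<Prod>i\<in>I. cis (f i))"
  by (induction I rule: finite_induct) (auto simp: cis_mult[symmetric])

lemma inner_vec_real: "(x::real^'d::finite) \<bullet> y = (\<Sum>i\<in>UNIV. x $ i * y $ i)"
  by (simp add: inner_vec_def)

lemma cis_inner: "cis (2 * pi * (x \<bullet> y)) = (\<Prod>i\<in>UNIV. cis (2 * pi * (x $ i * (y::real^'d::finite) $ i)))"
  by (simp add: inner_vec_real sum_distrib_left cis_sum)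

definition rapid_multiplier :: "(real^'d::finite \<Rightarrow> complex) \<Rightarrow> bool" where
  "rapid_multiplier h \<longleftrightarrow> integrable lborel h \<and>
     (\<forall>n. integrable lborel (\<lambda>u. (1 + norm u) ^ n *\<^sub>R inv_fourier h u)) \<and>
     (\<forall>\<xi>. (LINT u|lborel. cis (- (2 * pi * (u \<bullet> \<xi>))) * inv_fourier h u) = h \<xi>)"

lemma rapid_multiplier_integrable:
  assumes "rapid_multiplier h"
  shows "integrable lborel h" "integrable lborel (inv_fourier h)"
proof -
  show "integrable lborel h" using assms by (simp add: rapid_multiplier_def)
  have "integrable lborel (\<lambda>u. (1 + norm u) ^ 0 *\<^sub>R inv_fourier h u)"
    using assms unfolding rapid_multiplier_def by blast
  then show "integrable lborel (inv_fourier h)" by simp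
qed

lemma inv_fourier_tensor:
  fixes h :: "'d::finite \<Rightarrow> real \<Rightarrow> real"
  assumes h: "\<And>i. bump R (h i)"
  shows "inv_fourier (\<lambda>\<xi>. complex_of_real (\<Prod>i\<in>UNIV. h i (\<xi> $ i))) u =
    (\<Prod>i\<in>UNIV. inv_fourier1 (\<lambda>s. complex_of_real (h i s)) (u $ i))"
proof -
  have int: "integrable lborel (\<lambda>\<xi>. cis (2 * pi * (s * \<xi>)) * complex_of_real (h i \<xi>))" for i s
    by (rule Bochner_Integration.integrable_bound[OF bump_integrable[OF h[of i]]])
      (use bump_integrable[OF h[of i]] in \<open>auto simp: norm_mult dest: borel_measurable_integrable\<close>)
  show ?thesis
    unfolding inv_fourier_def inv_fourier1_def
    by (subst integral_lborel_tensor[symmetric, OF int]) (simp add: cis_inner prod.distrib)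
qed

lemma integrable_inv_fourier1_weight:
  assumes h: "bump R h"
  shows "integrable lborel (\<lambda>s. (1 + \<bar>s\<bar>) ^ n *\<^sub>R inv_fourier1 (\<lambda>s. complex_of_real (h s)) s)"
proof -
  let ?k = "inv_fourier1 (\<lambda>s. complex_of_real (h s))"
  obtain C where C: "\<And>s. (1 + \<bar>s\<bar>) ^ (n + 2) * norm (?k s) \<le> C"
    using inv_fourier1_decay[OF h] by meson
  have [measurable]: "?k \<in> borel_measurable borel"
    by (rule inv_fourier1_measurable[OF bump_integrable[OF h]])
  show ?thesis
  proof (rule Bochner_Integration.integrable_bound)
    show "integrable lborel (\<lambda>s::real. C * inverse (1 + \<bar>s\<bar>) ^ 2)"
      using integrable_inverse_1_plus_abs_square by simp
    show "AE s in lborel. norm ((1 + \<bar>s\<bar>) ^ n *\<^sub>R ?k s) \<le> norm (C * inverse (1 + \<bar>s\<bar>) ^ 2)"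
    proof (intro AE_I2)
      fix s :: real
      have "norm ((1 + \<bar>s\<bar>) ^ n *\<^sub>R ?k s) = ((1 + \<bar>s\<bar>) ^ (n + 2) * norm (?k s)) * inverse (1 + \<bar>s\<bar>) ^ 2"
      proof -
        have "(1 + \<bar>s\<bar>) ^ 2 * inverse (1 + \<bar>s\<bar>) ^ 2 = 1"
          by (simp add: power_mult_distrib[symmetric])
        then show ?thesis by (simp only: power_add norm_scaleR) (simp add: mult_ac)
      qed
      also have "\<dots> \<le> C * inverse (1 + \<bar>s\<bar>) ^ 2"
        by (intro mult_right_mono C) auto
      finally show "norm ((1 + \<bar>s\<bar>) ^ n *\<^sub>R ?k s) \<le> norm (C * inverse (1 + \<bar>s\<bar>) ^ 2)" by simp
    qed
  qed measurable
qed

lemma one_plus_norm_le_prod: "1 + norm (u::real^'d::finite) \<le> (\<Prod>i\<in>UNIV. (1 + \<bar>u $ i\<bar>))"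
proof -
  have "1 + (\<Sum>i\<in>I. \<bar>u $ i\<bar>) \<le> (\<Prod>i\<in>I. (1 + \<bar>u $ i\<bar>))" if "finite I" for I
    using that
  proof induction
    case (insert i I)
    have "1 + (\<Sum>i\<in>insert i I. \<bar>u $ i\<bar>) \<le> (1 + \<bar>u $ i\<bar>) * (1 + (\<Sum>i\<in>I. \<bar>u $ i\<bar>))"
      using insert by (simp add: algebra_simps sum_nonneg mult_nonneg_nonneg)
    also have "\<dots> \<le> (1 + \<bar>u $ i\<bar>) * (\<Prod>i\<in>I. (1 + \<bar>u $ i\<bar>))"
      using insert by (intro mult_left_mono) auto
    finally show ?case using insert by simp
  qed simp
  from this[of UNIV] norm_le_l1_cart[of u] show ?thesis by simp
qed

lemma rapid_multiplier_tensor: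
  fixes h :: "'d::finite \<Rightarrow> real \<Rightarrow> real"
  assumes h: "\<And>i. bump R (h i)"
  shows "rapid_multiplier (\<lambda>\<xi>. complex_of_real (\<Prod>i\<in>UNIV. h i (\<xi> $ i)))"
  unfolding rapid_multiplier_def
proof (intro conjI allI)
  let ?h = "\<lambda>\<xi>. complex_of_real (\<Prod>i\<in>UNIV. h i (\<xi> $ i))"
  let ?k = "\<lambda>i. inv_fourier1 (\<lambda>s. complex_of_real (h i s))"
  have k: "integrable lborel (?k i)" for i
    using integrable_inv_fourier1_weight[OF h[of i], of 0] by simp
  show "integrable lborel ?h"
    using integrable_lborel_tensor[OF bump_integrable[OF h]] by (simp add: of_real_prod)
  show "integrable lborel (\<lambda>u. (1 + norm u) ^ n *\<^sub>R inv_fourier ?h u)" for n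
  proof (rule Bochner_Integration.integrable_bound)
    show "integrable lborel (\<lambda>u::real^'d. \<Prod>i\<in>UNIV. (1 + \<bar>u $ i\<bar>) ^ n *\<^sub>R ?k i (u $ i))"
      by (rule integrable_lborel_tensor[OF integrable_inv_fourier1_weight[OF h]])
    have [measurable]: "?k i \<in> borel_measurable borel" for i
      using k[of i] by (auto dest: borel_measurable_integrable)
    show "(\<lambda>u. (1 + norm u) ^ n *\<^sub>R inv_fourier ?h u) \<in> borel_measurable lborel"
      unfolding inv_fourier_tensor[OF h] by measurable
    show "AE u in lborel. norm ((1 + norm u) ^ n *\<^sub>R inv_fourier ?h u)
        \<le> norm (\<Prod>i\<in>UNIV. (1 + \<bar>u $ i\<bar>) ^ n *\<^sub>R ?k i (u $ i))"
    proof (intro AE_I2)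
      fix u :: "real^'d"
      have "norm ((1 + norm u) ^ n *\<^sub>R inv_fourier ?h u) =
          (1 + norm u) ^ n * (\<Prod>i\<in>UNIV. norm (?k i (u $ i)))"
        unfolding inv_fourier_tensor[OF h] by (simp add: prod_norm)
      also have "\<dots> \<le> (\<Prod>i\<in>UNIV. (1 + \<bar>u $ i\<bar>)) ^ n * (\<Prod>i\<in>UNIV. norm (?k i (u $ i)))"
        by (intro mult_right_mono power_mono one_plus_norm_le_prod prod_nonneg) auto
      also have "\<dots> = (\<Prod>i\<in>UNIV. norm ((1 + \<bar>u $ i\<bar>) ^ n *\<^sub>R ?k i (u $ i)))"
        by (simp add: prod.distrib prod_power_distrib)
      finally show "norm ((1 + norm u) ^ n *\<^sub>R inv_fourier ?h u)
        \<le> norm (\<Prod>i\<in>UNIV. (1 + \<bar>u $ i\<bar>) ^ n *\<^sub>R ?k i (u $ i))"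
        by (simp only: prod_norm)
    qed
  qed
  show "(LINT u|lborel. cis (- (2 * pi * (u \<bullet> \<xi>))) * inv_fourier ?h u) = ?h \<xi>" for \<xi>
  proof -
    have int: "integrable lborel (\<lambda>s. cis (- (2 * pi * (s * x))) * ?k i s)" for i x
      by (rule Bochner_Integration.integrable_bound[OF k[of i]])
        (use k[of i] in \<open>auto simp: norm_mult dest: borel_measurable_integrable\<close>)
    have "cis (- (2 * pi * (u \<bullet> \<xi>))) = (\<Prod>i\<in>UNIV. cis (- (2 * pi * (u $ i * \<xi> $ i))))" for u
      by (simp add: inner_vec_real sum_distrib_left sum_negf[symmetric] cis_sum)
    then have "(LINT u|lborel. cis (- (2 * pi * (u \<bullet> \<xi>))) * inv_fourier ?h u) =
        (LINT u|lborel. (\<Prod>i\<in>UNIV. cis (- (2 * pi * (u $ i * \<xi> $ i))) * ?k i (u $ i)))"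
      unfolding inv_fourier_tensor[OF h] by (simp add: prod.distrib)
    also have "\<dots> = (\<Prod>i\<in>UNIV. (LINT s|lborel. cis (- (2 * pi * (s * \<xi> $ i))) * ?k i s))"
      by (rule integral_lborel_tensor[OF int])
    also have "\<dots> = (\<Prod>i\<in>UNIV. complex_of_real (h i (\<xi> $ i)))"
    proof (intro prod.cong refl)
      fix i
      obtain B where "\<And>x. \<bar>h i x\<bar> \<le> B"
        using bump_bounded[OF h[of i]] by blast
      then show "(LINT s|lborel. cis (- (2 * pi * (s * \<xi> $ i))) * ?k i s) = complex_of_real (h i (\<xi> $ i))"
        by (intro fourier_inversion1 bump_integrable[OF h] k)
          (auto intro!: continuous_intros bump_continuous[OF h])
    qed
    finally show ?thesis by simp
  qed
qed

lemma integrable_cis_mult: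
  fixes h :: "'a::euclidean_space \<Rightarrow> complex"
  assumes h: "integrable lborel h" and g: "g \<in> borel_measurable borel"
  shows "integrable lborel (\<lambda>x. cis (g x) * h x)"
  by (rule Bochner_Integration.integrable_bound[OF h])
    (use h g in \<open>auto simp: norm_mult dest: borel_measurable_integrable\<close>)

lemma inv_fourier_linear_comb:
  assumes "finite J" "\<And>j. j \<in> J \<Longrightarrow> integrable lborel (h j)"
  shows "inv_fourier (\<lambda>\<xi>. \<Sum>j\<in>J. a j * h j \<xi>) u = (\<Sum>j\<in>J. a j * inv_fourier (h j) u)"
proof -
  have "inv_fourier (\<lambda>\<xi>. \<Sum>j\<in>J. a j * h j \<xi>) u =
      (LINT \<xi>|lborel. (\<Sum>j\<in>J. a j * (cis (2 * pi * (u \<bullet> \<xi>)) * h j \<xi>)))"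
    unfolding inv_fourier_def
    by (simp add: sum_distrib_left mult.left_commute[of "cis _"])
  also have "\<dots> = (\<Sum>j\<in>J. (LINT \<xi>|lborel. a j * (cis (2 * pi * (u \<bullet> \<xi>)) * h j \<xi>)))"
    using assms by (intro Bochner_Integration.integral_sum integrable_mult_right integrable_cis_mult) auto
  finally show ?thesis by (simp add: inv_fourier_def)
qed

lemma rapid_multiplier_linear_comb:
  assumes J: "finite J" and h: "\<And>j. j \<in> J \<Longrightarrow> rapid_multiplier (h j)"
  shows "rapid_multiplier (\<lambda>\<xi>. \<Sum>j\<in>J. a j * h j \<xi>)"
  unfolding rapid_multiplier_def
proof (intro conjI allI)
  have hi: "integrable lborel (h j)" "integrable lborel (inv_fourier (h j))" if "j \<in> J" for j
    using rapid_multiplier_integrable[OF h[OF that]] .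
  note eq = inv_fourier_linear_comb[OF J hi(1), where a = a]
  show "integrable lborel (\<lambda>\<xi>. \<Sum>j\<in>J. a j * h j \<xi>)"
    using hi by auto
  show "integrable lborel (\<lambda>u. (1 + norm u) ^ n *\<^sub>R inv_fourier (\<lambda>\<xi>. \<Sum>j\<in>J. a j * h j \<xi>) u)" for n
  proof -
    have "integrable lborel (\<lambda>u. \<Sum>j\<in>J. a j * ((1 + norm u) ^ n *\<^sub>R inv_fourier (h j) u))"
      using h by (intro Bochner_Integration.integrable_sum integrable_mult_right)
        (auto simp: rapid_multiplier_def)
    then show ?thesis by (simp add: eq scaleR_sum_right)
  qed
  show "(LINT u|lborel. cis (- (2 * pi * (u \<bullet> \<xi>))) * inv_fourier (\<lambda>\<xi>. \<Sum>j\<in>J. a j * h j \<xi>) u) =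
      (\<Sum>j\<in>J. a j * h j \<xi>)" for \<xi>
  proof -
    have "(LINT u|lborel. cis (- (2 * pi * (u \<bullet> \<xi>))) * inv_fourier (\<lambda>\<xi>. \<Sum>j\<in>J. a j * h j \<xi>) u) =
        (LINT u|lborel. (\<Sum>j\<in>J. a j * (cis (- (2 * pi * (u \<bullet> \<xi>))) * inv_fourier (h j) u)))"
      by (simp add: eq sum_distrib_left mult.left_commute[of "cis _"])
    also have "\<dots> = (\<Sum>j\<in>J. (LINT u|lborel. a j * (cis (- (2 * pi * (u \<bullet> \<xi>))) * inv_fourier (h j) u)))"
      using hi(2) by (intro Bochner_Integration.integral_sum integrable_mult_right integrable_cis_mult) auto
    also have "\<dots> = (\<Sum>j\<in>J. a j * h j \<xi>)"
      using h by (intro sum.cong refl) (simp add: rapid_multiplier_def)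
    finally show ?thesis .
  qed
qed

lemma rapid_multiplier_cmult:
  assumes "rapid_multiplier h"
  shows "rapid_multiplier (\<lambda>\<xi>. c * h \<xi>)"
  using rapid_multiplier_linear_comb[of "{()}" "\<lambda>_. h" "\<lambda>_. c"] assms by simp

lemma inv_fourier_convolution:
  assumes h: "rapid_multiplier h" and m: "integrable lborel m"
  shows "(LINT u|lborel. inv_fourier m (z - u) * inv_fourier h u) = inv_fourier (\<lambda>\<xi>. m \<xi> * h \<xi>) z"
proof -
  let ?a = "inv_fourier h" and ?b = "\<lambda>\<xi>. cis (2 * pi * (z \<bullet> \<xi>)) * m \<xi>"
  have "(LINT u|lborel. inv_fourier m (z - u) * ?a u) =
      (LINT u|lborel. ?a u * (LINT \<xi>|lborel. cis (- (2 * pi * (u \<bullet> \<xi>))) * ?b \<xi>))"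
  proof (intro Bochner_Integration.integral_cong refl)
    fix u
    have eq: "cis (- (2 * pi * (u \<bullet> \<xi>))) * ?b \<xi> = cis (2 * pi * ((z - u) \<bullet> \<xi>)) * m \<xi>" for \<xi>
      unfolding mult.assoc[symmetric] cis_mult by (simp add: inner_diff_left algebra_simps)
    show "inv_fourier m (z - u) * ?a u =
        ?a u * (LINT \<xi>|lborel. cis (- (2 * pi * (u \<bullet> \<xi>))) * ?b \<xi>)"
      unfolding eq inv_fourier_def[of m] by (rule mult.commute)
  qed
  also have "\<dots> = (LINT \<xi>|lborel. ?b \<xi> * (LINT u|lborel. cis (- (2 * pi * (u \<bullet> \<xi>))) * ?a u))"
    by (rule Fubini_bounded_kernel)
      (use rapid_multiplier_integrable[OF h] integrable_cis_mult[OF m] in auto)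
  also have "\<dots> = inv_fourier (\<lambda>\<xi>. m \<xi> * h \<xi>) z"
    using h by (simp add: rapid_multiplier_def inv_fourier_def mult.assoc)
  finally show ?thesis .
qed

section \<open>Coordinatewise dilations\<close>

lemma lborel_dilation:
  fixes l :: "real^'d::finite"
  assumes l: "\<And>i. l $ i > 0"
  shows "lborel = density (distr lborel borel ((*) l)) (\<lambda>_. ennreal (\<Prod>i\<in>UNIV. l $ i))"
proof -
  let ?c = "\<lambda>b. l \<bullet> b"
  have "(\<lambda>x. 0 + (\<Sum>j\<in>Basis. (?c j * (x \<bullet> j)) *\<^sub>R j)) = (*) l"
  proof
    fix x
    have "0 + (\<Sum>j\<in>Basis. (?c j * (x \<bullet> j)) *\<^sub>R j) = (\<Sum>j\<in>Basis. ((l * x) \<bullet> j) *\<^sub>R j)"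
      by (auto intro!: sum.cong simp: Basis_eq_range_axis inner_axis)
    then show "0 + (\<Sum>j\<in>Basis. (?c j * (x \<bullet> j)) *\<^sub>R j) = l * x"
      by (simp only: euclidean_representation)
  qed
  moreover have "(\<Prod>j\<in>Basis. \<bar>?c j\<bar>) = (\<Prod>i\<in>UNIV. l $ i)"
    using l by (simp add: Basis_eq_range_axis prod.reindex[OF inj_axis_one] inner_axis abs_of_pos)
  moreover have "?c j \<noteq> 0" if "j \<in> Basis" for j
    using that l by (auto simp: Basis_eq_range_axis inner_axis less_imp_neq[symmetric])
  ultimately show ?thesis
    using lborel_affine_euclidean[of ?c 0] by simp
qed

lemma dilation_measurable[measurable]: "(*) (l::real^'d::finite) \<in> borel_measurable borel"
  by (intro borel_measurable_continuous_onI) (auto simp: times_vec_def intro!: continuous_intros)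

lemma inv_fourier_dilation:
  fixes l m :: "real^'d::finite"
  assumes h[measurable]: "h \<in> borel_measurable borel"
    and l: "\<And>i. l $ i > 0" and lm: "\<And>i. l $ i * m $ i = 1"
  shows "inv_fourier (\<lambda>\<xi>. complex_of_real (\<Prod>i\<in>UNIV. l $ i) * h (l * \<xi>)) x = inv_fourier h (m * x)"
proof -
  let ?P = "\<Prod>i\<in>UNIV. l $ i"
  have P: "?P \<ge> 0" using l by (intro prod_nonneg) (auto simp: less_imp_le)
  have dot: "(m * x) \<bullet> (l * \<xi>) = x \<bullet> \<xi>" for \<xi>
    unfolding inner_vec_real
  proof (intro sum.cong refl)
    fix i
    have "(m * x) $ i * (l * \<xi>) $ i = (l $ i * m $ i) * (x $ i * \<xi> $ i)"
      by (simp add: mult_ac)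
    then show "(m * x) $ i * (l * \<xi>) $ i = x $ i * \<xi> $ i"
      by (simp add: lm)
  qed
  have "inv_fourier h (m * x) = (LINT \<xi>|density (distr lborel borel ((*) l)) (\<lambda>_. ennreal ?P).
      cis (2 * pi * ((m * x) \<bullet> \<xi>)) * h \<xi>)"
    unfolding inv_fourier_def by (subst lborel_dilation[OF l]) simp
  also have "\<dots> = (LINT \<xi>|distr lborel borel ((*) l). ?P *\<^sub>R (cis (2 * pi * ((m * x) \<bullet> \<xi>)) * h \<xi>))"
    using P by (subst integral_density) auto
  also have "\<dots> = (LINT \<xi>|lborel. ?P *\<^sub>R (cis (2 * pi * ((m * x) \<bullet> (l * \<xi>))) * h (l * \<xi>)))"
    by (subst integral_distr) auto
  also have "\<dots> = inv_fourier (\<lambda>\<xi>. complex_of_real ?P * h (l * \<xi>)) x"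
    unfolding inv_fourier_def dot by (simp add: scaleR_conv_of_real mult_ac)
  finally show ?thesis by simp
qed

section \<open>Convolution and dilation on the Schwartz space\<close>

definition conv_op :: "real^'d::finite \<Rightarrow> (real^'d \<Rightarrow> complex) \<Rightarrow> (real^'d \<Rightarrow> complex) \<Rightarrow> real^'d \<Rightarrow> complex" where
  "conv_op l \<kappa> \<eta> y = (LINT u|lborel. \<eta> (l * y + u) * \<kappa> u)"

lemma fourier_mult_conv_op:
  assumes "rapid_multiplier h" "integrable lborel m"
  shows "fourier_mult m (\<lambda>\<eta>. T (conv_op l (inv_fourier h) \<eta>)) x =
    T (\<lambda>y. inv_fourier (\<lambda>\<xi>. m \<xi> * h \<xi>) (x - l * y))"
proof -
  have "conv_op l (inv_fourier h) (\<lambda>y. inv_fourier m (x - y)) =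
      (\<lambda>y. inv_fourier (\<lambda>\<xi>. m \<xi> * h \<xi>) (x - l * y))"
    by (simp add: fun_eq_iff conv_op_def inv_fourier_convolution[OF assms, symmetric] diff_diff_eq)
  then show ?thesis by (simp add: fourier_mult_def)
qed

lemma has_vector_derivative_shift_iff:
  fixes f :: "real \<Rightarrow> 'b::real_normed_vector"
  shows "((\<lambda>r. f (s + r)) has_vector_derivative D) (at 0) \<longleftrightarrow> (f has_vector_derivative D) (at s)"
proof
  assume "(f has_vector_derivative D) (at s)"
  then have "((f \<circ> (+) s) has_vector_derivative 1 *\<^sub>R D) (at 0)"
    by (intro vector_diff_chain_at) (auto intro!: derivative_eq_intros)
  then show "((\<lambda>r. f (s + r)) has_vector_derivative D) (at 0)"
    by (simp add: o_def)
next
  assume "((\<lambda>r. f (s + r)) has_vector_derivative D) (at 0)"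
  then have "(((\<lambda>r. f (s + r)) \<circ> (\<lambda>r. r - s)) has_vector_derivative 1 *\<^sub>R D) (at s)"
    by (intro vector_diff_chain_at) (auto intro!: derivative_eq_intros)
  then show "(f has_vector_derivative D) (at s)"
    by (simp add: o_def)
qed

lemma dilation_line: "l * (x + s *\<^sub>R axis i 1) = l * x + (l $ i * s) *\<^sub>R axis i (1::real)"
  for l x :: "real^'d::finite"
  by (simp add: vec_eq_iff axis_def algebra_simps)

lemma integrable_conv_op:
  fixes \<zeta> :: "real^'d::finite \<Rightarrow> complex"
  assumes \<kappa>: "integrable lborel \<kappa>" and c: "continuous_on UNIV \<zeta>" and B: "\<And>x. norm (\<zeta> x) \<le> B"
  shows "integrable lborel (\<lambda>u. \<zeta> (z + u) * \<kappa> u)"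
proof (rule Bochner_Integration.integrable_bound)
  show "integrable lborel (\<lambda>u. B *\<^sub>R \<kappa> u)" using \<kappa> by simp
  have [measurable]: "\<zeta> \<in> borel_measurable borel" "\<kappa> \<in> borel_measurable borel"
    using c \<kappa> by (auto dest: borel_measurable_integrable borel_measurable_continuous_onI)
  show "(\<lambda>u. \<zeta> (z + u) * \<kappa> u) \<in> borel_measurable lborel" by measurable
  show "AE u in lborel. norm (\<zeta> (z + u) * \<kappa> u) \<le> norm (B *\<^sub>R \<kappa> u)"
    unfolding norm_mult norm_scaleR
    by (intro AE_I2 mult_right_mono order_trans[OF B abs_ge_self] norm_ge_zero)
qed

lemma conv_op_has_derivative:
  fixes \<zeta> \<zeta>' :: "real^'d::finite \<Rightarrow> complex"
  assumes \<kappa>: "integrable lborel \<kappa>"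
    and c: "continuous_on UNIV \<zeta>" "continuous_on UNIV \<zeta>'"
    and B: "\<And>x. norm (\<zeta> x) \<le> B" "\<And>x. norm (\<zeta>' x) \<le> B'"
    and D: "\<And>x. ((\<lambda>s. \<zeta> (x + s *\<^sub>R axis i 1)) has_vector_derivative \<zeta>' x) (at 0)"
  shows "((\<lambda>s. conv_op l \<kappa> \<zeta> (x + s *\<^sub>R axis i 1)) has_vector_derivative
    l $ i *\<^sub>R conv_op l \<kappa> \<zeta>' x) (at 0)"
proof -
  let ?e = "axis i (1::real)"
  define Z where "Z u s = \<zeta> (l * x + u + (l $ i * s) *\<^sub>R ?e)" for u s
  define Z' where "Z' u s = l $ i *\<^sub>R \<zeta>' (l * x + u + (l $ i * s) *\<^sub>R ?e)" for u s
  have ZD: "(Z u has_vector_derivative Z' u s) (at s)" for u s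
  proof -
    let ?w = "l * x + u + (l $ i * s) *\<^sub>R ?e"
    have "((\<lambda>r. \<zeta> (?w + r *\<^sub>R ?e)) has_vector_derivative \<zeta>' ?w) (at (l $ i * 0))"
      using D[of ?w] by simp
    then have "((\<lambda>r. \<zeta> (?w + r *\<^sub>R ?e)) \<circ> (\<lambda>r. l $ i * r) has_vector_derivative l $ i *\<^sub>R \<zeta>' ?w) (at 0)"
      by (intro vector_diff_chain_at) (auto intro!: derivative_eq_intros)
    then have "((\<lambda>r. \<zeta> (?w + (l $ i * r) *\<^sub>R ?e)) has_vector_derivative Z' u s) (at 0)"
      by (simp add: o_def Z'_def)
    also have "(\<lambda>r. \<zeta> (?w + (l $ i * r) *\<^sub>R ?e)) = (\<lambda>r. Z u (s + r))"
      by (simp add: Z_def fun_eq_iff algebra_simps)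
    finally show ?thesis
      by (simp only: has_vector_derivative_shift_iff)
  qed
  define r where "r s u = (Z u s - Z u 0 - s *\<^sub>R Z' u 0) /\<^sub>R norm s" for s u
  have rlim: "((\<lambda>s. r s u) \<longlongrightarrow> 0) (at 0)" for u
    using ZD[of u 0] by (simp add: has_vector_derivative_def has_derivative_at_within r_def)
  have rbound: "norm (r s u) \<le> 2 * \<bar>l $ i\<bar> * B'" for s u
  proof (cases "s = 0")
    case True
    have "0 \<le> B'" using B(2) norm_ge_zero order_trans by blast
    with True show ?thesis by (simp add: r_def)
  next
    case False
    have "norm (Z u s - Z u 0 - (s - 0) *\<^sub>R Z' u 0) \<le> norm (s - 0) * (2 * \<bar>l $ i\<bar> * B')"
    proof (rule vector_differentiable_bound_linearization[where S = UNIV])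
      show "norm (Z' u a - Z' u 0) \<le> 2 * \<bar>l $ i\<bar> * B'" for a
      proof -
        have "norm (Z' u a) \<le> \<bar>l $ i\<bar> * B'" for a
          using B(2) by (simp add: Z'_def mult_left_mono)
        from this[of a] this[of 0] norm_triangle_ineq4[of "Z' u a" "Z' u 0"]
        show ?thesis by linarith
      qed
      show "(Z u has_vector_derivative Z' u a) (at a within UNIV)" for a
        using ZD by simp
    qed auto
    with False show ?thesis
      by (simp add: r_def pos_divide_le_eq divide_inverse[symmetric] mult.commute[of "inverse _"] mult_ac(2)[of "\<bar>s\<bar>"])
  qed
  have [measurable]: "\<zeta> \<in> borel_measurable borel" "\<zeta>' \<in> borel_measurable borel" "\<kappa> \<in> borel_measurable borel"
    using c \<kappa> by (auto dest: borel_measurable_integrable borel_measurable_continuous_onI)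
  have iZ: "integrable lborel (\<lambda>u. Z u s * \<kappa> u)" for s
    using integrable_conv_op[OF \<kappa> c(1) B(1), of "l * x + (l $ i * s) *\<^sub>R ?e"]
    by (simp add: Z_def algebra_simps)
  have iZ': "integrable lborel (\<lambda>u. Z' u 0 * \<kappa> u)"
    using integrable_conv_op[OF \<kappa> c(2) B(2), of "l * x"] by (simp add: Z'_def)
  have conv: "conv_op l \<kappa> \<zeta> (x + s *\<^sub>R ?e) = (LINT u|lborel. Z u s * \<kappa> u)" for s
    unfolding conv_op_def Z_def dilation_line by (simp add: add_ac)
  have conv': "l $ i *\<^sub>R conv_op l \<kappa> \<zeta>' x = (LINT u|lborel. Z' u 0 * \<kappa> u)"
    by (simp add: conv_op_def Z'_def)
  have eq: "(conv_op l \<kappa> \<zeta> (x + s *\<^sub>R ?e) - conv_op l \<kappa> \<zeta> (x + 0 *\<^sub>R ?e) -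
      s *\<^sub>R (l $ i *\<^sub>R conv_op l \<kappa> \<zeta>' x)) /\<^sub>R norm s = (LINT u|lborel. r s u * \<kappa> u)" for s
  proof -
    have "(LINT u|lborel. r s u * \<kappa> u) =
        (LINT u|lborel. (Z u s * \<kappa> u - Z u 0 * \<kappa> u - s *\<^sub>R (Z' u 0 * \<kappa> u)) /\<^sub>R norm s)"
      by (intro Bochner_Integration.integral_cong refl) (simp add: r_def algebra_simps)
    also have "\<dots> = (LINT u|lborel. Z u s * \<kappa> u - Z u 0 * \<kappa> u - s *\<^sub>R (Z' u 0 * \<kappa> u)) /\<^sub>R norm s"
      by simp
    also have "(LINT u|lborel. Z u s * \<kappa> u - Z u 0 * \<kappa> u - s *\<^sub>R (Z' u 0 * \<kappa> u)) =
        (LINT u|lborel. Z u s * \<kappa> u) - (LINT u|lborel. Z u 0 * \<kappa> u) - s *\<^sub>R (LINT u|lborel. Z' u 0 * \<kappa> u)"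
      using iZ iZ' by simp
    finally show ?thesis unfolding conv conv' by simp
  qed
  have "((\<lambda>s. LINT u|lborel. r s u * \<kappa> u) \<longlongrightarrow> 0) (at 0)"
    unfolding tendsto_at_iff_sequentially
  proof (intro allI impI)
    fix X :: "nat \<Rightarrow> real" assume X: "\<forall>n. X n \<in> UNIV - {0}" "X \<longlonglongrightarrow> 0"
    have "(\<lambda>n. LINT u|lborel. r (X n) u * \<kappa> u) \<longlonglongrightarrow> (LINT u::real^'d|lborel. 0::complex)"
    proof (rule integral_dominated_convergence[where w = "\<lambda>u. (2 * \<bar>l $ i\<bar> * B') * norm (\<kappa> u)"])
      show "integrable lborel (\<lambda>u. (2 * \<bar>l $ i\<bar> * B') * norm (\<kappa> u))" using \<kappa> by simp
      show "AE u in lborel. (\<lambda>n. r (X n) u * \<kappa> u) \<longlonglongrightarrow> 0"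
      proof (intro AE_I2)
        fix u
        have "(\<lambda>n. r (X n) u) \<longlonglongrightarrow> 0"
          using rlim[of u] X unfolding tendsto_at_iff_sequentially by (auto simp: o_def)
        from tendsto_mult_left_zero[OF this]
        show "(\<lambda>n. r (X n) u * \<kappa> u) \<longlonglongrightarrow> 0" .
      qed
      show "AE u in lborel. norm (r (X n) u * \<kappa> u) \<le> (2 * \<bar>l $ i\<bar> * B') * norm (\<kappa> u)" for n
        unfolding norm_mult by (intro AE_I2 mult_right_mono rbound) auto
      show "(\<lambda>u. r (X n) u * \<kappa> u) \<in> borel_measurable lborel" for n
        unfolding r_def Z_def Z'_def by measurable
    qed simp
    then show "((\<lambda>s. LINT u|lborel. r s u * \<kappa> u) \<circ> X) \<longlonglongrightarrow> 0"
      by (simp add: o_def)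
  qed
  then show ?thesis
    unfolding has_vector_derivative_def has_derivative_at_within eq[symmetric] diff_zero
    by (intro conjI bounded_linear_scaleR_left)
qed

lemma conv_op_continuous:
  fixes \<zeta> :: "real^'d::finite \<Rightarrow> complex"
  assumes \<kappa>: "integrable lborel \<kappa>" and c: "continuous_on UNIV \<zeta>" and B: "\<And>x. norm (\<zeta> x) \<le> B"
  shows "continuous_on UNIV (conv_op l \<kappa> \<zeta>)"
proof -
  have [measurable]: "\<zeta> \<in> borel_measurable borel" "\<kappa> \<in> borel_measurable borel"
    using c \<kappa> by (auto dest: borel_measurable_integrable borel_measurable_continuous_onI)
  have "continuous (at y) (conv_op l \<kappa> \<zeta>)" for y
  proof (rule continuous_at_sequentiallyI)
    fix Y assume Y: "Y \<longlonglongrightarrow> y"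
    have lY: "(\<lambda>n. l * Y n) \<longlonglongrightarrow> l * y"
      unfolding times_vec_def by (intro tendsto_intros Y)
    show "(\<lambda>n. conv_op l \<kappa> \<zeta> (Y n)) \<longlonglongrightarrow> conv_op l \<kappa> \<zeta> y"
      unfolding conv_op_def
    proof (rule integral_dominated_convergence[where w = "\<lambda>u. B * norm (\<kappa> u)"])
      show "AE u in lborel. (\<lambda>n. \<zeta> (l * Y n + u) * \<kappa> u) \<longlonglongrightarrow> \<zeta> (l * y + u) * \<kappa> u"
      proof (intro AE_I2 tendsto_mult tendsto_const)
        fix u
        show "(\<lambda>n. \<zeta> (l * Y n + u)) \<longlonglongrightarrow> \<zeta> (l * y + u)"
          using c by (intro isCont_tendsto_compose[of _ \<zeta>] tendsto_intros lY)
            (auto simp: continuous_on_eq_continuous_at)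
      qed
      show "AE u in lborel. norm (\<zeta> (l * Y n + u) * \<kappa> u) \<le> B * norm (\<kappa> u)" for n
        unfolding norm_mult by (intro AE_I2 mult_right_mono B) auto
    qed (use \<kappa> in auto)
  qed
  then show ?thesis
    by (simp add: continuous_on_eq_continuous_at)
qed

lemma schwartz_iter_pd_bounded:
  assumes "schwartz \<eta>"
  obtains B where "\<And>x. (1 + norm x) ^ n * norm (iter_pd is \<eta> x) \<le> B"
proof -
  have "bounded (range (\<lambda>x. (1 + norm x) ^ n * norm (iter_pd is \<eta> x)))"
    using assms unfolding schwartz_def by blast
  then obtain B where "\<And>x. norm ((1 + norm x) ^ n * norm (iter_pd is \<eta> x)) \<le> B"
    unfolding bounded_iff by blast
  then show ?thesis using that by (metis abs_ge_self order_trans real_norm_def)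
qed

lemma schwartz_SUP_bound:
  assumes "schwartz \<eta>"
  shows "(1 + norm x) ^ n * norm (iter_pd is \<eta> x) \<le> (SUP x. (1 + norm x) ^ n * norm (iter_pd is \<eta> x))"
proof (rule cSUP_upper)
  show "bdd_above (range (\<lambda>x. (1 + norm x) ^ n * norm (iter_pd is \<eta> x)))"
    using assms by (intro bounded_imp_bdd_above) (auto simp: schwartz_def)
qed simp

lemma iter_pd_conv_op:
  assumes \<kappa>: "integrable lborel \<kappa>" and \<eta>: "schwartz \<eta>"
  shows "iter_pd is (conv_op l \<kappa> \<eta>) = (\<lambda>y. (\<Prod>i\<leftarrow>is. l $ i) *\<^sub>R conv_op l \<kappa> (iter_pd is \<eta>) y)"
    and "((\<lambda>s. iter_pd is (conv_op l \<kappa> \<eta>) (x + s *\<^sub>R axis i 1)) has_vector_derivative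
      iter_pd (i # is) (conv_op l \<kappa> \<eta>) x) (at 0)"
proof -
  have D: "((\<lambda>s. conv_op l \<kappa> (iter_pd is \<eta>) (x + s *\<^sub>R axis i 1)) has_vector_derivative
      l $ i *\<^sub>R conv_op l \<kappa> (iter_pd (i # is) \<eta>) x) (at 0)" for "is" i x
  proof -
    obtain B where B: "\<And>x. (1 + norm x) ^ 0 * norm (iter_pd is \<eta> x) \<le> B"
      using schwartz_iter_pd_bounded[OF \<eta>] by blast
    obtain B' where B': "\<And>x. (1 + norm x) ^ 0 * norm (iter_pd (i # is) \<eta> x) \<le> B'"
      using schwartz_iter_pd_bounded[OF \<eta>] by blast
    show ?thesis
      by (rule conv_op_has_derivative[where B = B and B' = B'])
        (use \<eta> \<kappa> B B' in \<open>auto simp: schwartz_def smooth_fun_def simp del: iter_pd.simps\<close>)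
  qed
  have eq: "iter_pd is (conv_op l \<kappa> \<eta>) = (\<lambda>y. (\<Prod>i\<leftarrow>is. l $ i) *\<^sub>R conv_op l \<kappa> (iter_pd is \<eta>) y)" for "is"
  proof (induction "is")
    case (Cons i "is")
    show ?case
    proof
      fix x
      have "((\<lambda>s. (\<Prod>i\<leftarrow>is. l $ i) *\<^sub>R conv_op l \<kappa> (iter_pd is \<eta>) (x + s *\<^sub>R axis i 1)) has_vector_derivative
          (\<Prod>i\<leftarrow>is. l $ i) *\<^sub>R (l $ i *\<^sub>R conv_op l \<kappa> (iter_pd (i # is) \<eta>) x)) (at 0)"
        using has_vector_derivative_scaleR[OF DERIV_const D] by (simp del: iter_pd.simps)
      then show "iter_pd (i # is) (conv_op l \<kappa> \<eta>) x =
          (\<Prod>i\<leftarrow>i # is. l $ i) *\<^sub>R conv_op l \<kappa> (iter_pd (i # is) \<eta>) x"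
        by (simp add: Cons.IH pd_def[of i "\<lambda>y. _ *\<^sub>R _ y"] vector_derivative_at mult.commute)
    qed
  qed simp
  show "iter_pd is (conv_op l \<kappa> \<eta>) = (\<lambda>y. (\<Prod>i\<leftarrow>is. l $ i) *\<^sub>R conv_op l \<kappa> (iter_pd is \<eta>) y)"
    by (rule eq)
  have "((\<lambda>s. (\<Prod>i\<leftarrow>is. l $ i) *\<^sub>R conv_op l \<kappa> (iter_pd is \<eta>) (x + s *\<^sub>R axis i 1)) has_vector_derivative
      (\<Prod>i\<leftarrow>is. l $ i) *\<^sub>R (l $ i *\<^sub>R conv_op l \<kappa> (iter_pd (i # is) \<eta>) x)) (at 0)"
    using has_vector_derivative_scaleR[OF DERIV_const D] by (simp del: iter_pd.simps)
  then show "((\<lambda>s. iter_pd is (conv_op l \<kappa> \<eta>) (x + s *\<^sub>R axis i 1)) has_vector_derivative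
      iter_pd (i # is) (conv_op l \<kappa> \<eta>) x) (at 0)"
    by (simp add: eq mult.commute del: iter_pd.simps)
qed

lemma norm_dilation_ge:
  fixes l y :: "real^'d::finite"
  assumes "\<And>i. l $ i \<ge> 1"
  shows "norm y \<le> norm (l * y)"
proof -
  have "\<bar>y $ i\<bar> \<le> \<bar>(l * y) $ i\<bar>" for i
    using assms[of i] mult_right_mono[of 1 "l $ i" "\<bar>y $ i\<bar>"] by (simp add: abs_mult)
  then show ?thesis
    unfolding norm_vec_def by (intro L2_set_mono) auto
qed

lemma conv_op_weighted_bound:
  fixes \<zeta> :: "real^'d::finite \<Rightarrow> complex"
  assumes l: "\<And>i. l $ i \<ge> 1" and \<kappa>: "integrable lborel (\<lambda>u. (1 + norm u) ^ n *\<^sub>R \<kappa> u)"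
    and B: "\<And>x. (1 + norm x) ^ n * norm (\<zeta> x) \<le> B"
  shows "(1 + norm y) ^ n * norm (conv_op l \<kappa> \<zeta> y) \<le> B * (LINT u|lborel. (1 + norm u) ^ n * norm (\<kappa> u))"
proof -
  have i: "integrable lborel (\<lambda>u. B * ((1 + norm u) ^ n * norm (\<kappa> u)))"
    using integrable_norm[OF \<kappa>] by (simp add: abs_of_nonneg)
  have B0: "0 \<le> B"
    by (rule order_trans[OF _ B[of 0]]) simp
  have "(1 + norm y) ^ n * norm (conv_op l \<kappa> \<zeta> y) =
      norm (LINT u|lborel. (1 + norm y) ^ n *\<^sub>R (\<zeta> (l * y + u) * \<kappa> u))"
    by (simp add: conv_op_def)
  also have "\<dots> \<le> (LINT u|lborel. B * ((1 + norm u) ^ n * norm (\<kappa> u)))"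
  proof (rule order_trans[OF integral_norm_bound integral_mono'[OF i]])
    show "0 \<le> B * ((1 + norm u) ^ n * norm (\<kappa> u))" for u
      using B0 by simp
    fix u
    have "1 + norm y \<le> 1 + norm (l * y)" using norm_dilation_ge[OF l] by simp
    also have "\<dots> \<le> 1 + (norm (l * y + u) + norm u)"
      using norm_triangle_ineq4[of "l * y + u" u] by simp
    also have "\<dots> \<le> (1 + norm (l * y + u)) * (1 + norm u)"
      by (simp add: algebra_simps)
    finally have "(1 + norm y) ^ n \<le> (1 + norm (l * y + u)) ^ n * (1 + norm u) ^ n"
      unfolding power_mult_distrib[symmetric] by (intro power_mono) auto
    then have "(1 + norm y) ^ n * (norm (\<zeta> (l * y + u)) * norm (\<kappa> u)) \<le>
        (1 + norm (l * y + u)) ^ n * (1 + norm u) ^ n * (norm (\<zeta> (l * y + u)) * norm (\<kappa> u))"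
      by (intro mult_right_mono) auto
    also have "\<dots> = ((1 + norm (l * y + u)) ^ n * norm (\<zeta> (l * y + u))) * ((1 + norm u) ^ n * norm (\<kappa> u))"
      by (simp add: mult_ac)
    also have "\<dots> \<le> B * ((1 + norm u) ^ n * norm (\<kappa> u))"
      by (intro mult_right_mono B) auto
    finally show "norm ((1 + norm y) ^ n *\<^sub>R (\<zeta> (l * y + u) * \<kappa> u)) \<le> B * ((1 + norm u) ^ n * norm (\<kappa> u))"
      by (simp add: norm_mult)
  qed
  finally show ?thesis by simp
qed

context
  fixes l :: "real^'d::finite" and \<kappa> :: "real^'d \<Rightarrow> complex"
  assumes l: "\<And>i. l $ i \<ge> 1"
    and \<kappa>: "\<And>n. integrable lborel (\<lambda>u. (1 + norm u) ^ n *\<^sub>R \<kappa> u)"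
begin

lemma \<kappa>_integrable: "integrable lborel \<kappa>"
  using \<kappa>[of 0] by simp

lemma iter_pd_conv_op_bound:
  assumes \<eta>: "schwartz \<eta>"
  shows "(1 + norm y) ^ n * norm (iter_pd is (conv_op l \<kappa> \<eta>) y) \<le>
    (\<Prod>i\<leftarrow>is. l $ i) * (LINT u|lborel. (1 + norm u) ^ n * norm (\<kappa> u)) *
      (SUP x. (1 + norm x) ^ n * norm (iter_pd is \<eta> x))"
proof -
  have P: "(\<Prod>i\<leftarrow>is. l $ i) \<ge> 0"
    using l by (intro prod_list_nonneg) (auto intro: order_trans[of 0 1])
  have "(1 + norm y) ^ n * norm (conv_op l \<kappa> (iter_pd is \<eta>) y) \<le>
      (SUP x. (1 + norm x) ^ n * norm (iter_pd is \<eta> x)) * (LINT u|lborel. (1 + norm u) ^ n * norm (\<kappa> u))"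
    by (rule conv_op_weighted_bound[OF l \<kappa> schwartz_SUP_bound[OF \<eta>]])
  from mult_left_mono[OF this P] P show ?thesis
    by (simp add: iter_pd_conv_op(1)[OF \<kappa>_integrable \<eta>] abs_of_nonneg mult_ac)
qed

lemma schwartz_conv_op:
  assumes \<eta>: "schwartz \<eta>"
  shows "schwartz (conv_op l \<kappa> \<eta>)"
  unfolding schwartz_def smooth_fun_def
proof (intro conjI allI)
  fix "is"
  obtain B where "\<And>x. (1 + norm x) ^ 0 * norm (iter_pd is \<eta> x) \<le> B"
    using schwartz_iter_pd_bounded[OF \<eta>] by blast
  then have "continuous_on UNIV (conv_op l \<kappa> (iter_pd is \<eta>))"
    using \<eta> by (intro conv_op_continuous[OF \<kappa>_integrable, where B = B]) (auto simp: schwartz_def smooth_fun_def)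
  then show "continuous_on UNIV (iter_pd is (conv_op l \<kappa> \<eta>))"
    unfolding iter_pd_conv_op(1)[OF \<kappa>_integrable \<eta>] by (intro continuous_intros)
next
  fix "is" i x
  show "((\<lambda>s. iter_pd is (conv_op l \<kappa> \<eta>) (x + s *\<^sub>R axis i 1)) has_vector_derivative
      iter_pd (i # is) (conv_op l \<kappa> \<eta>) x) (at 0)"
    by (rule iter_pd_conv_op(2)[OF \<kappa>_integrable \<eta>])
next
  fix "is" n
  show "bounded (range (\<lambda>x. (1 + norm x) ^ n * norm (iter_pd is (conv_op l \<kappa> \<eta>) x)))"
    using iter_pd_conv_op_bound[OF \<eta>] unfolding bounded_iff by fastforce
qed

lemma schwartz_seminorm_conv_op:
  obtains K where "K \<ge> 0"
    "\<And>\<eta>. schwartz \<eta> \<Longrightarrow> schwartz_seminorm N (conv_op l \<kappa> \<eta>) \<le> K * schwartz_seminorm N \<eta>"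
proof -
  define L where "L = (\<Sum>i\<in>UNIV. l $ i)"
  have lL: "l $ i \<le> L" for i
    unfolding L_def using l by (intro member_le_sum) (auto intro: order_trans[of 0 1])
  then have L1: "L \<ge> 1" using l order_trans by blast
  have prodL: "0 \<le> (\<Prod>i\<leftarrow>is. l $ i) \<and> (\<Prod>i\<leftarrow>is. l $ i) \<le> L ^ length is" for "is"
  proof (induction "is")
    case (Cons i "is")
    have "0 \<le> l $ i" using l[of i] by simp
    with Cons L1 lL[of i] show ?case by (auto intro!: mult_mono)
  qed simp
  define M where "M n = (LINT u|lborel. (1 + norm u) ^ n * norm (\<kappa> u))" for n
  have M0: "M n \<ge> 0" for n
    unfolding M_def by (intro integral_nonneg_AE) auto
  define MM where "MM = (\<Sum>n\<le>N. M n)"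
  have MM: "M n \<le> MM" if "n \<le> N" for n
    unfolding MM_def using that M0 by (intro member_le_sum) auto
  have MM0: "MM \<ge> 0" unfolding MM_def using M0 by (intro sum_nonneg) auto
  let ?S = "\<lambda>\<eta> is n. (SUP x. (1 + norm x) ^ n * norm (iter_pd is \<eta> x))"
  have "schwartz_seminorm N (conv_op l \<kappa> \<eta>) \<le> (L ^ N * MM) * schwartz_seminorm N \<eta>"
    if \<eta>: "schwartz \<eta>" for \<eta>
  proof -
    have "?S (conv_op l \<kappa> \<eta>) is n \<le> (L ^ N * MM) * ?S \<eta> is n" if "length is \<le> N" "n \<le> N" for "is" n
    proof -
      have S0: "0 \<le> ?S \<eta> is n"
        by (rule order_trans[OF _ schwartz_SUP_bound[OF \<eta>, of 0]]) auto
      have "?S (conv_op l \<kappa> \<eta>) is n \<le> (\<Prod>i\<leftarrow>is. l $ i) * M n * ?S \<eta> is n"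
        unfolding M_def by (intro cSUP_least iter_pd_conv_op_bound[OF \<eta>]) auto
      also have "\<dots> \<le> L ^ N * MM * ?S \<eta> is n"
      proof (intro mult_right_mono mult_mono)
        show "(\<Prod>i\<leftarrow>is. l $ i) \<le> L ^ N"
          using prodL[of "is"] power_increasing[OF that(1) L1] by linarith
      qed (use MM that M0 S0 L1 in auto)
      finally show ?thesis .
    qed
    then show ?thesis
      unfolding schwartz_seminorm_def sum_distrib_left by (intro sum_mono) auto
  qed
  moreover have "L ^ N * MM \<ge> 0" using L1 MM0 by simp
  ultimately show ?thesis using that by blast
qed

lemma tempered_conv_op:
  assumes T: "tempered T"
  shows "tempered (\<lambda>\<eta>. T (conv_op l \<kappa> \<eta>))"
  unfolding tempered_def
proof (intro conjI allI impI)
  fix \<phi> \<psi> :: "real^'d \<Rightarrow> complex" and a b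
  assume s: "schwartz \<phi>" "schwartz \<psi>"
  have int: "integrable lborel (\<lambda>u. \<eta> (z + u) * \<kappa> u)" if \<eta>: "schwartz \<eta>" for \<eta> z
  proof -
    obtain B where "\<And>x. (1 + norm x) ^ 0 * norm (iter_pd [] \<eta> x) \<le> B"
      using schwartz_iter_pd_bounded[OF \<eta>] by blast
    moreover have "continuous_on UNIV (iter_pd [] \<eta>)"
      using \<eta> unfolding schwartz_def smooth_fun_def by blast
    ultimately show ?thesis
      by (intro integrable_conv_op[OF \<kappa>_integrable, where B = B]) auto
  qed
  have "conv_op l \<kappa> (\<lambda>x. a * \<phi> x + b * \<psi> x) = (\<lambda>y. a * conv_op l \<kappa> \<phi> y + b * conv_op l \<kappa> \<psi> y)"
  proof
    fix y
    have "conv_op l \<kappa> (\<lambda>x. a * \<phi> x + b * \<psi> x) y =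
        (LINT u|lborel. a * (\<phi> (l * y + u) * \<kappa> u) + b * (\<psi> (l * y + u) * \<kappa> u))"
      by (simp add: conv_op_def algebra_simps)
    also have "\<dots> = a * conv_op l \<kappa> \<phi> y + b * conv_op l \<kappa> \<psi> y"
      using int[OF s(1)] int[OF s(2)] by (simp add: conv_op_def)
    finally show "conv_op l \<kappa> (\<lambda>x. a * \<phi> x + b * \<psi> x) y = a * conv_op l \<kappa> \<phi> y + b * conv_op l \<kappa> \<psi> y" .
  qed
  then show "T (conv_op l \<kappa> (\<lambda>x. a * \<phi> x + b * \<psi> x)) = a * T (conv_op l \<kappa> \<phi>) + b * T (conv_op l \<kappa> \<psi>)"
    using T schwartz_conv_op[OF s(1)] schwartz_conv_op[OF s(2)] by (simp add: tempered_def)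
next
  obtain C N where CN: "\<And>\<phi>. schwartz \<phi> \<Longrightarrow> norm (T \<phi>) \<le> C * schwartz_seminorm N \<phi>"
    using T unfolding tempered_def by blast
  obtain K where K: "K \<ge> 0"
    "\<And>\<eta>. schwartz \<eta> \<Longrightarrow> schwartz_seminorm N (conv_op l \<kappa> \<eta>) \<le> K * schwartz_seminorm N \<eta>"
    using schwartz_seminorm_conv_op by blast
  have "norm (T (conv_op l \<kappa> \<eta>)) \<le> (\<bar>C\<bar> * K) * schwartz_seminorm N \<eta>" if \<eta>: "schwartz \<eta>" for \<eta>
  proof -
    have s0: "0 \<le> schwartz_seminorm N \<zeta>" if "schwartz \<zeta>" for \<zeta> :: "real^'d \<Rightarrow> complex"
      unfolding schwartz_seminorm_def
      by (intro sum_nonneg order_trans[OF _ schwartz_SUP_bound[OF that, of 0]]) auto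
    have "norm (T (conv_op l \<kappa> \<eta>)) \<le> C * schwartz_seminorm N (conv_op l \<kappa> \<eta>)"
      by (rule CN[OF schwartz_conv_op[OF \<eta>]])
    also have "\<dots> \<le> \<bar>C\<bar> * schwartz_seminorm N (conv_op l \<kappa> \<eta>)"
      by (intro mult_right_mono s0 schwartz_conv_op \<eta>) auto
    also have "\<dots> \<le> \<bar>C\<bar> * (K * schwartz_seminorm N \<eta>)"
      by (intro mult_left_mono K(2) \<eta>) auto
    finally show ?thesis by (simp add: mult.assoc)
  qed
  then show "\<exists>C N. \<forall>\<phi>. schwartz \<phi> \<longrightarrow> norm (T (conv_op l \<kappa> \<phi>)) \<le> C * schwartz_seminorm N \<phi>"
    by blast
qed

end

lemma iter_pd_zero: "iter_pd is (\<lambda>_. 0) = (\<lambda>_. 0)"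
  by (induction "is") (auto simp: pd_def fun_eq_iff)

lemma schwartz_zero: "schwartz (\<lambda>_. 0)"
  by (simp add: schwartz_def smooth_fun_def iter_pd_zero del: iter_pd.simps)

lemma tempered_zero: "tempered T \<Longrightarrow> T (\<lambda>_. 0) = 0"
proof -
  assume "tempered T"
  then have "T (\<lambda>x. 0 * 0 + 0 * 0) = 0 * T (\<lambda>_. 0) + 0 * T (\<lambda>_. 0)"
    using schwartz_zero unfolding tempered_def by blast
  then show ?thesis by simp
qed

lemma tempered_delta: "tempered (\<lambda>\<eta>::real^'d::finite \<Rightarrow> complex. \<eta> 0)"
proof -
  have "norm (\<eta> 0) \<le> 1 * schwartz_seminorm 0 \<eta>" if "schwartz \<eta>" for \<eta> :: "real^'d \<Rightarrow> complex"
  proof -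
    have "norm (\<eta> 0) \<le> (SUP x. (1 + norm x) ^ 0 * norm (iter_pd [] \<eta> x))"
      using schwartz_SUP_bound[OF that, of 0 0 "[]"] by simp
    then show ?thesis by (simp add: schwartz_seminorm_def)
  qed
  then show ?thesis unfolding tempered_def by blast
qed

section \<open>Quasi-norms with values in the extended nonnegative reals\<close>

lemma enn_powr_ennreal [simp]: "x \<ge> 0 \<Longrightarrow> enn_powr (ennreal x) r = ennreal (x powr r)"
  by (simp add: enn_powr_def)

lemma enn_powr_top [simp]: "enn_powr top r = top"
  by (simp add: enn_powr_def)

lemma enn_powr_0 [simp]: "enn_powr 0 r = 0"
  by (simp add: enn_powr_def)

lemma enn_powr_eq_0_iff: "enn_powr a r = 0 \<longleftrightarrow> a = 0"
  by (cases a) (auto simp: ennreal_eq_0_iff)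

lemma enn_powr_less_top: "enn_powr a r < top \<longleftrightarrow> a < top"
  by (cases a) auto

lemma enn_powr_mono: "a \<le> b \<Longrightarrow> r > 0 \<Longrightarrow> enn_powr a r \<le> enn_powr b r"
  by (cases a; cases b) (auto simp: ennreal_le_iff powr_mono2 top_unique)

lemma enn_powr_mult: "enn_powr (a * b) r = enn_powr a r * enn_powr b r"
proof (cases "a = top \<or> b = top")
  case True
  then show ?thesis
    by (cases "a = 0 \<or> b = 0") (auto simp: ennreal_top_mult ennreal_mult_top enn_powr_eq_0_iff)
next
  case False
  then show ?thesis
    by (cases a; cases b) (auto simp: ennreal_mult[symmetric] powr_mult)
qed

lemma enn_powr_powr: "enn_powr (enn_powr a r) s = enn_powr a (r * s)"
  by (cases a) (auto simp: powr_powr)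

lemma enn_powr_one_exp [simp]: "enn_powr a 1 = a"
  by (cases a) auto

lemma enn_powr_add: "a < top \<Longrightarrow> enn_powr a (r + s) = enn_powr a r * enn_powr a s"
  by (cases a) (auto simp: powr_add ennreal_mult[symmetric])

lemma enn2real_pos: "0 < q \<Longrightarrow> q \<noteq> top \<Longrightarrow> enn2real q > 0"
  by (simp add: enn2real_positive_iff less_top)

lemma lq_qnorm_upper:
  assumes q: "0 < q"
  shows "a k \<le> lq_qnorm q a"
proof (cases "q = \<infinity>")
  case True
  then show ?thesis by (auto simp: lq_qnorm_def intro: SUP_upper)
next
  case False
  let ?r = "enn2real q"
  have r: "?r > 0" using q False by (intro enn2real_pos) auto
  have "enn_powr (a k) ?r = (\<integral>\<^sup>+ j. enn_powr (a j) ?r * indicator {k} j \<partial>count_space UNIV)"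
    by (simp add: nn_integral_indicator_finite)
  also have "\<dots> \<le> (\<integral>\<^sup>+ j. enn_powr (a j) ?r \<partial>count_space UNIV)"
    by (intro nn_integral_mono) (auto simp: indicator_def)
  finally have "enn_powr (enn_powr (a k) ?r) (1 / ?r) \<le> lq_qnorm q a"
    using False r by (auto simp: lq_qnorm_def intro: enn_powr_mono)
  then show ?thesis using r by (simp add: enn_powr_powr)
qed

lemma lq_qnorm_mono:
  assumes q: "0 < q" and "\<And>k. a k \<le> b k"
  shows "lq_qnorm q a \<le> lq_qnorm q b"
proof (cases "q = \<infinity>")
  case True
  then show ?thesis using assms by (auto simp: lq_qnorm_def intro: SUP_mono)
next
  case False
  have r: "enn2real q > 0" using q False by (intro enn2real_pos) auto
  show ?thesis
    using False r assms(2) by (auto simp: lq_qnorm_def intro!: enn_powr_mono nn_integral_mono)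
qed

lemma lq_qnorm_cmult:
  assumes q: "0 < q"
  shows "lq_qnorm q (\<lambda>k. c * a k) = c * lq_qnorm q a"
proof (cases "q = \<infinity>")
  case True
  then show ?thesis by (simp add: lq_qnorm_def SUP_mult_left_ennreal)
next
  case False
  have r: "enn2real q > 0" using q False by (intro enn2real_pos) auto
  then show ?thesis
    using False by (simp add: lq_qnorm_def enn_powr_mult nn_integral_cmult enn_powr_powr)
qed

lemma lq_qnorm_indicator:
  assumes q: "0 < q" and J: "finite J" "J \<noteq> {}"
  shows "lq_qnorm q (\<lambda>k. if k \<in> J then c else 0) = c * ennreal (real (card J) powr (1 / enn2real q))"
proof (cases "q = \<infinity>")
  case True
  have "(SUP k. if k \<in> J then c else 0) = c"
  proof (intro antisym SUP_least)
    obtain k0 where "k0 \<in> J" using J by blast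
    then show "c \<le> (SUP k. if k \<in> J then c else 0)" by (intro SUP_upper2[of k0]) auto
  qed auto
  with True J show ?thesis by (simp add: lq_qnorm_def)
next
  case False
  let ?r = "enn2real q"
  have r: "?r > 0" using q False by (intro enn2real_pos) auto
  have "(\<integral>\<^sup>+ k. enn_powr (if k \<in> J then c else 0) ?r \<partial>count_space UNIV) =
      (\<integral>\<^sup>+ k. enn_powr c ?r * indicator J k \<partial>count_space UNIV)"
    by (intro nn_integral_cong) (auto simp: indicator_def)
  also have "\<dots> = enn_powr c ?r * ennreal (real (card J))"
    using J by (simp add: nn_integral_cmult_indicator emeasure_count_space ennreal_of_nat_eq_real_of_nat)
  finally show ?thesis
    using False r by (simp add: lq_qnorm_def enn_powr_mult enn_powr_powr)
qed

lemma lq_qnorm_single: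
  assumes q: "0 < q"
  shows "lq_qnorm q (\<lambda>k. if k = k0 then c else 0) = c"
  using lq_qnorm_indicator[OF q, of "{k0}" c] by simp

lemma lq_qnorm_antimono_exponent:
  assumes q0: "0 < q0" and le: "q0 \<le> q"
  shows "lq_qnorm q a \<le> lq_qnorm q0 a"
proof (cases "q = \<infinity>")
  case True
  then show ?thesis
    unfolding lq_qnorm_def[of q a] using lq_qnorm_upper[OF q0, of a] by (simp add: SUP_least)
next
  case False
  then have q0f: "q0 \<noteq> \<infinity>" using le by (auto simp: top_unique)
  let ?r = "enn2real q" and ?s = "enn2real q0"
  have r: "?r > 0" "?s > 0" "?s \<le> ?r"
    using q0 le False q0f by (auto intro!: enn2real_pos enn2real_mono simp: less_top)
  define S where "S = lq_qnorm q0 a"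
  show ?thesis
  proof (cases "S = top \<or> ?r = ?s")
    case True
    then show ?thesis
    proof
      assume "S = top"
      then show ?thesis by (simp add: S_def)
    next
      assume "?r = ?s"
      moreover have "ennreal ?r = q"
        using False by (intro ennreal_enn2real) (simp add: less_top)
      moreover have "ennreal ?s = q0"
        using q0f by (intro ennreal_enn2real) (simp add: less_top)
      ultimately have "q = q0" by metis
      then show ?thesis by simp
    qed
  next
    case S: False
    then have Sf: "S < top" by (simp add: less_top)
    have rr: "?r - ?s > 0" using S r(3) by linarith
    have aS: "a k \<le> S" for k unfolding S_def by (rule lq_qnorm_upper[OF q0])
    have "enn_powr (a k) ?r \<le> enn_powr S (?r - ?s) * enn_powr (a k) ?s" for k
    proof -
      have "enn_powr (a k) ?r = enn_powr (a k) (?r - ?s) * enn_powr (a k) ?s"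
        using enn_powr_add[of "a k" "?r - ?s" ?s] aS[of k] Sf by (simp add: le_less_trans)
      also have "\<dots> \<le> enn_powr S (?r - ?s) * enn_powr (a k) ?s"
        by (intro mult_right_mono enn_powr_mono aS rr) auto
      finally show ?thesis .
    qed
    then have "(\<integral>\<^sup>+ k. enn_powr (a k) ?r \<partial>count_space UNIV) \<le>
        (\<integral>\<^sup>+ k. enn_powr S (?r - ?s) * enn_powr (a k) ?s \<partial>count_space UNIV)"
      by (intro nn_integral_mono) auto
    also have "\<dots> = enn_powr S (?r - ?s) * (\<integral>\<^sup>+ k. enn_powr (a k) ?s \<partial>count_space UNIV)"
      by (simp add: nn_integral_cmult)
    also have "(\<integral>\<^sup>+ k. enn_powr (a k) ?s \<partial>count_space UNIV) = enn_powr S ?s"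
      using q0f r by (simp add: S_def lq_qnorm_def enn_powr_powr)
    also have "enn_powr S (?r - ?s) * enn_powr S ?s = enn_powr S ?r"
      using enn_powr_add[OF Sf, of "?r - ?s" ?s] by simp
    finally have "enn_powr (\<integral>\<^sup>+ k. enn_powr (a k) ?r \<partial>count_space UNIV) (1 / ?r) \<le>
        enn_powr (enn_powr S ?r) (1 / ?r)"
      using r by (intro enn_powr_mono) auto
    then show ?thesis
      using False r by (simp add: lq_qnorm_def enn_powr_powr S_def)
  qed
qed

lemma geometric_lq_qnorm_finite:
  assumes q: "0 < q" "q \<noteq> \<infinity>" and \<delta>: "\<delta> > 0"
  shows "lq_qnorm q (\<lambda>k::nat^'d::finite. ennreal (2 powr (- \<delta> * real (\<Sum>i\<in>UNIV. k $ i)))) < top"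
proof -
  let ?r = "enn2real q"
  have r: "?r > 0" using q by (intro enn2real_pos) auto
  define \<rho> where "\<rho> = 2 powr (- \<delta> * ?r)"
  have \<rho>: "0 < \<rho>" "\<rho> < 1"
    using \<delta> r by (auto simp: \<rho>_def powr_less_one)
  have "Infinite_Set_Sum.abs_summable_on (\<lambda>n. \<rho> ^ n) (UNIV :: nat set)"
    unfolding abs_summable_on_nat_iff' using \<rho> by (simp add: summable_geometric)
  then have "Infinite_Set_Sum.abs_summable_on (\<lambda>g::'d \<Rightarrow> nat. \<Prod>i\<in>UNIV. \<rho> ^ g i) (PiE UNIV (\<lambda>_. UNIV))"
    by (intro abs_summable_on_prod_PiE) auto
  then have int: "integrable (count_space (UNIV :: ('d \<Rightarrow> nat) set)) (\<lambda>g. \<Prod>i\<in>UNIV. \<rho> ^ g i)"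
    by (simp add: abs_summable_on_def PiE_UNIV_domain)
  have bij: "bij_betw (vec_nth :: nat^'d \<Rightarrow> 'd \<Rightarrow> nat) UNIV UNIV"
    by (rule bij_betwI[where g = vec_lambda]) auto
  have "integrable (count_space (UNIV :: (nat^'d) set)) (\<lambda>k. \<Prod>i\<in>UNIV. \<rho> ^ (k $ i))"
    using int integrable_bij_count_space[OF bij, of "\<lambda>g. \<Prod>i\<in>UNIV. \<rho> ^ g i"] by simp
  then have fin: "(\<integral>\<^sup>+ k. ennreal (\<Prod>i\<in>UNIV. \<rho> ^ ((k::nat^'d) $ i)) \<partial>count_space UNIV) < top"
    using \<rho> by (subst (asm) integrable_iff_bounded) (auto simp: abs_of_nonneg prod_nonneg)
  have "enn_powr (ennreal (2 powr (- \<delta> * real (\<Sum>i\<in>UNIV. k $ i)))) ?r = ennreal (\<Prod>i\<in>UNIV. \<rho> ^ (k $ i))"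
    for k :: "nat^'d"
  proof -
    have "(2 powr (- \<delta> * real (\<Sum>i\<in>UNIV. k $ i))) powr ?r = \<rho> powr real (\<Sum>i\<in>UNIV. k $ i)"
      by (simp add: \<rho>_def powr_powr mult_ac)
    also have "\<dots> = \<rho> ^ (\<Sum>i\<in>UNIV. k $ i)"
      using \<rho>(1) by (rule powr_realpow)
    finally show ?thesis by (simp add: power_sum)
  qed
  then show ?thesis
    using q fin by (simp add: lq_qnorm_def enn_powr_less_top)
qed

lemma Lp_qnorm_zero:
  assumes "0 < p"
  shows "Lp_qnorm p (\<lambda>_. 0) = 0"
  by (auto simp: Lp_qnorm_def bot_ennreal)

lemma nn_integral_dilation_measurable:
  fixes m :: "real^'d::finite"
  assumes m: "\<And>i. m $ i > 0" and [measurable]: "f \<in> borel_measurable borel"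
  shows "(\<integral>\<^sup>+ x. f x \<partial>lborel) = ennreal (\<Prod>i\<in>UNIV. m $ i) * (\<integral>\<^sup>+ x. f (m * x) \<partial>lborel)"
  by (subst lborel_dilation[OF m]) (simp add: nn_integral_density nn_integral_distr nn_integral_cmult)

text \<open>\<open>nn_integral\<close> is the lower integral, and dilations act on the simple functions below \<open>f\<close>; this
  covers the pieces of a distribution without proving them measurable.\<close>

lemma nn_integral_dilation:
  fixes l m :: "real^'d::finite" and f :: "real^'d \<Rightarrow> ennreal"
  assumes m: "\<And>i. m $ i > 0" and l: "\<And>i. l $ i > 0" and lm: "\<And>i. l $ i * m $ i = 1"
  shows "(\<integral>\<^sup>+ x. f (m * x) \<partial>lborel) = ennreal (\<Prod>i\<in>UNIV. l $ i) * (\<integral>\<^sup>+ x. f x \<partial>lborel)"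
proof -
  have le: "ennreal (\<Prod>i\<in>UNIV. l $ i) * (\<integral>\<^sup>+ x. f x \<partial>lborel) \<le> (\<integral>\<^sup>+ x. f (m * x) \<partial>lborel)"
    if m: "\<And>i. m $ i > 0" and l: "\<And>i. l $ i > 0" and lm: "\<And>i. l $ i * m $ i = 1"
    for l m :: "real^'d" and f :: "real^'d \<Rightarrow> ennreal"
  proof -
    have P: "ennreal (\<Prod>i\<in>UNIV. l $ i) * ennreal (\<Prod>i\<in>UNIV. m $ i) = 1"
      using l m by (simp add: ennreal_mult[symmetric] prod_nonneg less_imp_le prod.distrib[symmetric] lm)
    have "ennreal (\<Prod>i\<in>UNIV. l $ i) * (\<integral>\<^sup>+ x. f x \<partial>lborel) =
        (SUP g\<in>{g. simple_function lborel g \<and> g \<le> f}. ennreal (\<Prod>i\<in>UNIV. l $ i) * integral\<^sup>S lborel g)"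
      unfolding nn_integral_def by (rule SUP_mult_left_ennreal)
    also have "\<dots> \<le> (\<integral>\<^sup>+ x. f (m * x) \<partial>lborel)"
    proof (rule SUP_least)
      fix g assume "g \<in> {g. simple_function lborel g \<and> g \<le> f}"
      then have g: "simple_function lborel g" "g \<le> f" by auto
      then have [measurable]: "g \<in> borel_measurable borel"
        using borel_measurable_simple_function by fastforce
      have "ennreal (\<Prod>i\<in>UNIV. l $ i) * integral\<^sup>S lborel g =
          (ennreal (\<Prod>i\<in>UNIV. l $ i) * ennreal (\<Prod>i\<in>UNIV. m $ i)) * (\<integral>\<^sup>+ x. g (m * x) \<partial>lborel)"
        using nn_integral_dilation_measurable[OF m, of g]
        by (simp add: nn_integral_eq_simple_integral[OF g(1), symmetric] mult.assoc)
      also have "\<dots> \<le> (\<integral>\<^sup>+ x. f (m * x) \<partial>lborel)"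
        using g(2) by (auto simp: P le_fun_def intro: nn_integral_mono)
      finally show "ennreal (\<Prod>i\<in>UNIV. l $ i) * integral\<^sup>S lborel g \<le> (\<integral>\<^sup>+ x. f (m * x) \<partial>lborel)" .
    qed
    finally show ?thesis .
  qed
  have P: "ennreal (\<Prod>i\<in>UNIV. l $ i) * ennreal (\<Prod>i\<in>UNIV. m $ i) = 1"
    using l m by (simp add: ennreal_mult[symmetric] prod_nonneg less_imp_le prod.distrib[symmetric] lm)
  have ml: "m * (l * x) = x" for x
    using lm by (simp add: vec_eq_iff mult.assoc[symmetric] mult.commute[of "m $ _"])
  have "ennreal (\<Prod>i\<in>UNIV. m $ i) * (\<integral>\<^sup>+ x. f (m * x) \<partial>lborel) \<le> (\<integral>\<^sup>+ x. f (m * (l * x)) \<partial>lborel)"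
    using lm by (intro le[OF l m]) (simp add: mult.commute)
  from mult_left_mono[OF this[unfolded ml], of "ennreal (\<Prod>i\<in>UNIV. l $ i)"]
  have "(\<integral>\<^sup>+ x. f (m * x) \<partial>lborel) \<le> ennreal (\<Prod>i\<in>UNIV. l $ i) * (\<integral>\<^sup>+ x. f x \<partial>lborel)"
    by (simp add: mult.assoc[symmetric] P)
  with le[OF m l lm] show ?thesis by (intro antisym)
qed

lemma AE_dilation:
  fixes l m :: "real^'d::finite"
  assumes m: "\<And>i. m $ i > 0" and l: "\<And>i. l $ i > 0" and lm: "\<And>i. l $ i * m $ i = 1"
  shows "(AE x in lborel. P (m * x)) \<longleftrightarrow> (AE x in lborel. P x)"
proof -
  have le: "AE x in lborel. P (m * x)" if "AE x in lborel. P x" and m: "\<And>i. m $ i > 0"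
    for m :: "real^'d" and P
  proof -
    have "0 < (\<Prod>i\<in>UNIV. m $ i)" using m by (intro prod_pos) auto
    moreover have "AE x in density (distr lborel borel ((*) m)) (\<lambda>_. ennreal (\<Prod>i\<in>UNIV. m $ i)). P x"
      using that(1) by (subst (asm) lborel_dilation[OF m])
    ultimately have "AE x in distr lborel borel ((*) m). P x"
      by (simp add: AE_density)
    then show ?thesis by (rule AE_distrD[rotated]) simp
  qed
  have ml: "m * (l * x) = x" for x
    using lm by (simp add: vec_eq_iff mult.assoc[symmetric] mult.commute[of "m $ _"])
  show ?thesis
    using le[OF _ m, of P] le[OF _ l, of "\<lambda>x. P (m * x)"] unfolding ml by blast
qed

lemma Lp_qnorm_dilation:
  fixes l m :: "real^'d::finite"
  assumes m: "\<And>i. m $ i > 0" and l: "\<And>i. l $ i > 0" and lm: "\<And>i. l $ i * m $ i = 1"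
  shows "Lp_qnorm p (\<lambda>x. g (m * x)) = ennreal ((\<Prod>i\<in>UNIV. l $ i) powr (1 / enn2real p)) * Lp_qnorm p g"
proof -
  have P: "0 < (\<Prod>i\<in>UNIV. l $ i)" using l by (intro prod_pos) auto
  show ?thesis
  proof (cases "p = \<infinity>")
    case True
    with P show ?thesis
      by (simp add: Lp_qnorm_def AE_dilation[OF m l lm, of "\<lambda>x. ennreal (cmod (g x)) \<le> _"]
          less_imp_neq[OF l, symmetric])
  next
    case False
    with P show ?thesis
      by (simp add: Lp_qnorm_def nn_integral_dilation[OF m l lm, of "\<lambda>x. ennreal (cmod (g x) powr _)"]
          enn_powr_mult)
  qed
qed

lemma Lp_qnorm_cmult:
  assumes p: "0 < p" and g[measurable]: "g \<in> borel_measurable borel" and c: "c \<noteq> 0"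
  shows "Lp_qnorm p (\<lambda>x. c * g x) = ennreal (norm c) * Lp_qnorm p g"
proof (cases "p = \<infinity>")
  case True
  have le: "ennreal (norm (inverse c)) * Lp_qnorm p (\<lambda>x. c * g x) \<le> Lp_qnorm p g"
    if c: "c \<noteq> 0" for c and g :: "'a \<Rightarrow> complex"
  proof -
    have "ennreal (norm (inverse c)) * Lp_qnorm p (\<lambda>x. c * g x) \<le> C"
      if C: "AE x in lborel. ennreal (norm (g x)) \<le> C" for C
    proof -
      have "AE x in lborel. ennreal (norm (c * g x)) \<le> ennreal (norm c) * C"
        using C by eventually_elim (simp add: norm_mult ennreal_mult mult_left_mono)
      then have "Lp_qnorm p (\<lambda>x. c * g x) \<le> ennreal (norm c) * C"
        using True by (simp add: Lp_qnorm_def Inf_lower)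
      then have "ennreal (norm (inverse c)) * Lp_qnorm p (\<lambda>x. c * g x) \<le>
          ennreal (norm (inverse c)) * (ennreal (norm c) * C)"
        by (intro mult_left_mono) auto
      also have "\<dots> = C"
        using c by (simp add: mult.assoc[symmetric] ennreal_mult[symmetric] norm_inverse)
      finally show ?thesis .
    qed
    then show ?thesis
      using True by (subst (2) Lp_qnorm_def) (auto intro!: Inf_greatest)
  qed
  have "ennreal (norm c) * Lp_qnorm p g \<le> Lp_qnorm p (\<lambda>x. c * g x)"
    using le[of "inverse c" "\<lambda>x. c * g x"] c by (simp add: mult.assoc[symmetric])
  moreover have "ennreal (norm c) * (ennreal (norm (inverse c)) * Lp_qnorm p (\<lambda>x. c * g x))
      \<le> ennreal (norm c) * Lp_qnorm p g"
    using c by (intro mult_left_mono le) auto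
  moreover have "ennreal (norm c) * (ennreal (norm (inverse c)) * Lp_qnorm p (\<lambda>x. c * g x)) =
      Lp_qnorm p (\<lambda>x. c * g x)"
    using c by (simp add: mult.assoc[symmetric] ennreal_mult[symmetric] norm_inverse)
  ultimately show ?thesis by (intro antisym) auto
next
  case False
  let ?r = "enn2real p"
  have r: "?r > 0" using p False by (intro enn2real_pos) auto
  have "(\<integral>\<^sup>+ x. ennreal (norm (c * g x) powr ?r) \<partial>lborel) =
      (\<integral>\<^sup>+ x. ennreal (norm c powr ?r) * ennreal (norm (g x) powr ?r) \<partial>lborel)"
    by (simp add: norm_mult powr_mult ennreal_mult)
  also have "\<dots> = ennreal (norm c powr ?r) * (\<integral>\<^sup>+ x. ennreal (norm (g x) powr ?r) \<partial>lborel)"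
    by (intro nn_integral_cmult) auto
  finally show ?thesis
    using False r by (simp add: Lp_qnorm_def enn_powr_mult powr_powr)
qed

lemma Lp_qnorm_eq_0D:
  assumes p: "0 < p" and g[measurable]: "g \<in> borel_measurable borel" and z: "Lp_qnorm p g = 0"
  shows "AE x in lborel. g x = 0"
proof (cases "p = \<infinity>")
  case True
  have "AE x in lborel. \<forall>n. ennreal (norm (g x)) \<le> ennreal (1 / real (Suc n))"
  proof (rule AE_all_countable[THEN iffD2], rule allI)
    fix n
    have "Inf {C. AE x in lborel. ennreal (norm (g x)) \<le> C} < ennreal (1 / real (Suc n))"
      using True z by (simp add: Lp_qnorm_def)
    then obtain C where "AE x in lborel. ennreal (norm (g x)) \<le> C" "C < ennreal (1 / real (Suc n))"
      by (auto simp: Inf_less_iff)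
    then show "AE x in lborel. ennreal (norm (g x)) \<le> ennreal (1 / real (Suc n))"
      by (elim eventually_mono) (meson order_trans less_imp_le)
  qed
  then show ?thesis
  proof eventually_elim
    case (elim x)
    then have "norm (g x) \<le> 1 / real (Suc n)" for n by (simp add: ennreal_le_iff del: of_nat_Suc)
    then have "norm (g x) \<le> 0"
      by (intro LIMSEQ_le_const[OF LIMSEQ_Suc[OF lim_1_over_n]]) auto
    then show ?case by simp
  qed
next
  case False
  then have "(\<integral>\<^sup>+ x. ennreal (norm (g x) powr enn2real p) \<partial>lborel) = 0"
    using z by (simp add: Lp_qnorm_def enn_powr_eq_0_iff)
  then show ?thesis
    by (subst (asm) nn_integral_0_iff_AE) (auto simp: ennreal_eq_0_iff)
qed

lemma Lp_qnorm_inv_fourier_tensor_finite: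
  fixes h :: "'d::finite \<Rightarrow> real \<Rightarrow> real"
  assumes p: "0 < p" and h: "\<And>i. bump R (h i)"
  shows "Lp_qnorm p (inv_fourier (\<lambda>\<xi>. complex_of_real (\<Prod>i\<in>UNIV. h i (\<xi> $ i)))) < top"
proof -
  let ?k = "\<lambda>i. inv_fourier1 (\<lambda>s. complex_of_real (h i s))"
  have eq: "inv_fourier (\<lambda>\<xi>. complex_of_real (\<Prod>i\<in>UNIV. h i (\<xi> $ i))) = (\<lambda>u. \<Prod>i\<in>UNIV. ?k i (u $ i))"
    by (intro ext inv_fourier_tensor[OF h])
  show ?thesis
  proof (cases "p = \<infinity>")
    case True
    define C where "C i = (LINT \<xi>|lborel. norm (complex_of_real (h i \<xi>)))" for i
    have C: "norm (?k i s) \<le> C i" for i s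
      unfolding C_def by (rule norm_inv_fourier1_le)
    have "norm (\<Prod>i\<in>UNIV. ?k i (u $ i)) \<le> (\<Prod>i\<in>UNIV. C i)" for u :: "real^'d"
      unfolding prod_norm[symmetric] by (intro prod_mono) (auto simp: C)
    then have "Lp_qnorm p (\<lambda>u::real^'d. \<Prod>i\<in>UNIV. ?k i (u $ i)) \<le> ennreal (\<Prod>i\<in>UNIV. C i)"
      using True by (auto simp: Lp_qnorm_def intro!: Inf_lower ennreal_leI)
    then show ?thesis unfolding eq using ennreal_less_top le_less_trans by blast
  next
    case False
    let ?r = "enn2real p"
    have r: "?r > 0" using p False by (intro enn2real_pos) auto
    obtain n :: nat where n: "2 / ?r \<le> real n" using real_arch_simple by blast
    then have nr: "2 \<le> real n * ?r" using r by (simp add: field_simps)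
    have int: "integrable lborel (\<lambda>s. norm (?k i s) powr ?r)" for i
    proof -
      obtain C where C: "\<And>s. (1 + \<bar>s\<bar>) ^ n * norm (?k i s) \<le> C"
        using inv_fourier1_decay[OF h[of i]] by meson
      have [measurable]: "?k i \<in> borel_measurable borel"
        by (rule inv_fourier1_measurable[OF bump_integrable[OF h[of i]]])
      have C0: "0 \<le> C" by (rule order_trans[OF _ C[of 0]]) simp
      show ?thesis
      proof (rule Bochner_Integration.integrable_bound)
        show "integrable lborel (\<lambda>s::real. C powr ?r * inverse (1 + \<bar>s\<bar>) ^ 2)"
          using integrable_inverse_1_plus_abs_square by simp
        show "AE s in lborel. norm (norm (?k i s) powr ?r) \<le> norm (C powr ?r * inverse (1 + \<bar>s\<bar>) ^ 2)"
        proof (intro AE_I2)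
          fix s :: real
          have s1: "1 + \<bar>s\<bar> > 0" by simp
          have "norm (?k i s) \<le> C * inverse ((1 + \<bar>s\<bar>) ^ n)"
            using C[of s] s1 by (simp add: field_simps)
          also have "inverse ((1 + \<bar>s\<bar>) ^ n) = (1 + \<bar>s\<bar>) powr (- real n)"
            using s1 by (simp add: powr_minus powr_realpow)
          finally have "norm (?k i s) powr ?r \<le> (C * (1 + \<bar>s\<bar>) powr (- real n)) powr ?r"
            using r by (intro powr_mono2) auto
          also have "\<dots> = C powr ?r * (1 + \<bar>s\<bar>) powr (- (real n * ?r))"
            using C0 by (simp add: powr_mult powr_powr)
          also have "\<dots> \<le> C powr ?r * (1 + \<bar>s\<bar>) powr (- 2)"
            using nr by (intro mult_left_mono powr_mono) auto
          also have "(1 + \<bar>s\<bar>) powr (- 2) = inverse (1 + \<bar>s\<bar>) ^ 2"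
            using s1 by (simp add: powr_minus power_inverse)
          finally show "norm (norm (?k i s) powr ?r) \<le> norm (C powr ?r * inverse (1 + \<bar>s\<bar>) ^ 2)"
            by simp
        qed
      qed measurable
    qed
    have "integrable lborel (\<lambda>u::real^'d. \<Prod>i\<in>UNIV. norm (?k i (u $ i)) powr ?r)"
      by (rule integrable_lborel_tensor[OF int])
    then have "(\<integral>\<^sup>+ u. ennreal (\<Prod>i\<in>UNIV. norm (?k i ((u::real^'d) $ i)) powr ?r) \<partial>lborel) < top"
      by (subst (asm) integrable_iff_bounded) (auto simp: abs_of_nonneg prod_nonneg)
    moreover have "norm (\<Prod>i\<in>UNIV. ?k i (u $ i)) powr ?r = (\<Prod>i\<in>UNIV. norm (?k i (u $ i)) powr ?r)" for u :: "real^'d"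
      by (simp add: prod_norm[symmetric] prod_powr_distrib)
    ultimately show ?thesis
      unfolding eq using False by (simp add: Lp_qnorm_def enn_powr_less_top)
  qed
qed

lemma Lp_qnorm_inv_fourier_pos:
  assumes p: "0 < p" and h: "rapid_multiplier h" and ne: "h \<xi> \<noteq> 0"
  shows "Lp_qnorm p (inv_fourier h) > 0"
proof (rule ccontr)
  assume "\<not> ?thesis"
  then have z: "Lp_qnorm p (inv_fourier h) = 0" by (simp add: not_less)
  have [measurable]: "inv_fourier h \<in> borel_measurable borel"
    using rapid_multiplier_integrable(2)[OF h] by (auto dest: borel_measurable_integrable)
  have "AE u in lborel. inv_fourier h u = 0"
    by (rule Lp_qnorm_eq_0D[OF p _ z]) measurable
  then have "AE u in lborel. cis (- (2 * pi * (u \<bullet> \<xi>))) * inv_fourier h u = 0"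
    by (auto elim!: eventually_mono)
  then have "(LINT u|lborel. cis (- (2 * pi * (u \<bullet> \<xi>))) * inv_fourier h u) = 0"
    by (intro integral_eq_zero_AE)
  with h ne show False by (simp add: rapid_multiplier_def)
qed

section \<open>Smoothness of inverse transforms\<close>

lemma bump_times_id:
  assumes "bump R h"
  shows "bump R (\<lambda>x. x * h x)"
proof -
  obtain D where D: "D 0 = h" "\<And>n x. (D n has_real_derivative D (Suc n) x) (at x)"
    and z: "\<And>x. \<bar>x\<bar> > R \<Longrightarrow> h x = 0"
    using assms unfolding bump_def by metis
  define E where "E n x = x * D n x + real n * D (n - 1) x" for n x
  have "(E n has_real_derivative E (Suc n) x) (at x)" for n x
  proof (cases n)
    case 0
    then show ?thesis
      unfolding E_def[abs_def] by (auto intro!: derivative_eq_intros D(2) simp: E_def)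
  next
    case (Suc k)
    then show ?thesis
      unfolding E_def[abs_def] by (auto intro!: derivative_eq_intros D(2) simp: E_def algebra_simps)
  qed
  then show ?thesis
    unfolding bump_def using z D(1) by (intro conjI exI[of _ E]) (auto simp: E_def)
qed

lemma bump_times_power: "bump R h \<Longrightarrow> bump R (\<lambda>x. x ^ n * h x)"
proof (induction n)
  case (Suc n)
  from bump_times_id[OF Suc.IH[OF Suc.prems]] show ?case by (simp add: mult.assoc)
qed simp

lemma inv_fourier1_eq_integral:
  assumes h: "bump R h"
  shows "inv_fourier1 (\<lambda>x. complex_of_real (h x)) s =
    integral (cbox (-R) R) (\<lambda>\<xi>. cis (2 * pi * (s * \<xi>)) * complex_of_real (h \<xi>))"
proof -
  let ?f = "\<lambda>\<xi>. cis (2 * pi * (s * \<xi>)) * complex_of_real (h \<xi>)"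
  have z: "h x = 0" if "x \<notin> cbox (-R) R" for x
    using h that by (force simp: bump_def)
  have int: "integrable lborel ?f"
    by (intro integrable_cis_mult bump_integrable[OF h]) auto
  have "(?f has_integral inv_fourier1 (\<lambda>x. complex_of_real (h x)) s) UNIV"
    unfolding inv_fourier1_def by (rule has_integral_integral_lborel[OF int])
  also have "?f = (\<lambda>\<xi>. if \<xi> \<in> cbox (-R) R then ?f \<xi> else 0)"
    using z by (force simp: fun_eq_iff)
  finally have "(?f has_integral inv_fourier1 (\<lambda>x. complex_of_real (h x)) s) (cbox (-R) R)"
    by (simp only: has_integral_restrict_UNIV)
  then show ?thesis by (simp add: integral_unique)
qed

lemma inv_fourier1_has_derivative:
  assumes h: "bump R h"
  shows "(inv_fourier1 (\<lambda>x. complex_of_real (h x)) has_vector_derivative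
    2 * pi * \<i> * inv_fourier1 (\<lambda>x. complex_of_real (x * h x)) s) (at s)"
proof -
  let ?f = "\<lambda>s \<xi>. cis (2 * pi * (s * \<xi>)) * complex_of_real (h \<xi>)"
  let ?f' = "\<lambda>s \<xi>. (2 * pi * \<i>) * (cis (2 * pi * (s * \<xi>)) * complex_of_real (\<xi> * h \<xi>))"
  have c: "continuous_on A h" for A
    using bump_continuous[OF h] continuous_on_subset by blast
  have "((\<lambda>s. integral (cbox (-R) R) (?f s)) has_vector_derivative integral (cbox (-R) R) (?f' s)) (at s within UNIV)"
  proof (rule leibniz_rule_vector_derivative)
    fix s \<xi> :: real
    have "((\<lambda>s. cis (2 * pi * (s * \<xi>))) has_vector_derivative (2 * pi * \<xi>) *\<^sub>R (\<i> * cis (2 * pi * (s * \<xi>)))) (at s)"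
      unfolding has_vector_derivative_def
      by (rule has_derivative_eq_rhs, (rule derivative_intros)+) (auto simp: fun_eq_iff scaleR_conv_of_real)
    from has_vector_derivative_mult[OF this has_vector_derivative_const]
    have "((\<lambda>s. cis (2 * pi * (s * \<xi>)) * complex_of_real (h \<xi>)) has_vector_derivative
        cis (2 * pi * (s * \<xi>)) * 0 + (2 * pi * \<xi>) *\<^sub>R (\<i> * cis (2 * pi * (s * \<xi>))) * complex_of_real (h \<xi>)) (at s)" .
    then show "((\<lambda>s. ?f s \<xi>) has_vector_derivative ?f' s \<xi>) (at s within UNIV)"
      by (simp add: scaleR_conv_of_real mult_ac)
  next
    fix s :: real
    show "?f s integrable_on cbox (-R) R"
      by (intro integrable_continuous continuous_intros c)
  next
    have c2: "continuous_on A (\<lambda>x. h (snd x))" for A :: "(real \<times> real) set"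
      by (rule continuous_on_compose2[OF c]) (auto intro: continuous_intros)
    show "continuous_on (UNIV \<times> cbox (-R) R) (\<lambda>(s, \<xi>). ?f' s \<xi>)"
      unfolding split_beta by (intro continuous_intros c2)
  qed auto
  moreover have "inv_fourier1 (\<lambda>x. complex_of_real (h x)) = (\<lambda>s. integral (cbox (-R) R) (?f s))"
    by (rule ext) (rule inv_fourier1_eq_integral[OF h])
  moreover have "2 * pi * \<i> * inv_fourier1 (\<lambda>x. complex_of_real (x * h x)) s = integral (cbox (-R) R) (?f' s)"
    by (simp only: inv_fourier1_eq_integral[OF bump_times_id[OF h]] integral_mult_right)
  ultimately show ?thesis by (simp only:)
qed

lemma schwartz_tensor:
  fixes E :: "'d::finite \<Rightarrow> nat \<Rightarrow> real \<Rightarrow> complex"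
  assumes D: "\<And>i n s. (E i n has_vector_derivative E i (Suc n) s) (at s)"
    and decay: "\<And>i n m. \<exists>C. \<forall>s. (1 + \<bar>s\<bar>) ^ m * norm (E i n s) \<le> C"
  shows "schwartz (\<lambda>y::real^'d. \<Prod>i\<in>UNIV. E i 0 (y $ i))"
proof -
  define F where "F c y = (\<Prod>i\<in>UNIV. E i (c i) (y $ i))" for c :: "'d \<Rightarrow> nat" and y :: "real^'d"
  have FD: "((\<lambda>s. F c (x + s *\<^sub>R axis i 1)) has_vector_derivative F (c(i := Suc (c i))) x) (at 0)" for c x i
  proof -
    define P where "P = (\<Prod>j\<in>UNIV - {i}. E j (c j) (x $ j))"
    have eq: "F c (x + s *\<^sub>R axis i 1) = E i (c i) (x $ i + s) * P" for s
    proof -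
      have "F c (x + s *\<^sub>R axis i 1) = E i (c i) ((x + s *\<^sub>R axis i 1) $ i) *
          (\<Prod>j\<in>UNIV - {i}. E j (c j) ((x + s *\<^sub>R axis i 1) $ j))"
        unfolding F_def by (rule prod.remove) auto
      also have "(\<Prod>j\<in>UNIV - {i}. E j (c j) ((x + s *\<^sub>R axis i 1) $ j)) = P"
        unfolding P_def by (intro prod.cong) (auto simp: axis_def)
      finally show ?thesis by (simp add: axis_def)
    qed
    have eq': "F (c(i := Suc (c i))) x = E i (Suc (c i)) (x $ i) * P"
      unfolding F_def P_def by (subst prod.remove[of _ i]) (auto intro!: prod.cong)
    have "((\<lambda>s. E i (c i) (x $ i + s)) has_vector_derivative E i (Suc (c i)) (x $ i)) (at 0)"
      unfolding has_vector_derivative_shift_iff by (rule D)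
    from has_vector_derivative_mult[OF this has_vector_derivative_const, of P]
    show ?thesis unfolding eq eq' by simp
  qed
  have Ec: "continuous_on UNIV (E i n)" for i n
    using D has_vector_derivative_continuous by (intro continuous_at_imp_continuous_on) blast
  have Fc: "continuous_on UNIV (F c)" for c
    unfolding F_def[abs_def]
    by (intro continuous_on_prod continuous_on_compose2[OF Ec]) (auto intro: continuous_intros)
  have iter: "iter_pd is (F c) = F (\<lambda>i. c i + count_list is i)" for "is" c
  proof (induction "is")
    case (Cons i "is")
    have upd: "(\<lambda>j. c j + count_list is j)(i := Suc (c i + count_list is i)) = (\<lambda>j. c j + count_list (i # is) j)"
      by auto
    show ?case
    proof
      fix x
      show "iter_pd (i # is) (F c) x = F (\<lambda>j. c j + count_list (i # is) j) x"
        using vector_derivative_at[OF FD[of "\<lambda>j. c j + count_list is j" x i, unfolded upd]]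
        by (simp only: Cons.IH pd_def iter_pd.simps)
    qed
  qed simp
  have bd: "\<exists>B. \<forall>y. norm ((1 + norm y) ^ m * norm (F c y)) \<le> B" for c m
  proof -
    have "\<forall>i. \<exists>C. \<forall>s. (1 + \<bar>s\<bar>) ^ m * norm (E i (c i) s) \<le> C"
      using decay by blast
    then obtain C where C: "\<And>i s. (1 + \<bar>s\<bar>) ^ m * norm (E i (c i) s) \<le> C i"
      by metis
    have "norm ((1 + norm y) ^ m * norm (F c y)) \<le> (\<Prod>i\<in>UNIV. C i)" for y
    proof -
      have "(1 + norm y) ^ m * norm (F c y) \<le> (\<Prod>i\<in>UNIV. (1 + \<bar>y $ i\<bar>)) ^ m * norm (F c y)"
        by (intro mult_right_mono power_mono one_plus_norm_le_prod) auto
      also have "\<dots> = (\<Prod>i\<in>UNIV. (1 + \<bar>y $ i\<bar>) ^ m * norm (E i (c i) (y $ i)))"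
        by (simp add: F_def prod_norm[symmetric] prod.distrib prod_power_distrib)
      also have "\<dots> \<le> (\<Prod>i\<in>UNIV. C i)"
        by (intro prod_mono) (auto simp: C)
      finally show ?thesis by simp
    qed
    then show ?thesis by blast
  qed
  have "schwartz (F (\<lambda>_. 0))"
    unfolding schwartz_def smooth_fun_def
  proof (intro conjI allI)
    fix "is" i x
    show "((\<lambda>s. iter_pd is (F (\<lambda>_. 0)) (x + s *\<^sub>R axis i 1)) has_vector_derivative
        iter_pd (i # is) (F (\<lambda>_. 0)) x) (at 0)"
    proof -
      have "(\<lambda>j. 0 + count_list is j)(i := Suc (0 + count_list is i)) = (\<lambda>j. 0 + count_list (i # is) j)"
        by auto
      with FD[of "\<lambda>j. 0 + count_list is j" x i] show ?thesis by (simp only: iter)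
    qed
  next
    fix "is" n
    show "bounded (range (\<lambda>x. (1 + norm x) ^ n * norm (iter_pd is (F (\<lambda>_. 0)) x)))"
      unfolding bounded_iff iter using bd by fast
  qed (simp add: iter Fc)
  then show ?thesis by (simp add: F_def[abs_def])
qed

lemma schwartz_inv_fourier_tensor:
  fixes h :: "'d::finite \<Rightarrow> real \<Rightarrow> real"
  assumes h: "\<And>i. bump R (h i)"
  shows "schwartz (\<lambda>y. inv_fourier (\<lambda>\<xi>. complex_of_real (\<Prod>i\<in>UNIV. h i (\<xi> $ i))) (- y))"
proof -
  define E where "E i n s = (- (2 * pi * \<i>)) ^ n * inv_fourier1 (\<lambda>\<xi>. complex_of_real (\<xi> ^ n * h i \<xi>)) (- s)" for i n s
  have D: "(E i n has_vector_derivative E i (Suc n) s) (at s)" for i n s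
  proof -
    let ?k = "inv_fourier1 (\<lambda>\<xi>. complex_of_real (\<xi> ^ n * h i \<xi>))"
    have "(?k has_vector_derivative 2 * pi * \<i> * inv_fourier1 (\<lambda>x. complex_of_real (x * (x ^ n * h i x))) (- s)) (at (- s))"
      by (rule inv_fourier1_has_derivative[OF bump_times_power[OF h]])
    then have "(?k \<circ> uminus has_vector_derivative (-1) *\<^sub>R (2 * pi * \<i> * inv_fourier1 (\<lambda>x. complex_of_real (x * (x ^ n * h i x))) (- s))) (at s)"
      by (intro vector_diff_chain_at) (auto intro!: derivative_eq_intros)
    from has_vector_derivative_mult_right[OF this, of "(- (2 * pi * \<i>)) ^ n"]
    show ?thesis
      unfolding E_def[abs_def] by (simp add: o_def mult_ac)
  qed
  have "\<exists>C. \<forall>s. (1 + \<bar>s\<bar>) ^ m * norm (E i n s) \<le> C" for i n m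
  proof -
    obtain C where C: "\<And>s. (1 + \<bar>s\<bar>) ^ m * norm (inv_fourier1 (\<lambda>\<xi>. complex_of_real (\<xi> ^ n * h i \<xi>)) s) \<le> C"
      using inv_fourier1_decay[OF bump_times_power[OF h]] by meson
    have "(1 + \<bar>s\<bar>) ^ m * norm (E i n s) \<le> norm ((- (2 * pi * \<i>)) ^ n) * C" for s
    proof -
      have "(1 + \<bar>s\<bar>) ^ m * norm (E i n s) =
          norm ((- (2 * pi * \<i>)) ^ n) * ((1 + \<bar>- s\<bar>) ^ m * norm (inv_fourier1 (\<lambda>\<xi>. complex_of_real (\<xi> ^ n * h i \<xi>)) (- s)))"
        unfolding E_def norm_mult by (simp only: abs_minus_cancel mult_ac)
      also have "\<dots> \<le> norm ((- (2 * pi * \<i>)) ^ n) * C"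
        by (intro mult_left_mono C norm_ge_zero)
      finally show ?thesis .
    qed
    then show ?thesis by blast
  qed
  then have "schwartz (\<lambda>y::real^'d. \<Prod>i\<in>UNIV. E i 0 (y $ i))"
    by (intro schwartz_tensor D) blast
  moreover have "(\<lambda>y::real^'d. \<Prod>i\<in>UNIV. E i 0 (y $ i)) =
      (\<lambda>y. inv_fourier (\<lambda>\<xi>. complex_of_real (\<Prod>i\<in>UNIV. h i (\<xi> $ i))) (- y))"
    unfolding inv_fourier_tensor[OF h] by (simp add: E_def)
  ultimately show ?thesis by simp
qed

section \<open>Interchanging a tempered distribution with an integral\<close>

lemma iter_pd_translate: "iter_pd is (\<lambda>y. \<eta> (y + u)) = (\<lambda>y. iter_pd is \<eta> (y + u))"
proof (induction "is")
  case (Cons i "is")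
  then show ?case by (simp add: pd_def fun_eq_iff add_ac)
qed simp

lemma one_plus_norm_shift:
  fixes y u :: "'a::real_normed_vector"
  shows "(1 + norm y) ^ n \<le> (1 + norm (y + u)) ^ n * (1 + norm u) ^ n"
proof -
  have "1 + norm y \<le> 1 + (norm (y + u) + norm u)"
    using norm_triangle_ineq4[of "y + u" u] by simp
  also have "\<dots> \<le> (1 + norm (y + u)) * (1 + norm u)" by (simp add: algebra_simps)
  finally show ?thesis
    unfolding power_mult_distrib[symmetric] by (intro power_mono) auto
qed

lemma translate_weighted_bound:
  fixes y u :: "real^'d::finite"
  assumes B: "\<And>x. (1 + norm x) ^ n * norm (\<zeta> x) \<le> B"
  shows "(1 + norm y) ^ n * norm (\<zeta> (y + u)) \<le> B * (1 + norm u) ^ n"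
proof -
  have "(1 + norm y) ^ n * norm (\<zeta> (y + u)) \<le> ((1 + norm (y + u)) ^ n * (1 + norm u) ^ n) * norm (\<zeta> (y + u))"
    by (intro mult_right_mono one_plus_norm_shift) auto
  also have "\<dots> = ((1 + norm (y + u)) ^ n * norm (\<zeta> (y + u))) * (1 + norm u) ^ n" by (simp add: mult_ac)
  also have "\<dots> \<le> B * (1 + norm u) ^ n"
    by (intro mult_right_mono B) auto
  finally show ?thesis .
qed

lemma schwartz_translate:
  assumes \<eta>: "schwartz \<eta>"
  shows "schwartz (\<lambda>y. \<eta> (y + u))"
  unfolding schwartz_def smooth_fun_def
proof (intro conjI allI)
  fix "is"
  have "continuous_on UNIV (iter_pd is \<eta>)"
    using \<eta> unfolding schwartz_def smooth_fun_def by blast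
  then show "continuous_on UNIV (iter_pd is (\<lambda>y. \<eta> (y + u)))"
    unfolding iter_pd_translate by (rule continuous_on_compose2) (auto intro: continuous_intros)
next
  fix "is" i x
  have "((\<lambda>s. iter_pd is \<eta> ((x + u) + s *\<^sub>R axis i 1)) has_vector_derivative iter_pd (i # is) \<eta> (x + u)) (at 0)"
    using \<eta> unfolding schwartz_def smooth_fun_def by blast
  then show "((\<lambda>s. iter_pd is (\<lambda>y. \<eta> (y + u)) (x + s *\<^sub>R axis i 1)) has_vector_derivative
      iter_pd (i # is) (\<lambda>y. \<eta> (y + u)) x) (at 0)"
    unfolding iter_pd_translate by (simp only: add_ac)
next
  fix "is" n
  obtain B where "\<And>x. (1 + norm x) ^ n * norm (iter_pd is \<eta> x) \<le> B"
    using schwartz_iter_pd_bounded[OF \<eta>] by blast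
  from translate_weighted_bound[of n "iter_pd is \<eta>", OF this]
  show "bounded (range (\<lambda>x. (1 + norm x) ^ n * norm (iter_pd is (\<lambda>y. \<eta> (y + u)) x)))"
    unfolding iter_pd_translate bounded_iff by (intro exI[of _ "B * (1 + norm u) ^ n"]) simp
qed

lemma iter_pd_lincomb:
  assumes "schwartz \<phi>" "schwartz \<psi>"
  shows "iter_pd is (\<lambda>x. a * \<phi> x + b * \<psi> x) = (\<lambda>x. a * iter_pd is \<phi> x + b * iter_pd is \<psi> x)"
    and "((\<lambda>s. a * iter_pd is \<phi> (x + s *\<^sub>R axis i 1) + b * iter_pd is \<psi> (x + s *\<^sub>R axis i 1))
      has_vector_derivative (a * iter_pd (i # is) \<phi> x + b * iter_pd (i # is) \<psi> x)) (at 0)"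
proof -
  have D: "((\<lambda>s. a * iter_pd is \<phi> (x + s *\<^sub>R axis i 1) + b * iter_pd is \<psi> (x + s *\<^sub>R axis i 1))
      has_vector_derivative (a * iter_pd (i # is) \<phi> x + b * iter_pd (i # is) \<psi> x)) (at 0)" for "is" x i
  proof -
    have "((\<lambda>s. iter_pd is \<phi> (x + s *\<^sub>R axis i 1)) has_vector_derivative iter_pd (i # is) \<phi> x) (at 0)"
      "((\<lambda>s. iter_pd is \<psi> (x + s *\<^sub>R axis i 1)) has_vector_derivative iter_pd (i # is) \<psi> x) (at 0)"
      using assms unfolding schwartz_def smooth_fun_def by blast+
    then show ?thesis
      by (intro has_vector_derivative_add has_vector_derivative_mult_right)
  qed
  show "((\<lambda>s. a * iter_pd is \<phi> (x + s *\<^sub>R axis i 1) + b * iter_pd is \<psi> (x + s *\<^sub>R axis i 1))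
      has_vector_derivative (a * iter_pd (i # is) \<phi> x + b * iter_pd (i # is) \<psi> x)) (at 0)" by (rule D)
  show "iter_pd is (\<lambda>x. a * \<phi> x + b * \<psi> x) = (\<lambda>x. a * iter_pd is \<phi> x + b * iter_pd is \<psi> x)"
  proof (induction "is")
    case (Cons i "is")
    show ?case
      using vector_derivative_at[OF D[of "is" _ i]] by (simp add: Cons.IH pd_def fun_eq_iff)
  qed simp
qed

lemma schwartz_lincomb:
  assumes s: "schwartz \<phi>" "schwartz \<psi>"
  shows "schwartz (\<lambda>x. a * \<phi> x + b * \<psi> x)"
  unfolding schwartz_def smooth_fun_def iter_pd_lincomb(1)[OF s]
proof (intro conjI allI)
  fix "is"
  have "continuous_on UNIV (iter_pd is \<phi>)" "continuous_on UNIV (iter_pd is \<psi>)"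
    using s unfolding schwartz_def smooth_fun_def by blast+
  then show "continuous_on UNIV (\<lambda>x. a * iter_pd is \<phi> x + b * iter_pd is \<psi> x)"
    by (intro continuous_intros)
next
  fix "is" i x
  show "((\<lambda>s. a * iter_pd is \<phi> (x + s *\<^sub>R axis i 1) + b * iter_pd is \<psi> (x + s *\<^sub>R axis i 1))
      has_vector_derivative (a * iter_pd (i # is) \<phi> x + b * iter_pd (i # is) \<psi> x)) (at 0)"
    by (rule iter_pd_lincomb(2)[OF s])
next
  fix "is" n
  obtain B where B: "\<And>x. (1 + norm x) ^ n * norm (iter_pd is \<phi> x) \<le> B"
    using schwartz_iter_pd_bounded[OF s(1)] by blast
  obtain B' where B': "\<And>x. (1 + norm x) ^ n * norm (iter_pd is \<psi> x) \<le> B'"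
    using schwartz_iter_pd_bounded[OF s(2)] by blast
  have "(1 + norm x) ^ n * norm (a * iter_pd is \<phi> x + b * iter_pd is \<psi> x) \<le> norm a * B + norm b * B'" for x
  proof -
    have "(1 + norm x) ^ n * norm (a * iter_pd is \<phi> x + b * iter_pd is \<psi> x) \<le>
        (1 + norm x) ^ n * (norm a * norm (iter_pd is \<phi> x) + norm b * norm (iter_pd is \<psi> x))"
      by (intro mult_left_mono order_trans[OF norm_triangle_ineq]) (auto simp: norm_mult)
    also have "\<dots> = norm a * ((1 + norm x) ^ n * norm (iter_pd is \<phi> x)) + norm b * ((1 + norm x) ^ n * norm (iter_pd is \<psi> x))"
      by (simp add: algebra_simps)
    also have "\<dots> \<le> norm a * B + norm b * B'"
      by (intro add_mono mult_left_mono B B') auto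
    finally show ?thesis .
  qed
  then show "bounded (range (\<lambda>x. (1 + norm x) ^ n * norm (a * iter_pd is \<phi> x + b * iter_pd is \<psi> x)))"
    unfolding bounded_iff by (intro exI[of _ "norm a * B + norm b * B'"]) simp
qed

lemma schwartz_sum:
  assumes "finite V" "\<And>v. v \<in> V \<Longrightarrow> schwartz (\<eta> v)"
  shows "schwartz (\<lambda>x. \<Sum>v\<in>V. c v * \<eta> v x)"
    and "tempered T \<Longrightarrow> T (\<lambda>x. \<Sum>v\<in>V. c v * \<eta> v x) = (\<Sum>v\<in>V. c v * T (\<eta> v))"
    and "iter_pd is (\<lambda>x. \<Sum>v\<in>V. c v * \<eta> v x) = (\<lambda>x. \<Sum>v\<in>V. c v * iter_pd is (\<eta> v) x)"
proof -
  have "schwartz (\<lambda>x. \<Sum>v\<in>V. c v * \<eta> v x) \<and>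
      (tempered T \<longrightarrow> T (\<lambda>x. \<Sum>v\<in>V. c v * \<eta> v x) = (\<Sum>v\<in>V. c v * T (\<eta> v))) \<and>
      iter_pd is (\<lambda>x. \<Sum>v\<in>V. c v * \<eta> v x) = (\<lambda>x. \<Sum>v\<in>V. c v * iter_pd is (\<eta> v) x)"
    using assms
  proof (induction V)
    case empty
    show ?case by (simp add: schwartz_zero tempered_zero iter_pd_zero)
  next
    case (insert w V)
    then have w: "schwartz (\<eta> w)" and V: "schwartz (\<lambda>x. \<Sum>v\<in>V. c v * \<eta> v x)" by auto
    have eq: "(\<lambda>x. \<Sum>v\<in>insert w V. c v * \<eta> v x) = (\<lambda>x. c w * \<eta> w x + 1 * (\<Sum>v\<in>V. c v * \<eta> v x))"
      using insert by simp
    have lin: "T (\<lambda>x. c w * \<eta> w x + 1 * (\<Sum>v\<in>V. c v * \<eta> v x)) =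
        c w * T (\<eta> w) + 1 * T (\<lambda>x. \<Sum>v\<in>V. c v * \<eta> v x)" if "tempered T"
      using that w V unfolding tempered_def by blast
    show ?case
      unfolding eq using insert schwartz_lincomb[OF w V, of "c w" 1] iter_pd_lincomb(1)[OF w V, of "is" "c w" 1] lin
      by (auto simp: fun_eq_iff)
  qed
  then show "schwartz (\<lambda>x. \<Sum>v\<in>V. c v * \<eta> v x)"
    "tempered T \<Longrightarrow> T (\<lambda>x. \<Sum>v\<in>V. c v * \<eta> v x) = (\<Sum>v\<in>V. c v * T (\<eta> v))"
    "iter_pd is (\<lambda>x. \<Sum>v\<in>V. c v * \<eta> v x) = (\<lambda>x. \<Sum>v\<in>V. c v * iter_pd is (\<eta> v) x)" by auto
qed


lemma partials_Lipschitz: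
  fixes \<zeta> :: "real^'d::finite \<Rightarrow> complex"
  assumes D: "\<And>i x. ((\<lambda>s. \<zeta> (x + s *\<^sub>R axis i 1)) has_vector_derivative \<zeta>' i x) (at 0)"
    and B: "\<And>i x. norm (\<zeta>' i x) \<le> B"
  shows "norm (\<zeta> a - \<zeta> b) \<le> 3 * B * real CARD('d) * norm (a - b)"
proof -
  have B0: "0 \<le> B" using B norm_ge_zero order_trans by blast
  have one: "norm (\<zeta> (x + s *\<^sub>R axis i 1) - \<zeta> x) \<le> 3 * B * \<bar>s\<bar>" for x s i
  proof -
    define Z where "Z s = \<zeta> (x + s *\<^sub>R axis i 1)" for s
    define Z' where "Z' s = \<zeta>' i (x + s *\<^sub>R axis i 1)" for s
    have ZD: "(Z has_vector_derivative Z' s) (at s)" for s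
      using D[of "x + s *\<^sub>R axis i 1" i] unfolding has_vector_derivative_shift_iff[of Z s, symmetric]
      by (simp add: Z_def Z'_def algebra_simps)
    have "norm (Z s - Z 0 - (s - 0) *\<^sub>R Z' 0) \<le> norm (s - 0) * (2 * B)"
    proof (rule vector_differentiable_bound_linearization[where S = UNIV])
      show "norm (Z' r - Z' 0) \<le> 2 * B" for r
        using norm_triangle_ineq4[of "Z' r" "Z' 0"] B[of i "x + r *\<^sub>R axis i 1"] B[of i "x + 0 *\<^sub>R axis i 1"]
        unfolding Z'_def
        by linarith
      show "(Z has_vector_derivative Z' r) (at r within UNIV)" for r
        using ZD by simp
    qed auto
    moreover have "norm (s *\<^sub>R Z' 0) \<le> \<bar>s\<bar> * B"
      using B by (simp add: Z'_def mult_left_mono)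
    ultimately show ?thesis
      using norm_triangle_ineq[of "Z s - Z 0 - s *\<^sub>R Z' 0" "s *\<^sub>R Z' 0"]
      by (simp add: Z_def algebra_simps)
  qed
  have "norm (\<zeta> a - \<zeta> b) \<le> 3 * B * (\<Sum>i\<in>I. \<bar>a $ i - b $ i\<bar>)"
    if "finite I" "\<And>j. j \<notin> I \<Longrightarrow> a $ j = b $ j" for I a b
    using that
  proof (induction I arbitrary: a)
    case empty
    then have "a = b" by (simp add: vec_eq_iff)
    then show ?case by simp
  next
    case (insert i I)
    let ?c = "a + (b $ i - a $ i) *\<^sub>R axis i 1"
    have c: "?c $ j = (if j = i then b $ i else a $ j)" for j
      by (simp add: axis_def)
    have "norm (\<zeta> ?c - \<zeta> b) \<le> 3 * B * (\<Sum>j\<in>I. \<bar>?c $ j - b $ j\<bar>)"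
      by (rule insert.IH) (use insert.prems c in auto)
    also have "(\<Sum>j\<in>I. \<bar>?c $ j - b $ j\<bar>) = (\<Sum>j\<in>I. \<bar>a $ j - b $ j\<bar>)"
      using insert.hyps c by (intro sum.cong) auto
    finally have "norm (\<zeta> ?c - \<zeta> b) \<le> 3 * B * (\<Sum>j\<in>I. \<bar>a $ j - b $ j\<bar>)" .
    moreover have "norm (\<zeta> ?c - \<zeta> a) \<le> 3 * B * \<bar>a $ i - b $ i\<bar>"
      using one[of a "b $ i - a $ i" i] by (simp only: abs_minus_commute)
    moreover have "norm (\<zeta> a - \<zeta> b) \<le> norm (\<zeta> ?c - \<zeta> b) + norm (\<zeta> ?c - \<zeta> a)"
      using norm_triangle_ineq4[of "\<zeta> ?c - \<zeta> b" "\<zeta> ?c - \<zeta> a"] by simp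
    ultimately show ?case
      using insert.hyps by (simp add: distrib_left)
  qed
  from this[of UNIV a b]
  have "norm (\<zeta> a - \<zeta> b) \<le> 3 * B * (\<Sum>i\<in>UNIV. \<bar>a $ i - b $ i\<bar>)" by simp
  also have "\<dots> \<le> 3 * B * (real CARD('d) * norm (a - b))"
  proof (intro mult_left_mono)
    show "(\<Sum>i\<in>UNIV. \<bar>a $ i - b $ i\<bar>) \<le> real CARD('d) * norm (a - b)"
      using sum_bounded_above[of UNIV "\<lambda>i. \<bar>a $ i - b $ i\<bar>" "norm (a - b)"]
        component_le_norm_cart[of "a - b"] by simp
  qed (use B0 in auto)
  finally show ?thesis by (simp add: mult_ac)
qed

text \<open>The geometric mean of an unweighted Lipschitz bound and a bound with doubled weight.\<close>

lemma schwartz_shift_estimate: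
  fixes \<eta> :: "real^'d::finite \<Rightarrow> complex"
  assumes \<eta>: "schwartz \<eta>"
  shows "\<exists>K. \<forall>u v y. (1 + norm y) ^ n * norm (iter_pd is \<eta> (y + u) - iter_pd is \<eta> (y + v)) \<le>
    K * sqrt (norm (u - v)) * (1 + norm u + norm v) ^ n"
proof -
  let ?\<zeta> = "iter_pd is \<eta>"
  have "\<forall>i. \<exists>B. \<forall>x. (1 + norm x) ^ 0 * norm (iter_pd (i # is) \<eta> x) \<le> B"
    using schwartz_iter_pd_bounded[OF \<eta>] by meson
  then obtain b where b: "\<And>i x. norm (iter_pd (i # is) \<eta> x) \<le> b i"
    unfolding power_0 mult_1 by metis
  define B1 where "B1 = (\<Sum>i\<in>UNIV. \<bar>b i\<bar>)"
  have B1: "norm (iter_pd (i # is) \<eta> x) \<le> B1" for i x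
    using b[of i x] member_le_sum[of i UNIV "\<lambda>i. \<bar>b i\<bar>"] by (simp add: B1_def del: iter_pd.simps)
  define L where "L = 3 * B1 * real CARD('d)"
  have Lip: "norm (?\<zeta> a - ?\<zeta> b) \<le> L * norm (a - b)" for a b
    unfolding L_def
    by (rule partials_Lipschitz[where \<zeta>' = "\<lambda>i. iter_pd (i # is) \<eta>"])
      (use \<eta> B1 in \<open>auto simp: schwartz_def smooth_fun_def simp del: iter_pd.simps\<close>)
  obtain B2 where B2: "\<And>x. (1 + norm x) ^ (2 * n) * norm (?\<zeta> x) \<le> B2"
    using schwartz_iter_pd_bounded[OF \<eta>] by blast
  have B20: "0 \<le> B2" by (rule order_trans[OF _ B2[of 0]]) simp
  have L0: "0 \<le> L" unfolding L_def B1_def by (simp add: sum_nonneg)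
  have "(1 + norm y) ^ n * norm (?\<zeta> (y + u) - ?\<zeta> (y + v)) \<le>
      sqrt (2 * B2 * L) * sqrt (norm (u - v)) * (1 + norm u + norm v) ^ n" for u v y
  proof -
    let ?d = "norm (?\<zeta> (y + u) - ?\<zeta> (y + v))" and ?W = "1 + norm u + norm v"
    have d1: "?d \<le> L * norm (u - v)"
      using Lip[of "y + u" "y + v"] by simp
    have "(1 + norm y) ^ (2 * n) * ?d \<le>
        (1 + norm y) ^ (2 * n) * (norm (?\<zeta> (y + u)) + norm (?\<zeta> (y + v)))"
      by (intro mult_left_mono norm_triangle_ineq4) auto
    also have "\<dots> \<le> B2 * (1 + norm u) ^ (2 * n) + B2 * (1 + norm v) ^ (2 * n)"
      using translate_weighted_bound[of "2 * n" ?\<zeta>, OF B2] by (simp only: distrib_left add_mono)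
    also have "\<dots> \<le> B2 * ?W ^ (2 * n) + B2 * ?W ^ (2 * n)"
    proof (rule add_mono)
      show "B2 * (1 + norm u) ^ (2 * n) \<le> B2 * ?W ^ (2 * n)" "B2 * (1 + norm v) ^ (2 * n) \<le> B2 * ?W ^ (2 * n)"
        by (rule mult_left_mono[OF power_mono B20]; simp)+
    qed
    finally have d2: "(1 + norm y) ^ (2 * n) * ?d \<le> 2 * B2 * ?W ^ (2 * n)" by simp
    have "((1 + norm y) ^ n * ?d)\<^sup>2 = ((1 + norm y) ^ (2 * n) * ?d) * ?d"
      by (simp add: power2_eq_square power_mult mult_ac)
    also have "\<dots> \<le> (2 * B2 * ?W ^ (2 * n)) * (L * norm (u - v))"
      using B20 by (intro mult_mono d1 d2) auto
    also have "\<dots> = (sqrt (2 * B2 * L) * sqrt (norm (u - v)) * ?W ^ n)\<^sup>2"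
      using B20 L0 by (simp add: power_mult_distrib power_mult[symmetric] mult_ac)
    finally show ?thesis
      by (rule power2_le_imp_le) (use B20 L0 in simp)
  qed
  then show ?thesis by blast
qed

lemma schwartz_shift_estimate_uniform:
  fixes \<eta> :: "real^'d::finite \<Rightarrow> complex"
  assumes \<eta>: "schwartz \<eta>"
  obtains K where "K \<ge> 0" "\<And>is n u v y. length is \<le> N \<Longrightarrow> n \<le> N \<Longrightarrow>
    (1 + norm y) ^ n * norm (iter_pd is \<eta> (y + u) - iter_pd is \<eta> (y + v)) \<le>
      K * sqrt (norm (u - v)) * (1 + norm u + norm v) ^ N"
proof -
  have "\<forall>is n. \<exists>K. \<forall>u v y. (1 + norm y) ^ n * norm (iter_pd is \<eta> (y + u) - iter_pd is \<eta> (y + v)) \<le>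
      K * sqrt (norm (u - v)) * (1 + norm u + norm v) ^ n"
    using schwartz_shift_estimate[OF \<eta>] by blast
  then obtain k where k: "\<And>is n u v y. (1 + norm y) ^ n * norm (iter_pd is \<eta> (y + u) - iter_pd is \<eta> (y + v)) \<le>
      k is n * sqrt (norm (u - v)) * (1 + norm u + norm v) ^ n"
    by metis
  define A where "A = {is::'d list. length is \<le> N} \<times> {..N}"
  have "finite {is::'d list. length is \<le> N}"
    using finite_lists_length_le[of "UNIV :: 'd set" N] by simp
  then have A: "finite A" unfolding A_def by simp
  define K where "K = (\<Sum>(is, n)\<in>A. \<bar>k is n\<bar>)"
  have K0: "K \<ge> 0" unfolding K_def by (intro sum_nonneg) auto
  have "(1 + norm y) ^ n * norm (iter_pd is \<eta> (y + u) - iter_pd is \<eta> (y + v)) \<le>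
      K * sqrt (norm (u - v)) * (1 + norm u + norm v) ^ N" if "length is \<le> N" "n \<le> N" for "is" n u v y
  proof -
    have "k is n \<le> \<bar>k is n\<bar>" by simp
    also have "\<dots> \<le> K"
      unfolding K_def using member_le_sum[of "(is, n)" A "\<lambda>(is, n). \<bar>k is n\<bar>"] A that by (auto simp: A_def)
    finally have kK: "k is n \<le> K" .
    have "k is n * sqrt (norm (u - v)) * (1 + norm u + norm v) ^ n \<le>
        K * sqrt (norm (u - v)) * (1 + norm u + norm v) ^ N"
      using kK K0 that by (intro mult_mono mult_right_mono power_increasing) auto
    with k[of y n "is" u v] show ?thesis by linarith
  qed
  with K0 that show ?thesis by blast
qed

lemma tempered_uniform_bound:
  fixes T :: "(real^'d::finite \<Rightarrow> complex) \<Rightarrow> complex"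
  assumes "tempered T"
  obtains C N where "C \<ge> 0" "\<And>D e. schwartz D \<Longrightarrow>
    (\<And>is n y. length is \<le> N \<Longrightarrow> n \<le> N \<Longrightarrow> (1 + norm y) ^ n * norm (iter_pd is D y) \<le> e) \<Longrightarrow> norm (T D) \<le> C * e"
proof -
  obtain C N where CN: "\<And>\<phi>. schwartz \<phi> \<Longrightarrow> norm (T \<phi>) \<le> C * schwartz_seminorm N \<phi>"
    using assms unfolding tempered_def by blast
  define M where "M = real (card {is::'d list. length is \<le> N}) * real (Suc N)"
  have "norm (T D) \<le> (\<bar>C\<bar> * M) * e" if D: "schwartz D"
    and e: "\<And>is n y. length is \<le> N \<Longrightarrow> n \<le> N \<Longrightarrow> (1 + norm y) ^ n * norm (iter_pd is D y) \<le> e" for D e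
  proof -
    have "schwartz_seminorm N D \<le> (\<Sum>is\<in>{is::'d list. length is \<le> N}. \<Sum>n\<le>N. e)"
      unfolding schwartz_seminorm_def by (intro sum_mono cSUP_least e) auto
    also have "\<dots> = M * e" by (simp add: M_def)
    finally have le: "schwartz_seminorm N D \<le> M * e" .
    have "0 \<le> schwartz_seminorm N D"
      unfolding schwartz_seminorm_def
      by (intro sum_nonneg order_trans[OF _ schwartz_SUP_bound[OF D, of 0]]) auto
    then have "C * schwartz_seminorm N D \<le> \<bar>C\<bar> * schwartz_seminorm N D"
      by (intro mult_right_mono) auto
    also have "\<dots> \<le> \<bar>C\<bar> * (M * e)"
      by (intro mult_left_mono le) auto
    finally show ?thesis using CN[OF D] by (simp add: mult.assoc)
  qed
  moreover have "\<bar>C\<bar> * M \<ge> 0" by (simp add: M_def)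
  ultimately show ?thesis using that by blast
qed

lemma tempered_translate:
  fixes T :: "(real^'d::finite \<Rightarrow> complex) \<Rightarrow> complex"
  assumes T: "tempered T" and \<eta>: "schwartz \<eta>"
  shows "continuous_on UNIV (\<lambda>u. T (\<lambda>y. \<eta> (y + u)))"
    and "\<exists>A N. \<forall>u. norm (T (\<lambda>y. \<eta> (y + u))) \<le> A * (1 + norm u) ^ N"
proof -
  let ?F = "\<lambda>u. T (\<lambda>y. \<eta> (y + u))"
  obtain C N where C: "C \<ge> 0" "\<And>D e. schwartz D \<Longrightarrow>
    (\<And>is n y. length is \<le> N \<Longrightarrow> n \<le> N \<Longrightarrow> (1 + norm y) ^ n * norm (iter_pd is D y) \<le> e) \<Longrightarrow> norm (T D) \<le> C * e"
    using tempered_uniform_bound[OF T] by blast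
  obtain K where K: "K \<ge> 0" "\<And>is n u v y. length is \<le> N \<Longrightarrow> n \<le> N \<Longrightarrow>
    (1 + norm y) ^ n * norm (iter_pd is \<eta> (y + u) - iter_pd is \<eta> (y + v)) \<le>
      K * sqrt (norm (u - v)) * (1 + norm u + norm v) ^ N"
    using schwartz_shift_estimate_uniform[OF \<eta>] by blast
  have est: "norm (?F u - ?F v) \<le> C * (K * sqrt (norm (u - v)) * (1 + norm u + norm v) ^ N)" for u v
  proof -
    note s = schwartz_translate[OF \<eta>, of u] schwartz_translate[OF \<eta>, of v]
    have "T (\<lambda>y. 1 * \<eta> (y + u) + (-1) * \<eta> (y + v)) = 1 * ?F u + (-1) * ?F v"
      using T s unfolding tempered_def by blast
    then have "norm (?F u - ?F v) = norm (T (\<lambda>y. 1 * \<eta> (y + u) + (-1) * \<eta> (y + v)))" by simp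
    also have "\<dots> \<le> C * (K * sqrt (norm (u - v)) * (1 + norm u + norm v) ^ N)"
      by (rule C(2)[OF schwartz_lincomb[OF s]])
        (unfold iter_pd_lincomb(1)[OF s] iter_pd_translate, use K(2) in simp)
    finally show ?thesis .
  qed
  have "(?F \<longlongrightarrow> ?F v) (at v)" for v
  proof (rule LIM_zero_cancel[OF Lim_null_comparison])
    show "\<forall>\<^sub>F u in at v. norm (?F u - ?F v) \<le> C * (K * sqrt (norm (u - v)) * (1 + norm u + norm v) ^ N)"
      by (intro always_eventually allI est)
    have "((\<lambda>u. C * (K * sqrt (norm (u - v)) * (1 + norm u + norm v) ^ N)) \<longlongrightarrow>
        C * (K * sqrt (norm (v - v)) * (1 + norm v + norm v) ^ N)) (at v)"
      by (intro tendsto_intros)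
    then show "((\<lambda>u. C * (K * sqrt (norm (u - v)) * (1 + norm u + norm v) ^ N)) \<longlongrightarrow> 0) (at v)"
      by simp
  qed
  then show "continuous_on UNIV ?F"
    by (simp add: continuous_on_def)
  have "norm (?F u) \<le> (norm (?F 0) + C * K) * (1 + norm u) ^ Suc N" for u
  proof -
    have "sqrt (norm u) \<le> 1 + norm u"
      by (rule real_le_lsqrt) (auto simp: power2_eq_square algebra_simps)
    then have "C * (K * sqrt (norm u) * (1 + norm u) ^ N) \<le> C * (K * (1 + norm u) * (1 + norm u) ^ N)"
      using C(1) K(1) by (intro mult_left_mono mult_right_mono) auto
    moreover have "norm (?F 0) * 1 \<le> norm (?F 0) * (1 + norm u) ^ Suc N"
      by (intro mult_left_mono one_le_power) auto
    moreover have "norm (?F u) \<le> norm (?F 0) + norm (?F u - ?F 0)"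
      using norm_triangle_ineq[of "?F 0" "?F u - ?F 0"] by simp
    ultimately show ?thesis
      using est[of u 0] by (simp add: algebra_simps)
  qed
  then show "\<exists>A N. \<forall>u. norm (?F u) \<le> A * (1 + norm u) ^ N" by blast
qed

lemma simple_function_integral_sum:
  fixes s :: "real^'d::finite \<Rightarrow> real^'d" and \<Theta> \<zeta> :: "real^'d \<Rightarrow> complex"
  assumes s: "simple_function lborel s" and \<Theta>: "integrable lborel \<Theta>"
  shows "(LINT u|lborel. \<zeta> (s u) * \<Theta> u) =
    (\<Sum>v\<in>range s. (LINT u|lborel. indicator (s -` {v}) u *\<^sub>R \<Theta> u) * \<zeta> v)"
proof -
  have fin: "finite (range s)" using s by (simp add: simple_function_def)
  have m: "s -` {v} \<in> sets lborel" for v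
    using simple_functionD(2)[OF s, of "{v}"] by simp
  have i: "integrable lborel (\<lambda>u. indicator (s -` {v}) u *\<^sub>R \<Theta> u)" for v
    by (rule integrable_mult_indicator[OF m \<Theta>])
  have "\<zeta> (s u) * \<Theta> u = (\<Sum>v\<in>range s. (indicator (s -` {v}) u *\<^sub>R \<Theta> u) * \<zeta> v)" for u
  proof -
    have "(\<Sum>v\<in>range s. (indicator (s -` {v}) u *\<^sub>R \<Theta> u) * \<zeta> v) =
        (\<Sum>v\<in>range s. if v = s u then \<zeta> (s u) * \<Theta> u else 0)"
      by (intro sum.cong) (auto simp: indicator_def)
    then show ?thesis using fin by simp
  qed
  then have "(LINT u|lborel. \<zeta> (s u) * \<Theta> u) =
      (LINT u|lborel. (\<Sum>v\<in>range s. (indicator (s -` {v}) u *\<^sub>R \<Theta> u) * \<zeta> v))"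
    by (simp only:)
  also have "\<dots> = (\<Sum>v\<in>range s. (LINT u|lborel. (indicator (s -` {v}) u *\<^sub>R \<Theta> u) * \<zeta> v))"
    by (intro Bochner_Integration.integral_sum integrable_mult_left i)
  finally show ?thesis by (simp only: integral_mult_left_zero)
qed

lemma one_vec_times: "(1::real^'d::finite) * y = y"
  by (simp add: vec_eq_iff)

lemma tempered_conv_op_eq_integral:
  fixes T :: "(real^'d::finite \<Rightarrow> complex) \<Rightarrow> complex"
  assumes T: "tempered T" and \<eta>: "schwartz \<eta>"
    and \<Theta>: "\<And>n. integrable lborel (\<lambda>u. (1 + norm u) ^ n *\<^sub>R \<Theta> u)"
  shows "(LINT u|lborel. T (\<lambda>y. \<eta> (y + u)) * \<Theta> u) = T (conv_op 1 \<Theta> \<eta>)"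
proof -
  let ?F = "\<lambda>u. T (\<lambda>y. \<eta> (y + u))"
  have \<Theta>i: "integrable lborel \<Theta>" using \<Theta>[of 0] by simp
  have \<Theta>n: "integrable lborel (\<lambda>u. (1 + norm u) ^ n * norm (\<Theta> u))" for n
    using integrable_norm[OF \<Theta>[of n]] by (simp add: abs_of_nonneg)
  have [measurable]: "\<Theta> \<in> borel_measurable borel"
    using \<Theta>i by (auto dest: borel_measurable_integrable)
  have [measurable]: "?F \<in> borel_measurable borel"
    by (rule borel_measurable_continuous_onI[OF tempered_translate(1)[OF T \<eta>]])
  obtain s where s: "\<And>i. simple_function lborel (s i)" "\<And>u. (\<lambda>i. s i u) \<longlonglongrightarrow> u"
      "\<And>i u. norm (s i u) \<le> 2 * norm (u :: real^'d)"
    using borel_measurable_implies_sequence_metric[of "\<lambda>u::real^'d. u" lborel 0] by auto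
  have sm[measurable]: "s i \<in> borel_measurable borel" for i
    using borel_measurable_simple_function[OF s(1)[of i]] by simp
  have fin: "finite (range (s i))" for i using s(1)[of i] by (simp add: simple_function_def)
  define c where "c i v = (LINT u|lborel. indicator (s i -` {v}) u *\<^sub>R \<Theta> u)" for i v
  note sum = simple_function_integral_sum[OF s(1) \<Theta>i, folded c_def]
  define A where "A i y = (\<Sum>v\<in>range (s i). c i v * \<eta> (y + v))" for i y
  have sA: "schwartz (A i)" and TA: "T (A i) = (\<Sum>v\<in>range (s i). c i v * ?F v)"
    and iA: "iter_pd is (A i) = (\<lambda>y. \<Sum>v\<in>range (s i). c i v * iter_pd is \<eta> (y + v))" for i "is"
    unfolding A_def[abs_def]
    using schwartz_sum[where V = "range (s i)" and \<eta> = "\<lambda>v y. \<eta> (y + v)" and c = "c i",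
        OF fin schwartz_translate[OF \<eta>]] T
    by (auto simp: iter_pd_translate)
  have TAi: "T (A i) = (LINT u|lborel. ?F (s i u) * \<Theta> u)" for i
    unfolding TA by (rule sum[symmetric])
  obtain a N where aN: "\<And>u. norm (?F u) \<le> a * (1 + norm u) ^ N"
    using tempered_translate(2)[OF T \<eta>] by blast
  have a0: "0 \<le> a" by (rule order_trans[OF _ order_trans[OF aN[of 0]]]) auto
  have lim1: "(\<lambda>i. T (A i)) \<longlonglongrightarrow> (LINT u|lborel. ?F u * \<Theta> u)"
    unfolding TAi
  proof (rule integral_dominated_convergence[where w = "\<lambda>u. (a * 2 ^ N) * ((1 + norm u) ^ N * norm (\<Theta> u))"])
    show "integrable lborel (\<lambda>u. (a * 2 ^ N) * ((1 + norm u) ^ N * norm (\<Theta> u)))"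
      using \<Theta>n by simp
    show "AE u in lborel. (\<lambda>i. ?F (s i u) * \<Theta> u) \<longlonglongrightarrow> ?F u * \<Theta> u"
    proof (intro AE_I2 tendsto_mult tendsto_const)
      fix u
      show "(\<lambda>i. ?F (s i u)) \<longlonglongrightarrow> ?F u"
        using tempered_translate(1)[OF T \<eta>] by (intro isCont_tendsto_compose[of _ ?F, OF _ s(2)])
          (auto simp: continuous_on_eq_continuous_at)
    qed
    show "AE u in lborel. norm (?F (s i u) * \<Theta> u) \<le> (a * 2 ^ N) * ((1 + norm u) ^ N * norm (\<Theta> u))" for i
    proof (intro AE_I2)
      fix u
      have "(1 + norm (s i u)) ^ N \<le> (2 * (1 + norm u)) ^ N"
        using s(3)[of i u] by (intro power_mono) auto
      from mult_left_mono[OF this a0]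
      have "a * (1 + norm (s i u)) ^ N \<le> a * 2 ^ N * (1 + norm u) ^ N"
        by (simp only: power_mult_distrib mult.assoc)
      with aN[of "s i u"] have "norm (?F (s i u)) \<le> a * 2 ^ N * (1 + norm u) ^ N" by linarith
      from mult_right_mono[OF this, of "norm (\<Theta> u)"]
      show "norm (?F (s i u) * \<Theta> u) \<le> (a * 2 ^ N) * ((1 + norm u) ^ N * norm (\<Theta> u))"
        by (simp add: norm_mult mult.assoc)
    qed
  qed measurable
  obtain C M where C: "C \<ge> 0" "\<And>D e. schwartz D \<Longrightarrow>
    (\<And>is n y. length is \<le> M \<Longrightarrow> n \<le> M \<Longrightarrow> (1 + norm y) ^ n * norm (iter_pd is D y) \<le> e) \<Longrightarrow> norm (T D) \<le> C * e"
    using tempered_uniform_bound[OF T] by blast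
  obtain K where K: "K \<ge> 0" "\<And>is n u v y. length is \<le> M \<Longrightarrow> n \<le> M \<Longrightarrow>
    (1 + norm y) ^ n * norm (iter_pd is \<eta> (y + u) - iter_pd is \<eta> (y + v)) \<le>
      K * sqrt (norm (u - v)) * (1 + norm u + norm v) ^ M"
    using schwartz_shift_estimate_uniform[OF \<eta>] by blast
  define r where "r i u = K * sqrt (norm (s i u - u)) * (1 + norm (s i u) + norm u) ^ M * norm (\<Theta> u)" for i u
  have r0: "0 \<le> r i u" for i u using K(1) by (simp add: r_def)
  have rb: "r i u \<le> (K * 3 ^ Suc M) * ((1 + norm u) ^ Suc M * norm (\<Theta> u))" for i u
  proof -
    have "sqrt (norm (s i u - u)) \<le> 1 + norm (s i u - u)"
      by (rule real_le_lsqrt) (auto simp: power2_eq_square algebra_simps)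
    also have "\<dots> \<le> 3 * (1 + norm u)"
      using norm_triangle_ineq4[of "s i u" u] s(3)[of i u] by simp
    finally have "sqrt (norm (s i u - u)) * (1 + norm (s i u) + norm u) ^ M \<le>
        (3 * (1 + norm u)) * (3 * (1 + norm u)) ^ M"
      using s(3)[of i u] by (intro mult_mono power_mono) auto
    then have "K * (sqrt (norm (s i u - u)) * (1 + norm (s i u) + norm u) ^ M) * norm (\<Theta> u) \<le>
        K * ((3 * (1 + norm u)) * (3 * (1 + norm u)) ^ M) * norm (\<Theta> u)"
      using K(1) by (intro mult_right_mono mult_left_mono) auto
    also have "(3 * (1 + norm u)) * (3 * (1 + norm u)) ^ M = 3 ^ Suc M * (1 + norm u) ^ Suc M"
      by (simp only: power_mult_distrib power_Suc mult_ac)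
    finally show ?thesis
      by (simp only: r_def mult.assoc)
  qed
  have ri: "integrable lborel (r i)" for i
  proof (rule Bochner_Integration.integrable_bound)
    show "integrable lborel (\<lambda>u. (K * 3 ^ Suc M) * ((1 + norm u) ^ Suc M * norm (\<Theta> u)))"
      using \<Theta>n[of "Suc M"] by (intro integrable_mult_right)
    show "AE u in lborel. norm (r i u) \<le> norm ((K * 3 ^ Suc M) * ((1 + norm u) ^ Suc M * norm (\<Theta> u)))"
      using rb r0 by (intro AE_I2) (simp add: abs_of_nonneg order_trans[OF _ abs_ge_self])
    show "r i \<in> borel_measurable lborel"
      unfolding r_def[abs_def] by measurable
  qed
  define e where "e i = (LINT u|lborel. r i u)" for i
  have elim: "e \<longlonglongrightarrow> 0"
  proof -
    have "(\<lambda>i. LINT u|lborel. r i u) \<longlonglongrightarrow> (LINT u::real^'d|lborel. 0)"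
    proof (rule integral_dominated_convergence[where w = "\<lambda>u. (K * 3 ^ Suc M) * ((1 + norm u) ^ Suc M * norm (\<Theta> u))"])
      show "integrable lborel (\<lambda>u. (K * 3 ^ Suc M) * ((1 + norm u) ^ Suc M * norm (\<Theta> u)))"
        using \<Theta>n[of "Suc M"] by (intro integrable_mult_right)
      show "AE u in lborel. (\<lambda>i. r i u) \<longlonglongrightarrow> 0"
      proof (intro AE_I2)
        fix u
        have "(\<lambda>i. r i u) \<longlonglongrightarrow> K * sqrt (norm (u - u)) * (1 + norm u + norm u) ^ M * norm (\<Theta> u)"
          unfolding r_def by (intro tendsto_intros s(2))
        then show "(\<lambda>i. r i u) \<longlonglongrightarrow> 0" by simp
      qed
      show "AE u in lborel. norm (r i u) \<le> (K * 3 ^ Suc M) * ((1 + norm u) ^ Suc M * norm (\<Theta> u))" for i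
        using rb r0 by (intro AE_I2) (simp add: abs_of_nonneg)
    qed (use ri in \<open>auto dest: borel_measurable_integrable\<close>)
    then show ?thesis by (simp add: e_def[abs_def])
  qed
  have l1: "(1::real^'d) $ i \<ge> 1" for i by simp
  note sconv = schwartz_conv_op[OF l1 \<Theta> \<eta>]
  have diff: "norm (T (A i) - T (conv_op 1 \<Theta> \<eta>)) \<le> C * e i" for i
  proof -
    have "T (\<lambda>y. 1 * A i y + (-1) * conv_op 1 \<Theta> \<eta> y) = 1 * T (A i) + (-1) * T (conv_op 1 \<Theta> \<eta>)"
      using T sA sconv unfolding tempered_def by blast
    then have "norm (T (A i) - T (conv_op 1 \<Theta> \<eta>)) = norm (T (\<lambda>y. 1 * A i y + (-1) * conv_op 1 \<Theta> \<eta> y))" by simp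
    also have "\<dots> \<le> C * e i"
    proof (rule C(2)[OF schwartz_lincomb[OF sA sconv]])
      fix "is" :: "'d list" and n y assume l: "length is \<le> M" "n \<le> M"
      let ?\<zeta> = "iter_pd is \<eta>"
      obtain B where B: "\<And>x. (1 + norm x) ^ 0 * norm (?\<zeta> x) \<le> B"
        using schwartz_iter_pd_bounded[OF \<eta>] by blast
      have \<zeta>c: "continuous_on UNIV ?\<zeta>"
        using \<eta> unfolding schwartz_def smooth_fun_def by blast
      then have [measurable]: "?\<zeta> \<in> borel_measurable borel"
        by (rule borel_measurable_continuous_onI)
      have i1: "integrable lborel (\<lambda>u. ?\<zeta> (y + u) * \<Theta> u)"
        by (rule integrable_conv_op[OF \<Theta>i \<zeta>c]) (use B in simp)
      have i2: "integrable lborel (\<lambda>u. ?\<zeta> (y + s i u) * \<Theta> u)"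
      proof (rule Bochner_Integration.integrable_bound)
        show "integrable lborel (\<lambda>u. B *\<^sub>R \<Theta> u)" using \<Theta>i by simp
        show "AE u in lborel. norm (?\<zeta> (y + s i u) * \<Theta> u) \<le> norm (B *\<^sub>R \<Theta> u)"
          unfolding norm_mult norm_scaleR using B
          by (intro AE_I2 mult_right_mono order_trans[OF _ abs_ge_self] norm_ge_zero) simp
      qed measurable
      have "iter_pd is (\<lambda>y. 1 * A i y + (-1) * conv_op 1 \<Theta> \<eta> y) y =
          (\<Sum>v\<in>range (s i). c i v * ?\<zeta> (y + v)) - conv_op 1 \<Theta> ?\<zeta> y"
      proof -
        have one: "prod_list (map (($) (1::real^'d)) is) = 1" by (induction "is") auto
        show ?thesis
          unfolding iter_pd_lincomb(1)[OF sA sconv] iA iter_pd_conv_op(1)[OF \<Theta>i \<eta>] by (simp add: one)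
      qed
      also have "\<dots> = (LINT u|lborel. ?\<zeta> (y + s i u) * \<Theta> u) - (LINT u|lborel. ?\<zeta> (y + u) * \<Theta> u)"
        using sum[where \<zeta> = "\<lambda>v. ?\<zeta> (y + v)"] by (simp add: conv_op_def one_vec_times)
      also have "\<dots> = (LINT u|lborel. (?\<zeta> (y + s i u) - ?\<zeta> (y + u)) * \<Theta> u)"
        using i1 i2 by (simp add: left_diff_distrib)
      finally have "(1 + norm y) ^ n * norm (iter_pd is (\<lambda>y. 1 * A i y + (-1) * conv_op 1 \<Theta> \<eta> y) y) =
          norm (LINT u|lborel. (1 + norm y) ^ n *\<^sub>R ((?\<zeta> (y + s i u) - ?\<zeta> (y + u)) * \<Theta> u))"
        by (simp add: abs_of_nonneg)
      also have "\<dots> \<le> e i"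
        unfolding e_def
      proof (rule order_trans[OF integral_norm_bound integral_mono'[OF ri]])
        fix u
        have "(1 + norm y) ^ n * norm (?\<zeta> (y + s i u) - ?\<zeta> (y + u)) * norm (\<Theta> u) \<le> r i u"
          unfolding r_def by (intro mult_right_mono K(2) l) auto
        then show "norm ((1 + norm y) ^ n *\<^sub>R ((?\<zeta> (y + s i u) - ?\<zeta> (y + u)) * \<Theta> u)) \<le> r i u"
          by (simp add: norm_mult abs_of_nonneg mult.assoc)
      qed (rule r0)
      finally show "(1 + norm y) ^ n * norm (iter_pd is (\<lambda>y. 1 * A i y + (-1) * conv_op 1 \<Theta> \<eta> y) y) \<le> e i" .
    qed
    finally show ?thesis .
  qed
  have "(\<lambda>i. T (A i)) \<longlonglongrightarrow> T (conv_op 1 \<Theta> \<eta>)"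
  proof (rule LIM_zero_cancel[OF Lim_null_comparison])
    show "\<forall>\<^sub>F i in sequentially. norm (T (A i) - T (conv_op 1 \<Theta> \<eta>)) \<le> C * e i"
      by (intro always_eventually allI diff)
    show "(\<lambda>i. C * e i) \<longlonglongrightarrow> 0"
      using tendsto_mult_right_zero[OF elim] .
  qed
  with lim1 show ?thesis by (rule LIMSEQ_unique)
qed


section \<open>Nikol'skii's inequality\<close>

lemma fourier_mult_reproducing:
  fixes h \<theta> :: "'d::finite \<Rightarrow> real \<Rightarrow> real"
  assumes T: "tempered T" and h: "\<And>i. bump R (h i)" and \<theta>: "\<And>i. bump R' (\<theta> i)"
    and one: "\<And>i s. h i s \<noteq> 0 \<Longrightarrow> \<theta> i s = 1"
  defines "g \<equiv> fourier_mult (\<lambda>\<xi>. complex_of_real (\<Prod>i\<in>UNIV. h i (\<xi> $ i))) T"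
  shows "continuous_on UNIV g"
    and "\<exists>A N. \<forall>x. norm (g x) \<le> A * (1 + norm x) ^ N"
    and "g x = (LINT u|lborel. g (x - u) * inv_fourier (\<lambda>\<xi>. complex_of_real (\<Prod>i\<in>UNIV. \<theta> i (\<xi> $ i))) u)"
proof -
  define \<Phi> where "\<Phi> \<xi> = complex_of_real (\<Prod>i\<in>UNIV. h i (\<xi> $ i))" for \<xi> :: "real^'d"
  define \<eta> where "\<eta> y = inv_fourier \<Phi> (- y)" for y
  define tm where "tm \<xi> = complex_of_real (\<Prod>i\<in>UNIV. \<theta> i (\<xi> $ i))" for \<xi> :: "real^'d"
  have \<eta>: "schwartz \<eta>"
    unfolding \<eta>_def[abs_def] \<Phi>_def by (rule schwartz_inv_fourier_tensor[OF h])
  have g: "g x = T (\<lambda>y. \<eta> (y + (- x)))" for x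
    by (simp add: g_def fourier_mult_def \<eta>_def \<Phi>_def[abs_def])
  show "continuous_on UNIV g"
    unfolding g[abs_def]
    by (rule continuous_on_compose2[OF tempered_translate(1)[OF T \<eta>]]) (auto intro: continuous_intros)
  obtain A N where "\<And>u. norm (T (\<lambda>y. \<eta> (y + u))) \<le> A * (1 + norm u) ^ N"
    using tempered_translate(2)[OF T \<eta>] by blast
  then have "norm (g x) \<le> A * (1 + norm x) ^ N" for x
    unfolding g by (metis norm_minus_cancel)
  then show "\<exists>A N. \<forall>x. norm (g x) \<le> A * (1 + norm x) ^ N" by blast
  have tm: "rapid_multiplier tm"
    unfolding tm_def[abs_def] by (rule rapid_multiplier_tensor[OF \<theta>])
  have \<Phi>i: "integrable lborel \<Phi>"
    unfolding \<Phi>_def[abs_def] by (rule rapid_multiplier_integrable[OF rapid_multiplier_tensor[OF h]])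
  have prod: "(\<lambda>\<xi>. \<Phi> \<xi> * tm \<xi>) = \<Phi>"
  proof
    fix \<xi> :: "real^'d"
    show "\<Phi> \<xi> * tm \<xi> = \<Phi> \<xi>"
    proof (cases "\<Phi> \<xi> = 0")
      case False
      then have "\<theta> i (\<xi> $ i) = 1" for i by (auto simp: \<Phi>_def one)
      then show ?thesis by (simp add: tm_def)
    qed simp
  qed
  have "(LINT u|lborel. T (\<lambda>y. (\<lambda>y. \<eta> (y + (- x))) (y + u)) * inv_fourier tm u) =
      T (conv_op 1 (inv_fourier tm) (\<lambda>y. \<eta> (y + (- x))))"
    by (rule tempered_conv_op_eq_integral[OF T schwartz_translate[OF \<eta>]])
      (use tm in \<open>simp add: rapid_multiplier_def\<close>)
  also have "conv_op 1 (inv_fourier tm) (\<lambda>y. \<eta> (y + (- x))) = (\<lambda>y. \<eta> (y + (- x)))"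
  proof
    fix y
    have "conv_op 1 (inv_fourier tm) (\<lambda>y. \<eta> (y + (- x))) y =
        (LINT u|lborel. inv_fourier \<Phi> ((x - y) - u) * inv_fourier tm u)"
      by (simp add: conv_op_def one_vec_times \<eta>_def algebra_simps)
    also have "\<dots> = inv_fourier \<Phi> (x - y)"
      unfolding inv_fourier_convolution[OF tm \<Phi>i] prod ..
    finally show "conv_op 1 (inv_fourier tm) (\<lambda>y. \<eta> (y + (- x))) y = \<eta> (y + (- x))"
      by (simp add: \<eta>_def)
  qed
  finally have "T (\<lambda>y. \<eta> (y + (- x))) = (LINT u|lborel. T (\<lambda>y. \<eta> (y + u + (- x))) * inv_fourier tm u)"
    by simp
  also have "(\<lambda>u. T (\<lambda>y. \<eta> (y + u + (- x)))) = (\<lambda>u. g (x - u))"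
    by (simp add: g algebra_simps)
  finally show "g x = (LINT u|lborel. g (x - u) * inv_fourier (\<lambda>\<xi>. complex_of_real (\<Prod>i\<in>UNIV. \<theta> i (\<xi> $ i))) u)"
    unfolding g[of x] tm_def[abs_def] fun_eq_iff by simp
qed

lemma lborel_reflect: "lborel = distr lborel borel (\<lambda>u. x - u)" for x :: "real^'d::finite"
proof -
  have "lborel = density (distr lborel borel (\<lambda>u. x + (-1) *\<^sub>R u)) (\<lambda>_. ennreal (\<bar>-1\<bar> ^ DIM(real^'d)))"
    by (rule lborel_affine) simp
  then show ?thesis by (simp add: density_1)
qed

lemma
  fixes f :: "real^'d::finite \<Rightarrow> real"
  assumes f: "integrable lborel f"
  shows integrable_reflect: "integrable lborel (\<lambda>u. f (x - u))"
    and integral_reflect: "(LINT u|lborel. f (x - u)) = (LINT u|lborel. f u)"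
proof -
  have [measurable]: "f \<in> borel_measurable borel"
    using f by (auto dest: borel_measurable_integrable)
  have "integrable (distr lborel borel (\<lambda>u. x - u)) f"
    using f lborel_reflect[of x] by simp
  then show "integrable lborel (\<lambda>u. f (x - u))"
    by (subst (asm) integrable_distr_eq) auto
  have "(LINT u|lborel. f u) = (LINT u|distr lborel borel (\<lambda>u. x - u). f u)"
    using lborel_reflect[of x] by simp
  also have "\<dots> = (LINT u|lborel. f (x - u))"
    by (rule integral_distr) auto
  finally show "(LINT u|lborel. f (x - u)) = (LINT u|lborel. f u)" ..
qed

context
  fixes g \<Theta> :: "real^'d::finite \<Rightarrow> complex"
  assumes repr: "\<And>x. g x = (LINT u|lborel. g (x - u) * \<Theta> u)"
begin

lemma norm_repr_le:
  assumes w: "integrable lborel w" "\<And>u. norm (g (x - u)) * norm (\<Theta> u) \<le> w u"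
  shows "norm (g x) \<le> (LINT u|lborel. w u)"
proof -
  have "0 \<le> w u" for u
    by (rule order_trans[OF _ w(2)]) auto
  then show ?thesis
    unfolding repr[of x] using w
    by (intro order_trans[OF integral_norm_bound integral_mono'[OF w(1)]]) (auto simp: norm_mult)
qed

text \<open>Peetre's argument: the weighted supremum \<open>S\<close> controls \<open>|g| ^ (1 - r)\<close> and can be absorbed.\<close>

lemma pointwise_bound_small_exponent:
  assumes r: "0 < r" "r \<le> 1" and I: "integrable lborel (\<lambda>u. norm (g u) powr r)"
    and A: "\<And>y. norm (g y) \<le> A * (1 + norm (x - y)) ^ N"
    and M: "\<And>u. (1 + norm u) ^ N * norm (\<Theta> u) \<le> M"
  shows "norm (g x) powr r \<le> M * (LINT u|lborel. norm (g u) powr r)"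
proof -
  let ?I = "LINT u|lborel. norm (g u) powr r"
  define W where "W y = (1 + norm (x - y)) ^ N" for y
  have W1: "1 \<le> W y" for y unfolding W_def by (intro one_le_power) simp
  have W0: "0 < W y" for y using W1[of y] by linarith
  define S where "S = (SUP y. norm (g y) / W y)"
  have bdd: "bdd_above (range (\<lambda>y. norm (g y) / W y))"
    using A W0 by (intro bdd_aboveI[of _ A]) (auto simp: field_simps W_def)
  have gS: "norm (g y) \<le> S * W y" for y
  proof -
    have "norm (g y) / W y \<le> S" unfolding S_def by (rule cSUP_upper[OF _ bdd]) simp
    then show ?thesis using W0[of y] by (simp add: field_simps)
  qed
  have S0: "0 \<le> S"
    using gS[of x] norm_ge_zero[of "g x"] W0[of x] by (metis order_trans zero_le_mult_iff not_le)
  have M0: "0 \<le> M" by (rule order_trans[OF _ M[of 0]]) simp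
  have I0: "0 \<le> ?I" by (intro integral_nonneg_AE) auto
  have key: "norm (g y) \<le> (S powr (1 - r) * W y * M) * ?I" for y
  proof -
    have "norm (g y) \<le> (LINT u|lborel. (S powr (1 - r) * W y * M) * (norm (g (y - u)) powr r))"
    proof (rule norm_repr_le)
      show "integrable lborel (\<lambda>u. (S powr (1 - r) * W y * M) * (norm (g (y - u)) powr r))"
        using integrable_reflect[OF I, of y] by simp
      fix u
      define a where "a = norm (g (y - u))"
      have a0: "0 \<le> a" by (simp add: a_def)
      have Wle: "W (y - u) \<le> W y * (1 + norm u) ^ N"
        using one_plus_norm_shift[of "x - (y - u)" N "- u"] by (simp add: W_def algebra_simps)
      have "a = a powr r * a powr (1 - r)"
        using a0 by (cases "a = 0") (auto simp: powr_add[symmetric])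
      also have "\<dots> \<le> a powr r * (S powr (1 - r) * (W y * (1 + norm u) ^ N))"
      proof (rule mult_left_mono)
        have "a powr (1 - r) \<le> (S * W (y - u)) powr (1 - r)"
          using gS[of "y - u"] a0 r by (intro powr_mono2) (auto simp: a_def)
        also have "\<dots> = S powr (1 - r) * W (y - u) powr (1 - r)"
          using S0 W0[of "y - u"] by (simp add: powr_mult)
        also have "\<dots> \<le> S powr (1 - r) * (W y * (1 + norm u) ^ N)"
        proof (rule mult_left_mono)
          have "W (y - u) powr (1 - r) \<le> W (y - u) powr 1"
            using r W1 by (intro powr_mono) auto
          then show "W (y - u) powr (1 - r) \<le> W y * (1 + norm u) ^ N"
            using Wle W0[of "y - u"] by simp
        qed simp
        finally show "a powr (1 - r) \<le> S powr (1 - r) * (W y * (1 + norm u) ^ N)" .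
      qed simp
      finally have "a * norm (\<Theta> u) \<le> a powr r * (S powr (1 - r) * (W y * (1 + norm u) ^ N)) * norm (\<Theta> u)"
        by (rule mult_right_mono) simp
      also have "\<dots> = (a powr r * S powr (1 - r) * W y) * ((1 + norm u) ^ N * norm (\<Theta> u))"
        by (simp add: mult_ac)
      also have "\<dots> \<le> (a powr r * S powr (1 - r) * W y) * M"
        using W0[of y] by (intro mult_left_mono M) auto
      finally show "norm (g (y - u)) * norm (\<Theta> u) \<le> (S powr (1 - r) * W y * M) * (norm (g (y - u)) powr r)"
        by (simp add: a_def mult_ac)
    qed
    also have "\<dots> = (S powr (1 - r) * W y * M) * ?I"
      using integral_reflect[OF I, of y] by simp
    finally show ?thesis .
  qed
  have "S \<le> S powr (1 - r) * (M * ?I)"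
    unfolding S_def
  proof (rule cSUP_least)
    fix y
    show "norm (g y) / W y \<le> (SUP y. norm (g y) / W y) powr (1 - r) * (M * ?I)"
      using key[of y] W0[of y] unfolding S_def[symmetric] by (simp add: field_simps)
  qed simp
  then have Sr: "S powr r \<le> M * ?I"
  proof (cases "S = 0")
    case False
    then have Sp: "0 < S powr (1 - r)" by simp
    assume "S \<le> S powr (1 - r) * (M * ?I)"
    moreover have "S = S powr (1 - r) * S powr r"
      using S0 False by (simp add: powr_add[symmetric])
    ultimately have "S powr (1 - r) * S powr r \<le> S powr (1 - r) * (M * ?I)" by simp
    then show ?thesis using Sp by simp
  qed (use M0 I0 in simp)
  have "norm (g x) powr r \<le> S powr r"
    using gS[of x] r by (intro powr_mono2) (auto simp: W_def)
  with Sr show ?thesis by linarith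
qed

lemma pointwise_bound_large_exponent:
  assumes r: "1 \<le> r" and I: "integrable lborel (\<lambda>u. norm (g u) powr r)"
    and c: "0 < c" "(LINT u|lborel. norm (g u) powr r) \<le> c powr r"
    and M: "\<And>u. norm (\<Theta> u) \<le> M" and \<Theta>: "integrable lborel \<Theta>"
  shows "norm (g x) \<le> c * (M + (LINT u|lborel. norm (\<Theta> u)))"
proof -
  have M0: "0 \<le> M" by (rule order_trans[OF _ M[of 0]]) simp
  have cr: "0 < c powr r" using c by simp
  have "norm (g x) \<le> (LINT u|lborel. (c * M / c powr r) * (norm (g (x - u)) powr r) + c * norm (\<Theta> u))"
  proof (rule norm_repr_le)
    show "integrable lborel (\<lambda>u. (c * M / c powr r) * (norm (g (x - u)) powr r) + c * norm (\<Theta> u))"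
      using integrable_reflect[OF I, of x] \<Theta> by simp
    fix u
    define b where "b = norm (g (x - u)) / c"
    have b0: "0 \<le> b" using c by (simp add: b_def)
    have "b \<le> b powr r + 1"
    proof (cases "b \<le> 1")
      case False
      then have "b powr 1 \<le> b powr r" using r by (intro powr_mono) auto
      then show ?thesis using False by simp
    qed (simp add: add_increasing)
    then have "c * b * norm (\<Theta> u) \<le> c * (b powr r + 1) * norm (\<Theta> u)"
      using c by (intro mult_right_mono mult_left_mono) auto
    also have "\<dots> = c * b powr r * norm (\<Theta> u) + c * norm (\<Theta> u)" by (simp add: algebra_simps)
    also have "\<dots> \<le> c * b powr r * M + c * norm (\<Theta> u)"
      using c by (intro add_mono mult_left_mono M) auto
    finally show "norm (g (x - u)) * norm (\<Theta> u) \<le> (c * M / c powr r) * (norm (g (x - u)) powr r) + c * norm (\<Theta> u)"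
      using c by (simp add: b_def powr_divide mult_ac)
  qed
  also have "\<dots> = (c * M / c powr r) * (LINT u|lborel. norm (g u) powr r) + c * (LINT u|lborel. norm (\<Theta> u))"
    using integrable_reflect[OF I, of x] \<Theta> integral_reflect[OF I, of x] by simp
  also have "\<dots> \<le> (c * M / c powr r) * c powr r + c * (LINT u|lborel. norm (\<Theta> u))"
    using c M0 cr by (intro add_mono mult_left_mono) auto
  also have "\<dots> = c * (M + (LINT u|lborel. norm (\<Theta> u)))"
    using cr by (simp add: algebra_simps)
  finally show ?thesis .
qed

end

lemma Nikolskii_pointwise:
  fixes \<Theta> :: "real^'d::finite \<Rightarrow> complex"
  assumes r: "0 < r" and \<Theta>: "integrable lborel \<Theta>"
    and M: "\<And>n. \<exists>M. \<forall>u. (1 + norm u) ^ n * norm (\<Theta> u) \<le> M"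
  obtains K where "1 \<le> K" "\<And>g x. (\<And>x. g x = (LINT u|lborel. g (x - u) * \<Theta> u)) \<Longrightarrow>
    \<exists>A N. \<forall>x. norm (g x) \<le> A * (1 + norm x) ^ N \<Longrightarrow>
    integrable lborel (\<lambda>u. norm (g u) powr r) \<Longrightarrow>
    norm (g x) \<le> K * (LINT u|lborel. norm (g u) powr r) powr (1 / r)"
proof -
  obtain M0 where "\<And>u. (1 + norm u) ^ 0 * norm (\<Theta> u) \<le> M0" using M by meson
  then have M0: "norm (\<Theta> u) \<le> M0" for u by simp
  have M00: "0 \<le> M0" by (rule order_trans[OF _ M0[of 0]]) simp
  define L where "L = (LINT u|lborel. norm (\<Theta> u))"
  have L0: "0 \<le> L" unfolding L_def by (intro integral_nonneg_AE) auto
  define K where "K = 1 + (if r \<le> 1 then M0 powr (1 / r) else M0 + L)"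
  have K1: "1 \<le> K" using M00 L0 by (simp add: K_def)
  have "norm (g x) \<le> K * (LINT u|lborel. norm (g u) powr r) powr (1 / r)"
    if repr: "\<And>x. g x = (LINT u|lborel. g (x - u) * \<Theta> u)"
      and growth: "\<exists>A N. \<forall>x. norm (g x) \<le> A * (1 + norm x) ^ N"
      and I: "integrable lborel (\<lambda>u. norm (g u) powr r)" for g x
  proof -
    let ?I = "LINT u|lborel. norm (g u) powr r"
    have I0: "0 \<le> ?I" by (intro integral_nonneg_AE) auto
    show ?thesis
    proof (cases "r \<le> 1")
      case True
      have root: "norm (g x) \<le> (m * ?I) powr (1 / r)" if "norm (g x) powr r \<le> m * ?I" for m x
      proof -
        have "norm (g x) = (norm (g x) powr r) powr (1 / r)"
          using r by (simp add: powr_powr)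
        also have "\<dots> \<le> (m * ?I) powr (1 / r)"
          using that r by (intro powr_mono2) auto
        finally show ?thesis .
      qed
      obtain A N where AN: "\<And>x. norm (g x) \<le> A * (1 + norm x) ^ N" using growth by blast
      have A0: "0 \<le> A" by (rule order_trans[OF _ order_trans[OF AN[of 0]]]) auto
      obtain MN where MN: "\<And>u. (1 + norm u) ^ N * norm (\<Theta> u) \<le> MN" using M by meson
      have "norm (g x) \<le> (MN * ?I) powr (1 / r)" for x
      proof (rule root, rule pointwise_bound_small_exponent[OF repr r True I _ MN])
        fix y
        have "A * (1 + norm y) ^ N \<le> A * ((1 + norm (y + (- x))) ^ N * (1 + norm (- x)) ^ N)"
          using A0 by (intro mult_left_mono one_plus_norm_shift)
        then show "norm (g y) \<le> (A * (1 + norm x) ^ N) * (1 + norm (x - y)) ^ N"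
          using AN[of y] by (simp add: norm_minus_commute mult_ac)
      qed
      then have "norm (g x) powr r \<le> M0 * ?I"
        by (intro pointwise_bound_small_exponent[OF repr r True I, where N = 0 and A = "(MN * ?I) powr (1 / r)"])
          (auto simp: M0)
      from root[OF this] have "norm (g x) \<le> M0 powr (1 / r) * ?I powr (1 / r)"
        using M00 I0 by (simp add: powr_mult)
      also have "\<dots> \<le> K * ?I powr (1 / r)"
        using True by (intro mult_right_mono) (auto simp: K_def)
      finally show ?thesis .
    next
      case False
      then have r1: "1 \<le> r" by simp
      have bd: "norm (g x) \<le> c * (M0 + L)" if "0 < c" "?I \<le> c powr r" for c
        unfolding L_def by (rule pointwise_bound_large_exponent[OF repr r1 I that M0 \<Theta>])
      show ?thesis
      proof (cases "?I = 0")
        case True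
        have "norm (g x) \<le> 0"
        proof (rule ccontr)
          assume "\<not> norm (g x) \<le> 0"
          then have g0: "0 < norm (g x)" by simp
          have pos: "0 < M0 + L + 1" using M00 L0 by simp
          have "norm (g x) \<le> norm (g x) / (M0 + L + 1) * (M0 + L)"
            using g0 pos True by (intro bd) auto
          then have "norm (g x) * (M0 + L + 1) \<le> norm (g x) * (M0 + L)"
            using pos by (simp add: field_simps)
          then show False using g0 by (simp add: mult_le_cancel_left)
        qed
        then show ?thesis using True by simp
      next
        case False
        then have "norm (g x) \<le> ?I powr (1 / r) * (M0 + L)"
          using I0 r by (intro bd) (auto simp: powr_powr)
        also have "\<dots> \<le> ?I powr (1 / r) * K"
          using \<open>\<not> r \<le> 1\<close> by (intro mult_left_mono) (auto simp: K_def)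
        finally show ?thesis by (simp add: mult.commute)
      qed
    qed
  qed
  with K1 that show ?thesis by blast
qed

lemma Lp_qnorm_le_of_pointwise:
  fixes g :: "real^'d::finite \<Rightarrow> complex"
  assumes p: "0 < p0" "p0 \<le> p" "p0 \<noteq> \<infinity>" and g[measurable]: "g \<in> borel_measurable borel"
    and I: "integrable lborel (\<lambda>u. norm (g u) powr enn2real p0)" and K: "1 \<le> K"
    and b: "\<And>x. norm (g x) \<le> K * (LINT u|lborel. norm (g u) powr enn2real p0) powr (1 / enn2real p0)"
  shows "Lp_qnorm p g \<le> ennreal K * Lp_qnorm p0 g"
proof -
  let ?r = "enn2real p0" and ?I = "LINT u|lborel. norm (g u) powr enn2real p0"
  define J where "J = ?I powr (1 / ?r)"
  have r: "0 < ?r" using p by (intro enn2real_pos) auto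
  have I0: "0 \<le> ?I" by (intro integral_nonneg_AE) auto
  have J0: "0 \<le> J" by (simp add: J_def)
  have Jr: "J powr ?r = ?I" using r I0 by (simp add: J_def powr_powr)
  have nI: "(\<integral>\<^sup>+ u. ennreal (norm (g u) powr ?r) \<partial>lborel) = ennreal ?I"
    by (rule nn_integral_eq_integral[OF I]) simp
  have L: "Lp_qnorm p0 g = ennreal J"
    using p I0 by (simp add: Lp_qnorm_def nI J_def)
  have b: "norm (g x) \<le> K * J" for x using b[of x] by (simp add: J_def)
  have KJ: "0 \<le> K * J" using K J0 by simp
  have "Lp_qnorm p g \<le> ennreal (K * J)"
  proof (cases "p = \<infinity>")
    case True
    then show ?thesis using b by (auto simp: Lp_qnorm_def intro!: Inf_lower ennreal_leI)
  next
    case False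
    let ?s = "enn2real p"
    have rs: "?r \<le> ?s" using p False by (auto intro!: enn2real_mono simp: less_top)
    with r have s: "0 < ?s" by linarith
    have "norm (g x) powr ?s \<le> (K * J) powr (?s - ?r) * norm (g x) powr ?r" for x
    proof (cases "g x = 0")
      case False
      then have "norm (g x) powr ?s = norm (g x) powr (?s - ?r) * norm (g x) powr ?r"
        by (simp add: powr_add[symmetric])
      also have "\<dots> \<le> (K * J) powr (?s - ?r) * norm (g x) powr ?r"
        using b[of x] rs by (intro mult_right_mono powr_mono2) auto
      finally show ?thesis .
    qed simp
    then have "(\<integral>\<^sup>+ u. ennreal (norm (g u) powr ?s) \<partial>lborel) \<le>
        (\<integral>\<^sup>+ u. ennreal ((K * J) powr (?s - ?r)) * ennreal (norm (g u) powr ?r) \<partial>lborel)"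
      by (intro nn_integral_mono) (simp add: ennreal_mult[symmetric])
    also have "\<dots> = ennreal ((K * J) powr (?s - ?r)) * ennreal ?I"
      by (subst nn_integral_cmult) (auto simp: nI)
    also have "\<dots> \<le> ennreal ((K * J) powr (?s - ?r)) * ennreal ((K * J) powr ?r)"
    proof (intro mult_left_mono ennreal_leI)
      have "J \<le> K * J" using K J0 mult_right_mono[of 1 K J] by simp
      then show "?I \<le> (K * J) powr ?r"
        unfolding Jr[symmetric] using J0 r by (intro powr_mono2) auto
    qed simp
    also have "\<dots> = ennreal ((K * J) powr ?s)"
      by (simp add: ennreal_mult[symmetric] powr_add[symmetric])
    finally have "enn_powr (\<integral>\<^sup>+ u. ennreal (norm (g u) powr ?s) \<partial>lborel) (1 / ?s) \<le>
        enn_powr (ennreal ((K * J) powr ?s)) (1 / ?s)"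
      using s by (intro enn_powr_mono) auto
    then show ?thesis
      using False s KJ by (simp add: Lp_qnorm_def powr_powr)
  qed
  then show ?thesis using K J0 by (simp add: L ennreal_mult)
qed

lemma Nikolskii_inequality:
  fixes h \<theta> :: "'d::finite \<Rightarrow> real \<Rightarrow> real"
  assumes p: "0 < p0" "p0 \<le> p" and h: "\<And>i. bump R (h i)" and \<theta>: "\<And>i. bump R' (\<theta> i)"
    and one: "\<And>i s. h i s \<noteq> 0 \<Longrightarrow> \<theta> i s = 1"
  obtains K where "\<And>T. tempered T \<Longrightarrow>
    Lp_qnorm p (fourier_mult (\<lambda>\<xi>. complex_of_real (\<Prod>i\<in>UNIV. h i (\<xi> $ i))) T) \<le>
    ennreal K * Lp_qnorm p0 (fourier_mult (\<lambda>\<xi>. complex_of_real (\<Prod>i\<in>UNIV. h i (\<xi> $ i))) T)"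
proof (cases "p0 = \<infinity>")
  case True
  then have "p = p0" using p by (simp add: top_unique)
  then show ?thesis using that[of 1] by simp
next
  case False
  let ?r = "enn2real p0"
  have r: "0 < ?r" using p False by (intro enn2real_pos) auto
  define \<Theta> where "\<Theta> = inv_fourier (\<lambda>\<xi>. complex_of_real (\<Prod>i\<in>UNIV. \<theta> i (\<xi> $ i)))"
  have \<Theta>: "integrable lborel \<Theta>"
    unfolding \<Theta>_def by (rule rapid_multiplier_integrable[OF rapid_multiplier_tensor[OF \<theta>]])
  have M: "\<exists>M. \<forall>u. (1 + norm u) ^ n * norm (\<Theta> u) \<le> M" for n
  proof -
    have "schwartz (\<lambda>y. \<Theta> (- y))"
      unfolding \<Theta>_def by (rule schwartz_inv_fourier_tensor[OF \<theta>])
    from schwartz_iter_pd_bounded[OF this, of n "[]"]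
    obtain B where B: "\<And>x. (1 + norm x) ^ n * norm (\<Theta> (- x)) \<le> B" by auto
    have "(1 + norm u) ^ n * norm (\<Theta> u) \<le> B" for u using B[of "- u"] by simp
    then show ?thesis by blast
  qed
  obtain K where K: "1 \<le> K" "\<And>g x. (\<And>x. g x = (LINT u|lborel. g (x - u) * \<Theta> u)) \<Longrightarrow>
    \<exists>A N. \<forall>x. norm (g x) \<le> A * (1 + norm x) ^ N \<Longrightarrow>
    integrable lborel (\<lambda>u. norm (g u) powr ?r) \<Longrightarrow>
    norm (g x) \<le> K * (LINT u|lborel. norm (g u) powr ?r) powr (1 / ?r)"
    using Nikolskii_pointwise[OF r \<Theta> M] by blast
  show ?thesis
  proof (rule that[of K])
    fix T :: "(real^'d \<Rightarrow> complex) \<Rightarrow> complex" assume T: "tempered T"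
    define g where "g = fourier_mult (\<lambda>\<xi>. complex_of_real (\<Prod>i\<in>UNIV. h i (\<xi> $ i))) T"
    note rep = fourier_mult_reproducing[of T R h R' \<theta>, OF T h \<theta> one, folded g_def \<Theta>_def]
    have gm[measurable]: "g \<in> borel_measurable borel"
      by (rule borel_measurable_continuous_onI[OF rep(1)])
    have "Lp_qnorm p g \<le> ennreal K * Lp_qnorm p0 g"
    proof (cases "Lp_qnorm p0 g = top")
      case True
      then show ?thesis using K(1) by (simp add: ennreal_mult_top)
    next
      case finite: False
      then have "(\<integral>\<^sup>+ u. ennreal (norm (g u) powr ?r) \<partial>lborel) < top"
        using False by (simp add: Lp_qnorm_def less_top[symmetric] enn_powr_less_top flip: less_top)
          (metis enn_powr_top top.not_eq_extremum)
      then have I: "integrable lborel (\<lambda>u. norm (g u) powr ?r)"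
        by (subst integrable_iff_bounded) auto
      show ?thesis
        by (rule Lp_qnorm_le_of_pointwise[OF p False gm I K(1) K(2)[OF rep(3,2) I]])
    qed
    then show "Lp_qnorm p (fourier_mult (\<lambda>\<xi>. complex_of_real (\<Prod>i\<in>UNIV. h i (\<xi> $ i))) T) \<le>
        ennreal K * Lp_qnorm p0 (fourier_mult (\<lambda>\<xi>. complex_of_real (\<Prod>i\<in>UNIV. h i (\<xi> $ i))) T)"
      by (simp add: g_def)
  qed
qed

section \<open>The dyadic pieces\<close>

context
  fixes T :: "(real^'d::finite \<Rightarrow> complex) \<Rightarrow> complex" and h :: "real^'d \<Rightarrow> complex" and l :: "real^'d"
  assumes T: "tempered T" and h: "rapid_multiplier h" and l: "\<And>i. l $ i \<ge> 1"
begin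

lemma tempered_rapid_conv_op: "tempered (\<lambda>\<eta>. T (conv_op l (inv_fourier h) \<eta>))"
  using h T l by (intro tempered_conv_op) (auto simp: rapid_multiplier_def)

lemma fourier_mult_conv_op_one:
  assumes M: "integrable lborel M" "\<And>\<xi>. h \<xi> \<noteq> 0 \<Longrightarrow> M \<xi> = 1"
  shows "fourier_mult M (\<lambda>\<eta>. T (conv_op l (inv_fourier h) \<eta>)) = (\<lambda>x. T (\<lambda>y. inv_fourier h (x - l * y)))"
proof -
  have "(\<lambda>\<xi>. M \<xi> * h \<xi>) = h"
    using M(2) by (force simp: fun_eq_iff)
  then show ?thesis
    by (auto simp: fourier_mult_conv_op[OF h M(1)])
qed

lemma fourier_mult_conv_op_zero:
  assumes M: "integrable lborel M" "\<And>\<xi>. h \<xi> \<noteq> 0 \<Longrightarrow> M \<xi> = 0"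
  shows "fourier_mult M (\<lambda>\<eta>. T (conv_op l (inv_fourier h) \<eta>)) = (\<lambda>_. 0)"
proof -
  have "(\<lambda>\<xi>. M \<xi> * h \<xi>) = (\<lambda>_. 0)"
    using M(2) by (force simp: fun_eq_iff)
  moreover have "inv_fourier (\<lambda>_. 0 :: complex) = (\<lambda>_::real^'d. 0)"
    by (simp add: inv_fourier_def fun_eq_iff)
  ultimately show ?thesis
    by (auto simp: fourier_mult_conv_op[OF h M(1)] tempered_zero[OF T])
qed

end

lemma bump_mixed_admissible: "mixed_admissible \<phi>0 \<Longrightarrow> bump (3 / 2) \<phi>0"
  by (rule bump_smooth_fun1) (auto simp: mixed_admissible_def)

lemma two_powr_minus: "2 powr (- real n) = 1 / 2 ^ n" "2 powr (1 - real n) = 2 / 2 ^ n"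
  by (simp_all add: powr_minus powr_diff powr_realpow inverse_eq_divide)

lemma bump_mixed_piece1:
  assumes \<phi>: "mixed_admissible \<phi>0"
  shows "bump (3 / 2 * 2 ^ j) (mixed_piece1 \<phi>0 j)"
proof (cases "j = 0")
  case True
  then show ?thesis using bump_mixed_admissible[OF \<phi>] by (simp add: mixed_piece1_def[abs_def])
next
  case False
  have *: "bump (3 / 2 * 2 ^ j) (\<lambda>s. \<phi>0 (c * s))" if c: "0 < c" "3 / 2 / c \<le> 3 / 2 * 2 ^ j" for c
    using bump_mono[OF bump_affine[OF bump_mixed_admissible[OF \<phi>] c(1), of 0]] c(2) by simp
  have "bump (3 / 2 * 2 ^ j) (\<lambda>s. \<phi>0 (2 powr (- real j) * s))"
    by (rule *) (simp_all add: two_powr_minus)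
  moreover have "bump (3 / 2 * 2 ^ j) (\<lambda>s. \<phi>0 (2 powr (1 - real j) * s))"
    by (rule *) (simp_all add: two_powr_minus)
  ultimately have "bump (3 / 2 * 2 ^ j) (\<lambda>s. \<phi>0 (2 powr (- real j) * s) - \<phi>0 (2 powr (1 - real j) * s))"
    by (rule bump_diff)
  moreover have "mixed_piece1 \<phi>0 j = (\<lambda>s. \<phi>0 (2 powr (- real j) * s) - \<phi>0 (2 powr (1 - real j) * s))"
    using False by (simp add: mixed_piece1_def fun_eq_iff)
  ultimately show ?thesis by simp
qed

lemma bump_uniform_radius:
  fixes h :: "'d::finite \<Rightarrow> real \<Rightarrow> real"
  assumes "\<And>i. bump (R i) (h i)"
  shows "bump (\<Sum>i\<in>UNIV. \<bar>R i\<bar>) (h i)"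
proof (rule bump_mono[OF assms])
  show "R i \<le> (\<Sum>i\<in>UNIV. \<bar>R i\<bar>)"
    using member_le_sum[of i UNIV "\<lambda>i. \<bar>R i\<bar>"] by simp
qed

lemma rapid_multiplier_mixed_piece:
  assumes \<phi>: "mixed_admissible \<phi>0" and l: "\<And>i. l $ i > 0"
  shows "rapid_multiplier (\<lambda>\<xi>. complex_of_real (mixed_piece \<phi>0 k (l * \<xi>)))"
proof -
  have "bump ((3 / 2 * 2 ^ (k $ i) + \<bar>0\<bar>) / l $ i) (\<lambda>s. mixed_piece1 \<phi>0 (k $ i) (l $ i * s + 0))" for i
    by (rule bump_affine[OF bump_mixed_piece1[OF \<phi>] l])
  from rapid_multiplier_tensor[OF bump_uniform_radius, OF this]
  show ?thesis by (simp add: mixed_piece_def)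
qed

lemma mixed_piece_integrable:
  fixes k :: "nat^'d::finite"
  assumes "mixed_admissible \<phi>0"
  shows "integrable lborel (\<lambda>\<xi>. complex_of_real (mixed_piece \<phi>0 k \<xi>))"
  using rapid_multiplier_integrable(1)[OF rapid_multiplier_mixed_piece[OF assms, of 1 k]]
  by (simp add: one_vec_times)

lemma iso_piece_integrable:
  fixes \<psi>0 :: "real^'d::finite \<Rightarrow> real"
  assumes \<psi>: "iso_admissible \<psi>0"
  shows "integrable lborel (\<lambda>\<xi>. complex_of_real (iso_piece \<psi>0 j \<xi>))"
proof -
  have "continuous_on UNIV (iter_pd [] \<psi>0)"
    using \<psi> unfolding iso_admissible_def smooth_fun_def by blast
  then have cont: "continuous_on UNIV \<psi>0" by simp
  have int: "integrable lborel (\<lambda>x. complex_of_real (\<psi>0 (c *\<^sub>R x)))" if c: "c > 0" for c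
  proof -
    let ?S = "cbox (\<chi> i. - (3 / (2 * c))) (\<chi> i. 3 / (2 * c)) :: (real^'d) set"
    have "continuous_on ?S (\<lambda>x. \<psi>0 (c *\<^sub>R x))"
      by (intro continuous_on_compose2[OF cont] continuous_intros) auto
    then have "integrable lborel (\<lambda>x. indicator ?S x *\<^sub>R \<psi>0 (c *\<^sub>R x))"
      by (intro borel_integrable_compact) auto
    moreover have "indicator ?S x *\<^sub>R \<psi>0 (c *\<^sub>R x) = \<psi>0 (c *\<^sub>R x)" for x
    proof (cases "x \<in> ?S")
      case False
      then obtain i where "\<not> (- (3 / (2 * c)) \<le> x $ i \<and> x $ i \<le> 3 / (2 * c))"
        by (auto simp: mem_box_cart)
      then have "\<bar>(c *\<^sub>R x) $ i\<bar> \<ge> 3 / 2"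
        using c by (auto simp: field_simps abs_if abs_mult)
      then have "\<psi>0 (c *\<^sub>R x) = 0" using \<psi> unfolding iso_admissible_def by blast
      then show ?thesis by simp
    qed simp
    ultimately show ?thesis by (intro integrable_of_real) (simp only:)
  qed
  show ?thesis
  proof (cases "j = 0")
    case True
    then show ?thesis using int[of 1] by (simp add: iso_piece_def)
  next
    case False
    then show ?thesis
      using int[of "2 powr (- real j)"] int[of "2 powr (1 - real j)"] by (simp add: iso_piece_def)
  qed
qed

lemma mixed_piece1_low:
  assumes \<phi>: "mixed_admissible \<phi>0" and s: "\<bar>s\<bar> \<le> 1"
  shows "mixed_piece1 \<phi>0 n s = (if n = 0 then 1 else 0)"
proof -
  have "\<phi>0 (c * s) = 1" if "0 \<le> c" "c \<le> 1" for c
    using \<phi> s that mult_mono[of c 1 "\<bar>s\<bar>" 1] by (simp add: mixed_admissible_def abs_mult)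
  from this[of 1] this[of "2 powr (- real n)"] this[of "2 powr (1 - real n)"]
  show ?thesis
    using powr_mono[of "1 - real n" 0 2] powr_mono[of "- real n" 0 2] by (auto simp: mixed_piece1_def)
qed

lemma mixed_piece_low:
  fixes k :: "nat^'d::finite"
  assumes \<phi>: "mixed_admissible \<phi>0" and s: "\<And>i. \<bar>\<xi> $ i\<bar> \<le> 1"
  shows "mixed_piece \<phi>0 k \<xi> = (if k = 0 then 1 else 0)"
proof -
  have "mixed_piece \<phi>0 k \<xi> = (\<Prod>i\<in>UNIV. if k $ i = 0 then 1 else 0)"
    unfolding mixed_piece_def using mixed_piece1_low[OF \<phi> s] by simp
  also have "\<dots> = (if k = 0 then 1 else 0)"
    by (auto simp: vec_eq_iff)
  finally show ?thesis .
qed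

lemma iso_piece_low:
  fixes \<psi>0 :: "real^'d::finite \<Rightarrow> real"
  assumes \<psi>: "iso_admissible \<psi>0" and s: "\<And>i. \<bar>\<xi> $ i\<bar> \<le> 1"
  shows "iso_piece \<psi>0 n \<xi> = (if n = 0 then 1 else 0)"
proof -
  have "\<psi>0 (c *\<^sub>R \<xi>) = 1" if "0 \<le> c" "c \<le> 1" for c
    using \<psi> that mult_mono[of c 1 "\<bar>\<xi> $ _\<bar>" 1] s by (simp add: iso_admissible_def abs_mult)
  from this[of 1] this[of "2 powr (- real n)"] this[of "2 powr (1 - real n)"]
  show ?thesis
    using powr_mono[of "1 - real n" 0 2] powr_mono[of "- real n" 0 2] by (auto simp: iso_piece_def)
qed

lemma mixed_piece1_support:
  assumes \<phi>: "mixed_admissible \<phi>0" and "mixed_piece1 \<phi>0 j s \<noteq> 0"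
  shows "\<bar>s\<bar> \<le> 3 / 2 * 2 ^ j"
  using bump_mixed_piece1[OF \<phi>, of j] assms(2) unfolding bump_def by (meson not_le)

text \<open>On this window of frequencies exactly one dyadic cutoff of each kind is nonzero.\<close>

lemma dyadic_window:
  fixes s :: real and n j :: nat
  assumes s: "25 / 32 * 2 ^ j \<le> s" "s \<le> 31 / 32 * 2 ^ j"
  shows "n < j \<Longrightarrow> 2 powr (- real n) * s > 3 / 2"
    and "j \<le> n \<Longrightarrow> 0 \<le> 2 powr (- real n) * s \<and> 2 powr (- real n) * s \<le> 1"
proof -
  note e = two_powr_minus(1)
  show "2 powr (- real n) * s > 3 / 2" if "n < j"
  proof -
    have "(2::real) ^ Suc n \<le> 2 ^ j" using that by (intro power_increasing) auto
    moreover have "0 < (2::real) ^ n" by simp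
    ultimately have "3 * 2 ^ n < s * 2" using s(1) unfolding power_Suc by linarith
    then show ?thesis by (simp add: e field_simps)
  qed
  show "0 \<le> 2 powr (- real n) * s \<and> 2 powr (- real n) * s \<le> 1" if "j \<le> n"
  proof -
    have "(2::real) ^ j \<le> 2 ^ n" using that by (intro power_increasing) auto
    moreover have "0 < (2::real) ^ j" by simp
    ultimately have "0 \<le> s" "s \<le> 2 ^ n" using s by linarith+
    then show ?thesis by (simp add: e field_simps)
  qed
qed

lemma mixed_piece1_window:
  assumes \<phi>: "mixed_admissible \<phi>0" and j: "j \<ge> 1"
    and s: "25 / 32 * 2 ^ j \<le> s" "s \<le> 31 / 32 * 2 ^ j"
  shows "mixed_piece1 \<phi>0 n s = (if n = j then 1 else 0)"
proof -
  have v: "\<phi>0 (2 powr (- real n) * s) = (if j \<le> n then 1 else 0)" for n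
    using \<phi> dyadic_window[OF s, of n] by (auto simp: mixed_admissible_def)
  show ?thesis
  proof (cases n)
    case 0
    then show ?thesis using v[of 0] j by (simp add: mixed_piece1_def)
  next
    case (Suc n')
    then show ?thesis using v[of n] v[of n'] by (auto simp: mixed_piece1_def)
  qed
qed

lemma iso_piece_window:
  fixes \<psi>0 :: "real^'d::finite \<Rightarrow> real"
  assumes \<psi>: "iso_admissible \<psi>0" and j: "j \<ge> 1"
    and s: "25 / 32 * 2 ^ j \<le> \<xi> $ i1" "\<xi> $ i1 \<le> 31 / 32 * 2 ^ j"
    and o: "\<And>i. i \<noteq> i1 \<Longrightarrow> \<bar>\<xi> $ i\<bar> \<le> 1"
  shows "iso_piece \<psi>0 n \<xi> = (if n = j then 1 else 0)"
proof -
  have v: "\<psi>0 ((2 powr (- real n)) *\<^sub>R \<xi>) = (if j \<le> n then 1 else 0)" for n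
  proof (cases "j \<le> n")
    case True
    have "\<bar>((2 powr (- real n)) *\<^sub>R \<xi>) $ i\<bar> \<le> 1" for i
    proof (cases "i = i1")
      case i: True
      then show ?thesis using dyadic_window(2)[OF s True] by simp
    next
      case False
      have "(2::real) powr (- real n) \<le> 1" using powr_mono[of "- real n" 0 2] by simp
      then show ?thesis using o[OF False] mult_mono[of "2 powr (- real n)" 1 "\<bar>\<xi> $ i\<bar>" 1]
        by (simp add: abs_mult)
    qed
    then show ?thesis using \<psi> True by (simp add: iso_admissible_def)
  next
    case False
    then have "\<bar>((2 powr (- real n)) *\<^sub>R \<xi>) $ i1\<bar> \<ge> 3 / 2"
      using dyadic_window(1)[OF s, of n] by simp
    then show ?thesis using \<psi> False unfolding iso_admissible_def by (metis (no_types))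
  qed
  show ?thesis
  proof (cases n)
    case 0
    then show ?thesis using v[of 0] j by (simp add: iso_piece_def)
  next
    case (Suc n')
    then show ?thesis using v[of n] v[of n'] by (auto simp: iso_piece_def)
  qed
qed

definition coord_index :: "'d::finite \<Rightarrow> nat \<Rightarrow> nat^'d" where
  "coord_index i1 j = (\<chi> i. if i = i1 then j else 0)"

lemma coord_index_sum: "(\<Sum>i\<in>UNIV. coord_index i1 j $ i) = j"
  by (simp add: coord_index_def)

lemma coord_index_inj: "coord_index i1 j = coord_index i1 j' \<longleftrightarrow> j = j'"
  by (auto simp: coord_index_def vec_eq_iff)

lemma mixed_piece_window:
  fixes k :: "nat^'d::finite"
  assumes \<phi>: "mixed_admissible \<phi>0" and j: "j \<ge> 1"
    and s: "25 / 32 * 2 ^ j \<le> \<xi> $ i1" "\<xi> $ i1 \<le> 31 / 32 * 2 ^ j"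
    and o: "\<And>i. i \<noteq> i1 \<Longrightarrow> \<bar>\<xi> $ i\<bar> \<le> 1"
  shows "mixed_piece \<phi>0 k \<xi> = (if k = coord_index i1 j then 1 else 0)"
proof -
  have "mixed_piece1 \<phi>0 (k $ i) (\<xi> $ i) = (if k $ i = coord_index i1 j $ i then 1 else 0)" for i
    using mixed_piece1_window[OF \<phi> j s] mixed_piece1_low[OF \<phi> o]
    by (cases "i = i1") (auto simp: coord_index_def)
  then have "mixed_piece \<phi>0 k \<xi> = (\<Prod>i\<in>UNIV. if k $ i = coord_index i1 j $ i then 1 else 0)"
    by (simp add: mixed_piece_def)
  also have "\<dots> = (if k = coord_index i1 j then 1 else 0)"
    by (auto simp: vec_eq_iff)
  finally show ?thesis .
qed

section \<open>Sufficient conditions\<close>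

lemma mixed_piece_Nikolskii:
  assumes \<phi>: "mixed_admissible \<phi>0" and p: "0 < p0" "p0 \<le> p"
  obtains K where "\<And>(f :: (real^'d::finite \<Rightarrow> complex) \<Rightarrow> complex) k. tempered f \<Longrightarrow>
    ennreal (2 powr ((real (\<Sum>i\<in>UNIV. k $ i) + real CARD('d)) / enn2real p)) *
      Lp_qnorm p (fourier_mult (\<lambda>x. complex_of_real (mixed_piece \<phi>0 k x)) f) \<le>
    ennreal K * (ennreal (2 powr ((real (\<Sum>i\<in>UNIV. k $ i) + real CARD('d)) / enn2real p0)) *
      Lp_qnorm p0 (fourier_mult (\<lambda>x. complex_of_real (mixed_piece \<phi>0 k x)) f))"
proof -
  have b1: "bump (3 / 2) \<phi>0" by (rule bump_mixed_admissible[OF \<phi>])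
  have b2: "bump 3 (\<lambda>s. \<phi>0 (1 / 2 * s))"
    using bump_affine[OF b1, of "1 / 2" 0] by simp
  have one: "\<phi>0 (1 / 2 * s) = 1" if "\<phi>0 s \<noteq> 0" for s
  proof -
    have "\<not> \<bar>s\<bar> > 3 / 2" using that \<phi> unfolding mixed_admissible_def by blast
    then have "\<bar>1 / 2 * s\<bar> \<le> 1" by linarith
    then show ?thesis using \<phi> unfolding mixed_admissible_def by blast
  qed
  obtain K where K0: "\<And>T. tempered T \<Longrightarrow>
    Lp_qnorm p (fourier_mult (\<lambda>\<xi>::real^'d. complex_of_real (\<Prod>i\<in>UNIV. \<phi>0 (\<xi> $ i))) T) \<le>
    ennreal K * Lp_qnorm p0 (fourier_mult (\<lambda>\<xi>. complex_of_real (\<Prod>i\<in>UNIV. \<phi>0 (\<xi> $ i))) T)"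
    using Nikolskii_inequality[OF p, of "3 / 2" "\<lambda>_::'d. \<phi>0" 3 "\<lambda>_ s. \<phi>0 (1 / 2 * s)", OF b1 b2 one] by blast
  have K: "Lp_qnorm p (fourier_mult (\<lambda>\<xi>::real^'d. complex_of_real (mixed_piece \<phi>0 0 \<xi>)) T) \<le>
    ennreal K * Lp_qnorm p0 (fourier_mult (\<lambda>\<xi>. complex_of_real (mixed_piece \<phi>0 0 \<xi>)) T)" if "tempered T" for T
    using K0[OF that] by (simp add: mixed_piece_def mixed_piece1_def)
  show ?thesis
  proof (rule that[of K])
    fix f :: "(real^'d \<Rightarrow> complex) \<Rightarrow> complex" and k assume T: "tempered f"
    define P where "P = fourier_mult (\<lambda>x. complex_of_real (mixed_piece \<phi>0 k x)) f"
    define l :: "real^'d" where "l = (\<chi> i. 2 ^ Suc (k $ i))"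
    define m :: "real^'d" where "m = (\<chi> i. 1 / 2 ^ Suc (k $ i))"
    have l1: "l $ i \<ge> 1" and l0: "l $ i > 0" and m0: "m $ i > 0" and lm: "l $ i * m $ i = 1" for i
      by (simp_all add: l_def m_def del: power_Suc)
    define \<Phi> where "\<Phi> k' x = complex_of_real (mixed_piece \<phi>0 k' x)" for k' and x :: "real^'d"
    define h where "h \<xi> = complex_of_real (\<Prod>i\<in>UNIV. l $ i) * \<Phi> k (l * \<xi>)" for \<xi>
    have h: "rapid_multiplier h"
      unfolding h_def \<Phi>_def by (intro rapid_multiplier_cmult rapid_multiplier_mixed_piece \<phi> l0)
    have \<Phi>i: "integrable lborel (\<Phi> k')" for k'
      unfolding \<Phi>_def by (rule mixed_piece_integrable[OF \<phi>])
    have supp: "\<bar>\<xi> $ i\<bar> \<le> 1" if "h \<xi> \<noteq> 0" for \<xi> i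
    proof -
      have "mixed_piece1 \<phi>0 (k $ i) (l $ i * \<xi> $ i) \<noteq> 0"
        using that by (auto simp: h_def \<Phi>_def mixed_piece_def)
      from mixed_piece1_support[OF \<phi> this] show ?thesis
        by (simp add: l_def abs_mult field_simps)
    qed
    define G where "G = (\<lambda>\<eta>. f (conv_op l (inv_fourier h) \<eta>))"
    define g where "g x = P (m * x)" for x
    have invh: "inv_fourier h x = inv_fourier (\<Phi> k) (m * x)" for x
      unfolding h_def using \<Phi>i[of k]
      by (intro inv_fourier_dilation l0 lm) (auto dest: borel_measurable_integrable)
    have ml: "m * (x - l * y) = m * x - y" for x y
      using lm by (simp add: vec_eq_iff right_diff_distrib mult.assoc[symmetric] mult.commute[of "m $ _"])
    have shape: "(\<lambda>x. f (\<lambda>y. inv_fourier h (x - l * y))) = g"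
      by (simp add: fun_eq_iff invh ml g_def P_def fourier_mult_def \<Phi>_def[abs_def])
    have G0: "fourier_mult (\<Phi> 0) G = g"
      using fourier_mult_conv_op_one[OF T h l1 \<Phi>i, of 0] mixed_piece_low[OF \<phi> supp, of _ 0]
      by (auto simp: G_def shape \<Phi>_def)
    have Lam: "(\<Prod>i\<in>UNIV. l $ i) powr r = 2 powr ((real (\<Sum>i\<in>UNIV. k $ i) + real CARD('d)) * r)" for r
    proof -
      have "(\<Prod>i\<in>UNIV. l $ i) = (\<Prod>i\<in>UNIV. 2 ^ (k $ i)) * 2 ^ CARD('d)"
        by (simp add: l_def prod.distrib)
      also have "\<dots> = 2 ^ ((\<Sum>i\<in>UNIV. k $ i) + CARD('d))"
        by (simp add: power_sum power_add)
      also have "\<dots> = 2 powr real ((\<Sum>i\<in>UNIV. k $ i) + CARD('d))"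
        by (rule powr_realpow[symmetric]) simp
      finally show ?thesis by (simp add: powr_powr)
    qed
    have scale: "Lp_qnorm p' g = ennreal (2 powr ((real (\<Sum>i\<in>UNIV. k $ i) + real CARD('d)) / enn2real p')) * Lp_qnorm p' P" for p'
      unfolding g_def[abs_def] using Lp_qnorm_dilation[OF m0 l0 lm, of p' P] Lam[of "1 / enn2real p'"] by simp
    have "tempered G"
      unfolding G_def by (rule tempered_rapid_conv_op[OF T h l1])
    from K[OF this] have "Lp_qnorm p g \<le> ennreal K * Lp_qnorm p0 g"
      using G0 by (simp add: \<Phi>_def[abs_def])
    then show "ennreal (2 powr ((real (\<Sum>i\<in>UNIV. k $ i) + real CARD('d)) / enn2real p)) *
        Lp_qnorm p (fourier_mult (\<lambda>x. complex_of_real (mixed_piece \<phi>0 k x)) f) \<le>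
      ennreal K * (ennreal (2 powr ((real (\<Sum>i\<in>UNIV. k $ i) + real CARD('d)) / enn2real p0)) *
        Lp_qnorm p0 (fourier_mult (\<lambda>x. complex_of_real (mixed_piece \<phi>0 k x)) f))"
      by (simp only: scale P_def)
  qed
qed

lemma mixed_embedding:
  fixes p q p0 q0 :: ennreal and t t0 :: real
  assumes \<phi>: "mixed_admissible \<phi>0"
    and pos: "0 < p" "0 < q" "0 < p0" "0 < q0" and p: "p0 \<le> p"
  defines "\<delta> \<equiv> (t0 - 1 / enn2real p0) - (t - 1 / enn2real p)"
  assumes \<delta>0: "\<delta> \<ge> 0" and \<delta>pos: "q < q0 \<Longrightarrow> \<delta> > 0"
  shows "cont_embed (mixed_space \<phi>0 t0 p0 q0 :: ((real^'d::finite \<Rightarrow> complex) \<Rightarrow> complex) set)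
    (mixed_qnorm \<phi>0 t0 p0 q0) (mixed_space \<phi>0 t p q) (mixed_qnorm \<phi>0 t p q)"
proof -
  obtain C where C: "\<And>(f :: (real^'d \<Rightarrow> complex) \<Rightarrow> complex) k. tempered f \<Longrightarrow>
    ennreal (2 powr ((real (\<Sum>i\<in>UNIV. k $ i) + real CARD('d)) / enn2real p)) *
      Lp_qnorm p (fourier_mult (\<lambda>x. complex_of_real (mixed_piece \<phi>0 k x)) f) \<le>
    ennreal C * (ennreal (2 powr ((real (\<Sum>i\<in>UNIV. k $ i) + real CARD('d)) / enn2real p0)) *
      Lp_qnorm p0 (fourier_mult (\<lambda>x. complex_of_real (mixed_piece \<phi>0 k x)) f))"
    using mixed_piece_Nikolskii[OF \<phi> pos(3) p] by blast
  define D where "D = real CARD('d)"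
  define K where "K = \<bar>C\<bar> * 2 powr (D / enn2real p0 - D / enn2real p)"
  have K0: "K \<ge> 0" by (simp add: K_def)
  define w where "w k = ennreal (2 powr (- \<delta> * real (\<Sum>i\<in>UNIV. k $ i)))" for k :: "nat^'d"
  have piece: "ennreal (2 powr (real (\<Sum>i\<in>UNIV. k $ i) * t)) *
        Lp_qnorm p (fourier_mult (\<lambda>x. complex_of_real (mixed_piece \<phi>0 k x)) f) \<le>
      ennreal K * w k * (ennreal (2 powr (real (\<Sum>i\<in>UNIV. k $ i) * t0)) *
        Lp_qnorm p0 (fourier_mult (\<lambda>x. complex_of_real (mixed_piece \<phi>0 k x)) f))" (is "?L \<le> ?R")
    if f: "f \<in> mixed_space \<phi>0 t0 p0 q0" for f :: "(real^'d \<Rightarrow> complex) \<Rightarrow> complex" and k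
  proof -
    define s where "s = real (\<Sum>i\<in>UNIV. k $ i)"
    define X where "X = Lp_qnorm p (fourier_mult (\<lambda>x. complex_of_real (mixed_piece \<phi>0 k x)) f)"
    define Y where "Y = Lp_qnorm p0 (fourier_mult (\<lambda>x. complex_of_real (mixed_piece \<phi>0 k x)) f)"
    have N: "ennreal (2 powr ((s + D) / enn2real p)) * X \<le> ennreal C * (ennreal (2 powr ((s + D) / enn2real p0)) * Y)"
      unfolding s_def D_def X_def Y_def using f by (intro C) (simp add: mixed_space_def)
    have "ennreal (2 powr (s * t)) * X =
        ennreal (2 powr (s * t - (s + D) / enn2real p)) * (ennreal (2 powr ((s + D) / enn2real p)) * X)"
      by (simp add: mult.assoc[symmetric] ennreal_mult[symmetric] powr_add[symmetric])
    also have "\<dots> \<le> ennreal (2 powr (s * t - (s + D) / enn2real p)) *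
        (ennreal \<bar>C\<bar> * (ennreal (2 powr ((s + D) / enn2real p0)) * Y))"
      by (intro mult_left_mono order_trans[OF N] mult_right_mono ennreal_leI) auto
    also have "\<dots> = ennreal (2 powr (s * t - (s + D) / enn2real p) * \<bar>C\<bar> * 2 powr ((s + D) / enn2real p0)) * Y"
      by (simp add: mult.assoc[symmetric] ennreal_mult[symmetric])
    also have "2 powr (s * t - (s + D) / enn2real p) * \<bar>C\<bar> * 2 powr ((s + D) / enn2real p0) =
        K * 2 powr (- \<delta> * s) * 2 powr (s * t0)"
    proof -
      have "2 powr (s * t - (s + D) / enn2real p) * 2 powr ((s + D) / enn2real p0) =
          2 powr (D / enn2real p0 - D / enn2real p) * 2 powr (- \<delta> * s) * 2 powr (s * t0)"
        unfolding powr_add[symmetric]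
        by (rule arg_cong[where f = "\<lambda>z. 2 powr z"])
          (simp add: \<delta>_def algebra_simps add_divide_distrib)
      then show ?thesis by (simp add: K_def mult_ac)
    qed
    finally show ?thesis
      using K0 unfolding w_def X_def Y_def s_def
      by (simp add: ennreal_mult mult.assoc)
  qed
  have w1: "w k \<le> 1" for k
  proof -
    have "0 \<le> \<delta> * real (\<Sum>i\<in>UNIV. k $ i)"
      by (intro mult_nonneg_nonneg \<delta>0 of_nat_0_le_iff)
    then have "2 powr (- \<delta> * real (\<Sum>i\<in>UNIV. k $ i)) \<le> 2 powr 0"
      by (intro powr_mono) auto
    then show ?thesis by (simp add: w_def ennreal_le_1)
  qed
  have "\<exists>C'. \<forall>f::(real^'d \<Rightarrow> complex) \<Rightarrow> complex\<in>mixed_space \<phi>0 t0 p0 q0. mixed_qnorm \<phi>0 t p q f \<le> ennreal C' * mixed_qnorm \<phi>0 t0 p0 q0 f"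
  proof (cases "q0 \<le> q")
    case True
    have "mixed_qnorm \<phi>0 t p q f \<le> ennreal K * mixed_qnorm \<phi>0 t0 p0 q0 f"
      if f: "f \<in> mixed_space \<phi>0 t0 p0 q0" for f :: "(real^'d \<Rightarrow> complex) \<Rightarrow> complex"
    proof -
      have "mixed_qnorm \<phi>0 t p q f \<le> lq_qnorm q (\<lambda>k::nat^'d. ennreal K *
          (ennreal (2 powr (real (\<Sum>i\<in>UNIV. k $ i) * t0)) *
          Lp_qnorm p0 (fourier_mult (\<lambda>x. complex_of_real (mixed_piece \<phi>0 k x)) f)))"
        unfolding mixed_qnorm_def
      proof (intro lq_qnorm_mono[OF pos(2)] order_trans[OF piece[OF f]] mult_right_mono)
        show "ennreal K * w k \<le> ennreal K" for k
          using mult_left_mono[OF w1[of k], of "ennreal K"] by simp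
      qed simp
      also have "\<dots> \<le> ennreal K * mixed_qnorm \<phi>0 t0 p0 q0 f"
        unfolding mixed_qnorm_def lq_qnorm_cmult[OF pos(2)]
        by (intro mult_left_mono lq_qnorm_antimono_exponent pos True) auto
      finally show ?thesis .
    qed
    then show ?thesis by blast
  next
    case False
    then have qq: "q < q0" by simp
    then have qf: "q \<noteq> \<infinity>" by auto
    define W where "W = enn2real (lq_qnorm q w)"
    have W: "lq_qnorm q w = ennreal W"
      using geometric_lq_qnorm_finite[OF pos(2) qf \<delta>pos[OF qq], where 'd = 'd]
      by (simp add: W_def w_def[abs_def])
    have "mixed_qnorm \<phi>0 t p q f \<le> ennreal (K * W) * mixed_qnorm \<phi>0 t0 p0 q0 f"
      if f: "f \<in> mixed_space \<phi>0 t0 p0 q0" for f :: "(real^'d \<Rightarrow> complex) \<Rightarrow> complex"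
    proof -
      have "mixed_qnorm \<phi>0 t p q f \<le> lq_qnorm q (\<lambda>k::nat^'d. (ennreal K * mixed_qnorm \<phi>0 t0 p0 q0 f) * w k)"
        unfolding mixed_qnorm_def[of \<phi>0 t]
      proof (intro lq_qnorm_mono[OF pos(2)] order_trans[OF piece[OF f]])
        fix k :: "nat^'d"
        have "ennreal (2 powr (real (\<Sum>i\<in>UNIV. k $ i) * t0)) *
            Lp_qnorm p0 (fourier_mult (\<lambda>x. complex_of_real (mixed_piece \<phi>0 k x)) f) \<le> mixed_qnorm \<phi>0 t0 p0 q0 f"
          unfolding mixed_qnorm_def by (rule lq_qnorm_upper[OF pos(4)])
        from mult_left_mono[OF this, of "ennreal K * w k"]
        show "ennreal K * w k * (ennreal (2 powr (real (\<Sum>i\<in>UNIV. k $ i) * t0)) *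
            Lp_qnorm p0 (fourier_mult (\<lambda>x. complex_of_real (mixed_piece \<phi>0 k x)) f)) \<le>
            ennreal K * mixed_qnorm \<phi>0 t0 p0 q0 f * w k"
          by (simp add: mult_ac)
      qed
      also have "\<dots> = ennreal (K * W) * mixed_qnorm \<phi>0 t0 p0 q0 f"
        unfolding lq_qnorm_cmult[OF pos(2)] W using K0 by (simp add: W_def ennreal_mult mult_ac)
      finally show ?thesis .
    qed
    then show ?thesis by blast
  qed
  then obtain C' where C': "\<And>f::(real^'d \<Rightarrow> complex) \<Rightarrow> complex. f \<in> mixed_space \<phi>0 t0 p0 q0 \<Longrightarrow>
      mixed_qnorm \<phi>0 t p q f \<le> ennreal C' * mixed_qnorm \<phi>0 t0 p0 q0 f" by blast
  have "f \<in> mixed_space \<phi>0 t p q" if f: "f \<in> mixed_space \<phi>0 t0 p0 q0" for f :: "(real^'d \<Rightarrow> complex) \<Rightarrow> complex"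
    using f le_less_trans[OF C'[OF f]] by (simp add: mixed_space_def ennreal_mult_less_top)
  with C' show ?thesis unfolding cont_embed_def by blast
qed

section \<open>Necessary conditions\<close>

lemma enn_inverse_less:
  assumes "0 < q" "q < q0"
  shows "1 / enn2real q0 < 1 / enn2real q"
proof (cases "q0 = \<infinity>")
  case True
  then show ?thesis using assms by (simp add: enn2real_positive_iff)
next
  case False
  have "q \<noteq> top" using assms by auto
  then have "0 < enn2real q" using assms by (intro enn2real_pos)
  moreover have "enn2real q < enn2real q0"
    using assms False \<open>q \<noteq> top\<close> by (cases q; cases q0) (auto simp: ennreal_less_iff)
  ultimately show ?thesis by (simp add: field_simps)
qed

lemma powr_unbounded:
  fixes A B r :: real
  assumes "0 < A" "0 < r"
  shows "\<exists>n::nat. 1 \<le> n \<and> B < A * real n powr r"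
proof -
  obtain n :: nat where n: "(\<bar>B\<bar> / A + 1) powr (1 / r) \<le> real n" using real_arch_simple by blast
  have "(\<bar>B\<bar> / A + 1) = ((\<bar>B\<bar> / A + 1) powr (1 / r)) powr r"
    using assms by (simp add: powr_powr add_nonneg_nonneg)
  also have "\<dots> \<le> real n powr r"
    using n assms by (intro powr_mono2) auto
  finally have le: "\<bar>B\<bar> / A + 1 \<le> real n powr r" .
  have "A * (\<bar>B\<bar> / A + 1) = \<bar>B\<bar> + A" using assms by (simp add: field_simps)
  then have "B < A * (\<bar>B\<bar> / A + 1)" using assms by linarith
  also have "\<dots> \<le> A * real n powr r" using le assms by (intro mult_left_mono) auto
  finally have "B < A * real n powr r" .
  moreover have "n \<noteq> 0"
  proof
    assume "n = 0"
    moreover have "0 \<le> \<bar>B\<bar> / A" using assms by simp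
    ultimately show False using le by simp
  qed
  ultimately show ?thesis by (intro exI[of _ n]) auto
qed

lemma embedding_low_frequency:
  fixes \<psi>0 :: "real^'d::finite \<Rightarrow> real" and h :: "real^'d \<Rightarrow> complex"
  assumes \<psi>: "iso_admissible \<psi>0" and \<phi>: "mixed_admissible \<phi>0"
    and pos: "0 < p" "0 < q" "0 < p0" "0 < q0"
    and C: "\<And>g. g \<in> mixed_space \<phi>0 t0 p0 q0 \<Longrightarrow>
      besov_qnorm \<psi>0 t p q g \<le> ennreal C * mixed_qnorm \<phi>0 t0 p0 q0 g"
    and h: "rapid_multiplier h" and supp: "\<And>\<xi> i. h \<xi> \<noteq> 0 \<Longrightarrow> \<bar>\<xi> $ i\<bar> \<le> 1"
    and fin: "Lp_qnorm p0 (inv_fourier h) < top"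
  shows "Lp_qnorm p (inv_fourier h) \<le> ennreal C * Lp_qnorm p0 (inv_fourier h)"
proof -
  define G where "G = (\<lambda>\<eta>. (\<lambda>\<eta>::real^'d \<Rightarrow> complex. \<eta> 0) (conv_op 1 (inv_fourier h) \<eta>))"
  have l1: "(1::real^'d) $ i \<ge> 1" for i by simp
  have shape: "(\<lambda>x. (\<lambda>\<eta>::real^'d \<Rightarrow> complex. \<eta> 0) (\<lambda>y. inv_fourier h (x - 1 * y))) = inv_fourier h"
    by (simp add: one_vec_times)
  note T = tempered_delta[where 'd = 'd]
  have mixed: "fourier_mult (\<lambda>x. complex_of_real (mixed_piece \<phi>0 k x)) G = (if k = 0 then inv_fourier h else (\<lambda>_. 0))" for k
    using fourier_mult_conv_op_one[OF T h l1 mixed_piece_integrable[OF \<phi>], of k]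
      fourier_mult_conv_op_zero[OF T h l1 mixed_piece_integrable[OF \<phi>], of k]
      mixed_piece_low[OF \<phi> supp, of _ k]
    by (auto simp: G_def shape[simplified])
  have iso: "fourier_mult (\<lambda>x. complex_of_real (iso_piece \<psi>0 j x)) G = (if j = 0 then inv_fourier h else (\<lambda>_. 0))" for j
    using fourier_mult_conv_op_one[OF T h l1 iso_piece_integrable[OF \<psi>], of j]
      fourier_mult_conv_op_zero[OF T h l1 iso_piece_integrable[OF \<psi>], of j]
      iso_piece_low[OF \<psi> supp, of _ j]
    by (auto simp: G_def shape[simplified])
  have "(\<lambda>k::nat^'d. ennreal (2 powr (real (\<Sum>i\<in>UNIV. k $ i) * t0)) *
      Lp_qnorm p0 (fourier_mult (\<lambda>x. complex_of_real (mixed_piece \<phi>0 k x)) G)) =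
      (\<lambda>k. if k = 0 then Lp_qnorm p0 (inv_fourier h) else 0)"
    using Lp_qnorm_zero[OF pos(3)] by (auto simp: fun_eq_iff mixed)
  then have mG: "mixed_qnorm \<phi>0 t0 p0 q0 G = Lp_qnorm p0 (inv_fourier h)"
    using lq_qnorm_single[OF pos(4)] by (simp add: mixed_qnorm_def)
  have "(\<lambda>j. ennreal (2 powr (real j * t)) * Lp_qnorm p (fourier_mult (\<lambda>x. complex_of_real (iso_piece \<psi>0 j x)) G)) =
      (\<lambda>j. if j = 0 then Lp_qnorm p (inv_fourier h) else 0)"
    using Lp_qnorm_zero[OF pos(1)] by (auto simp: fun_eq_iff iso)
  then have bG: "besov_qnorm \<psi>0 t p q G = Lp_qnorm p (inv_fourier h)"
    using lq_qnorm_single[OF pos(2)] by (simp add: besov_qnorm_def)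
  have "G \<in> mixed_space \<phi>0 t0 p0 q0"
    unfolding mixed_space_def using mG fin tempered_rapid_conv_op[OF T h l1] by (simp add: G_def)
  from C[OF this] show ?thesis
    by (simp add: mG bG)
qed

lemma embedding_integrability:
  fixes \<psi>0 :: "real^'d::finite \<Rightarrow> real"
  assumes \<psi>: "iso_admissible \<psi>0" and \<phi>: "mixed_admissible \<phi>0"
    and pos: "0 < p" "0 < q" "0 < p0" "0 < q0"
    and C: "\<And>g. g \<in> mixed_space \<phi>0 t0 p0 q0 \<Longrightarrow>
      besov_qnorm \<psi>0 t p q g \<le> ennreal C * mixed_qnorm \<phi>0 t0 p0 q0 g"
  shows "p0 \<le> p"
proof (rule ccontr)
  assume "\<not> p0 \<le> p"
  then have "1 / enn2real p0 < 1 / enn2real p" using pos by (intro enn_inverse_less) auto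
  then have rr: "0 < 1 / enn2real p - 1 / enn2real p0" by simp
  define \<Phi> where "\<Phi> \<xi> = complex_of_real (mixed_piece \<phi>0 0 \<xi>)" for \<xi> :: "real^'d"
  have b1: "bump (3 / 2) (\<lambda>s. \<phi>0 s)" by (rule bump_mixed_admissible[OF \<phi>])
  have \<Phi>: "rapid_multiplier \<Phi>"
    using rapid_multiplier_mixed_piece[OF \<phi>, of "1::real^'d" 0] by (simp add: \<Phi>_def[abs_def] one_vec_times)
  have "\<Phi> 0 \<noteq> 0" using mixed_piece_low[OF \<phi>, where \<xi> = "0 :: real^'d" and k = 0] by (simp add: \<Phi>_def)
  note \<Phi>_pos = Lp_qnorm_inv_fourier_pos[OF _ \<Phi> this]
  have \<Phi>_fin: "Lp_qnorm p' (inv_fourier \<Phi>) < top" if "0 < p'" for p'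
    using Lp_qnorm_inv_fourier_tensor_finite[OF that, of "3 / 2" "\<lambda>_::'d. \<phi>0", OF b1]
    by (simp add: \<Phi>_def[abs_def] mixed_piece_def mixed_piece1_def)
  define N where "N p' = enn2real (Lp_qnorm p' (inv_fourier \<Phi>))" for p'
  have N: "Lp_qnorm p' (inv_fourier \<Phi>) = ennreal (N p')" "N p' > 0" if "0 < p'" for p'
    using \<Phi>_pos[OF that] \<Phi>_fin[OF that] by (auto simp: N_def enn2real_positive_iff)
  have Np: "0 < N p" and Np0: "0 < N p0" using N(2) pos by auto
  obtain n where n: "1 \<le> n" "(\<bar>C\<bar> + 1) * N p0 < N p * real n powr (1 / enn2real p - 1 / enn2real p0)"
    using powr_unbounded[OF Np rr] by blast
  define l :: "real^'d" where "l = (\<chi> i. 2 ^ Suc n)"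
  define m :: "real^'d" where "m = (\<chi> i. 1 / 2 ^ Suc n)"
  have l0: "l $ i > 0" and m0: "m $ i > 0" and lm: "l $ i * m $ i = 1" for i
    by (simp_all add: l_def m_def del: power_Suc)
  define X where "X = (\<Prod>i\<in>UNIV. l $ i)"
  have X: "real n \<le> X"
  proof -
    have "real n \<le> 2 ^ n" using of_nat_less_two_power[of n] by simp
    also have "\<dots> \<le> 2 ^ (Suc n * CARD('d))"
      using mult_le_mono[of 1 "CARD('d)" n "Suc n"] by (intro power_increasing) (auto simp: Suc_le_eq mult.commute)
    also have "\<dots> = X"
    proof -
      have "X = (\<Prod>i\<in>(UNIV :: 'd set). 2 ^ Suc n)"
        unfolding X_def by (intro prod.cong) (simp_all add: l_def)
      then show ?thesis by (simp only: prod_constant power_mult)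
    qed
    finally show ?thesis .
  qed
  define h where "h \<xi> = complex_of_real X * \<Phi> (l * \<xi>)" for \<xi>
  have h: "rapid_multiplier h"
    unfolding h_def \<Phi>_def by (intro rapid_multiplier_cmult rapid_multiplier_mixed_piece \<phi> l0)
  have supp: "\<bar>\<xi> $ i\<bar> \<le> 1" if "h \<xi> \<noteq> 0" for \<xi> i
  proof -
    have "mixed_piece1 \<phi>0 0 (l $ i * \<xi> $ i) \<noteq> 0"
      using that by (auto simp: h_def \<Phi>_def mixed_piece_def)
    from mixed_piece1_support[OF \<phi> this] have "2 ^ Suc n * \<bar>\<xi> $ i\<bar> \<le> 3 / 2"
      by (simp add: l_def abs_mult)
    moreover have "2 * \<bar>\<xi> $ i\<bar> \<le> 2 ^ Suc n * \<bar>\<xi> $ i\<bar>"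
      using power_increasing[of 1 "Suc n" "2::real"] by (intro mult_right_mono) auto
    ultimately show ?thesis by linarith
  qed
  have ih: "inv_fourier h = (\<lambda>x. inv_fourier \<Phi> (m * x))"
    unfolding h_def[abs_def] X_def using rapid_multiplier_integrable(1)[OF \<Phi>]
    by (intro ext inv_fourier_dilation l0 lm) (auto dest: borel_measurable_integrable)
  have Lp: "Lp_qnorm p' (inv_fourier h) = ennreal (X powr (1 / enn2real p') * N p')" if "0 < p'" for p'
    unfolding ih using Lp_qnorm_dilation[OF m0 l0 lm, of p' "inv_fourier \<Phi>"] N[OF that]
    by (simp add: X_def ennreal_mult)
  have "Lp_qnorm p (inv_fourier h) \<le> ennreal C * Lp_qnorm p0 (inv_fourier h)"
    by (rule embedding_low_frequency[OF \<psi> \<phi> pos C h supp]) (auto simp: Lp[OF pos(3)])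
  also have "\<dots> \<le> ennreal (\<bar>C\<bar> + 1) * Lp_qnorm p0 (inv_fourier h)"
    by (intro mult_right_mono ennreal_leI) auto
  also have "\<dots> = ennreal ((\<bar>C\<bar> + 1) * (X powr (1 / enn2real p0) * N p0))"
    unfolding Lp[OF pos(3)] using Np0 by (intro ennreal_mult[symmetric]) auto
  finally have "X powr (1 / enn2real p) * N p \<le> (\<bar>C\<bar> + 1) * (X powr (1 / enn2real p0) * N p0)"
    unfolding Lp[OF pos(1)] using Np0 by (subst (asm) ennreal_le_iff) auto
  moreover have X0: "0 < X" using X n(1) by linarith
  then have "X powr (1 / enn2real p) = X powr (1 / enn2real p - 1 / enn2real p0) * X powr (1 / enn2real p0)"
    by (simp add: powr_add[symmetric])
  ultimately have "X powr (1 / enn2real p0) * (N p * X powr (1 / enn2real p - 1 / enn2real p0)) \<le>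
      X powr (1 / enn2real p0) * ((\<bar>C\<bar> + 1) * N p0)"
    by (simp add: mult_ac)
  then have "N p * X powr (1 / enn2real p - 1 / enn2real p0) \<le> (\<bar>C\<bar> + 1) * N p0"
    using X0 by (simp add: mult_le_cancel_left)
  moreover have "N p * real n powr (1 / enn2real p - 1 / enn2real p0) \<le> N p * X powr (1 / enn2real p - 1 / enn2real p0)"
    using X rr Np by (intro mult_left_mono powr_mono2) auto
  ultimately show False using n(2) by linarith
qed

text \<open>The coefficients \<open>a j\<close> make all nonzero summands of the source norm equal.\<close>

lemma embedding_test:
  fixes \<psi>0 :: "real^'d::finite \<Rightarrow> real"
  assumes \<psi>: "iso_admissible \<psi>0" and \<phi>: "mixed_admissible \<phi>0"
    and pos: "0 < p" "0 < q" "0 < p0" "0 < q0"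
    and C: "\<And>g. g \<in> mixed_space \<phi>0 t0 p0 q0 \<Longrightarrow>
      besov_qnorm \<psi>0 t p q g \<le> ennreal C * mixed_qnorm \<phi>0 t0 p0 q0 g"
  defines "\<delta> \<equiv> (t0 - 1 / enn2real p0) - (t - 1 / enn2real p)"
  obtains A B where "0 < A" "0 < B"
    "\<And>J. finite J \<Longrightarrow> J \<noteq> {} \<Longrightarrow> (\<forall>j\<in>J. 1 \<le> j) \<Longrightarrow>
      ennreal A * lq_qnorm q (\<lambda>n. if n \<in> J then ennreal (2 powr (- \<delta> * real n)) else 0) \<le>
      ennreal (B * real (card J) powr (1 / enn2real q0))"
proof -
  obtain i1 :: 'd where True by blast
  define b where "b i s = \<phi>0 ((if i = i1 then 16 else 2) * s + (if i = i1 then -14 else 0))" for i s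
  define r where "r i = (3 / 2 + \<bar>if i = i1 then -14 else 0\<bar>) / (if i = i1 then 16 else 2 :: real)" for i
  have "bump (r i) (b i)" for i
    unfolding b_def r_def by (rule bump_affine[OF bump_mixed_admissible[OF \<phi>]]) auto
  then obtain R where bR: "\<And>i. bump R (b i)"
    using bump_uniform_radius[of r b] by blast
  have b_supp: "25 / 32 \<le> s \<and> s \<le> 31 / 32" if "b i1 s \<noteq> 0" for s
  proof -
    have "\<bar>16 * s - 14\<bar> \<le> 3 / 2"
      using that \<phi> unfolding b_def mixed_admissible_def by (auto simp: not_less[symmetric])
    then show ?thesis by (intro conjI) linarith+
  qed
  have b_supp': "\<bar>s\<bar> \<le> 1" if "b i s \<noteq> 0" "i \<noteq> i1" for i s
  proof -
    have "\<bar>2 * s\<bar> \<le> 3 / 2"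
      using that \<phi> unfolding b_def mixed_admissible_def by (auto simp: not_less[symmetric])
    then show ?thesis by linarith
  qed
  define hs where "hs \<xi> = complex_of_real (\<Prod>i\<in>UNIV. b i (\<xi> $ i))" for \<xi> :: "real^'d"
  have hs: "rapid_multiplier hs"
    unfolding hs_def[abs_def] by (rule rapid_multiplier_tensor[OF bR])
  have "hs (\<chi> i. if i = i1 then 7 / 8 else 0) \<noteq> 0"
    using \<phi> by (auto simp: hs_def b_def mixed_admissible_def)
  note hs_pos = Lp_qnorm_inv_fourier_pos[OF _ hs this]
  have hs_fin: "Lp_qnorm p' (inv_fourier hs) < top" if "0 < p'" for p'
    unfolding hs_def[abs_def] by (rule Lp_qnorm_inv_fourier_tensor_finite[OF that bR])
  define N where "N p' = enn2real (Lp_qnorm p' (inv_fourier hs))" for p'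
  have N: "Lp_qnorm p' (inv_fourier hs) = ennreal (N p')" "N p' > 0" if "0 < p'" for p'
    using hs_pos[OF that] hs_fin[OF that] by (auto simp: N_def enn2real_positive_iff)
  define l :: "nat \<Rightarrow> real^'d" where "l j = (\<chi> i. if i = i1 then 1 / 2 ^ j else 1)" for j
  define m :: "nat \<Rightarrow> real^'d" where "m j = (\<chi> i. if i = i1 then 2 ^ j else 1)" for j
  have l0: "l j $ i > 0" and m0: "m j $ i > 0" and lm: "l j $ i * m j $ i = 1" for i j
    by (simp_all add: l_def m_def)
  have Pl: "(\<Prod>i\<in>UNIV. l j $ i) = 2 powr (- real j)" for j
    by (simp add: l_def prod.If_cases powr_minus powr_realpow divide_inverse)
  define hj where "hj j \<xi> = complex_of_real (\<Prod>i\<in>UNIV. l j $ i) * hs (l j * \<xi>)" for j \<xi>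
  have hj: "rapid_multiplier (hj j)" for j
  proof -
    have "bump ((R + \<bar>0\<bar>) / l j $ i) (\<lambda>s. b i (l j $ i * s + 0))" for i
      by (rule bump_affine[OF bR l0])
    from rapid_multiplier_tensor[OF bump_uniform_radius, OF this]
    show ?thesis unfolding hj_def[abs_def] hs_def by (intro rapid_multiplier_cmult) simp
  qed
  have [measurable]: "hs \<in> borel_measurable borel" "inv_fourier hs \<in> borel_measurable borel"
    using rapid_multiplier_integrable[OF hs] by (auto dest: borel_measurable_integrable)
  have ihj: "inv_fourier (hj j) x = inv_fourier hs (m j * x)" for j x
    unfolding hj_def by (intro inv_fourier_dilation l0 lm) measurable
  have hj_supp: "25 / 32 * 2 ^ j \<le> \<xi> $ i1" "\<xi> $ i1 \<le> 31 / 32 * 2 ^ j" "i \<noteq> i1 \<Longrightarrow> \<bar>\<xi> $ i\<bar> \<le> 1"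
    if "hj j \<xi> \<noteq> 0" for j \<xi> i
  proof -
    have nz: "b i (l j $ i * \<xi> $ i) \<noteq> 0" for i
      using that by (auto simp: hj_def hs_def)
    show "25 / 32 * 2 ^ j \<le> \<xi> $ i1" "\<xi> $ i1 \<le> 31 / 32 * 2 ^ j"
      using b_supp[OF nz[of i1]] by (auto simp: l_def field_simps)
    show "\<bar>\<xi> $ i\<bar> \<le> 1" if "i \<noteq> i1"
      using b_supp'[OF nz[of i] that] that by (simp add: l_def)
  qed
  define a where "a j = 2 powr (- (real j * (t0 - 1 / enn2real p0)))" for j :: nat
  have a0: "a j > 0" for j by (simp add: a_def)
  have Lp_piece: "ennreal (2 powr (real j * \<tau>)) * Lp_qnorm p' (\<lambda>x. complex_of_real (a j) * inv_fourier (hj j) x) =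
      ennreal (2 powr (real j * ((\<tau> - 1 / enn2real p') - (t0 - 1 / enn2real p0))) * N p')"
    if "0 < p'" for j \<tau> p'
  proof -
    have [measurable]: "inv_fourier (hj j) \<in> borel_measurable borel"
      using rapid_multiplier_integrable(2)[OF hj] by (auto dest: borel_measurable_integrable)
    have "Lp_qnorm p' (\<lambda>x. complex_of_real (a j) * inv_fourier (hj j) x) =
        ennreal (a j) * Lp_qnorm p' (inv_fourier (hj j))"
      using a0[of j] by (subst Lp_qnorm_cmult[OF that]) auto
    also have "Lp_qnorm p' (inv_fourier (hj j)) = ennreal ((2 powr (- real j)) powr (1 / enn2real p')) * ennreal (N p')"
      unfolding ihj[abs_def] using Lp_qnorm_dilation[OF m0 l0 lm, of p' "inv_fourier hs" j] N(1)[OF that]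
      by (simp add: Pl)
    finally show ?thesis
      using N(2)[OF that] by (simp add: a_def ennreal_mult[symmetric] powr_powr powr_add[symmetric] mult.assoc[symmetric] algebra_simps)
  qed
  have main: "lq_qnorm q (\<lambda>n. if n \<in> J then ennreal (2 powr (- \<delta> * real n) * N p) else 0) \<le>
      ennreal C * (ennreal (N p0) * ennreal (real (card J) powr (1 / enn2real q0)))"
    if J: "finite J" "J \<noteq> {}" "\<forall>j\<in>J. 1 \<le> j" for J
  proof -
    define h where "h \<xi> = (\<Sum>j\<in>J. complex_of_real (a j) * hj j \<xi>)" for \<xi>
    have h: "rapid_multiplier h"
      unfolding h_def[abs_def] by (intro rapid_multiplier_linear_comb J hj)
    define G where "G = (\<lambda>\<eta>. (\<lambda>\<eta>::real^'d \<Rightarrow> complex. \<eta> 0) (conv_op 1 (inv_fourier h) \<eta>))"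
    have piece: "fourier_mult M G = (\<lambda>x. if n \<in> J then complex_of_real (a n) * inv_fourier (hj n) x else 0)"
      if M: "integrable lborel M" and Mh: "\<And>j \<xi>. 1 \<le> j \<Longrightarrow> hj j \<xi> \<noteq> 0 \<Longrightarrow> M \<xi> = (if j = n then 1 else 0)"
      for M n
    proof
      fix x
      have "(\<lambda>\<xi>. M \<xi> * h \<xi>) = (\<lambda>\<xi>. \<Sum>j\<in>J. (if j = n then complex_of_real (a j) else 0) * hj j \<xi>)"
      proof
        fix \<xi>
        have "M \<xi> * hj j \<xi> = (if j = n then hj j \<xi> else 0)" if "j \<in> J" for j
          using Mh[of j \<xi>] J(3) that by (cases "hj j \<xi> = 0") auto
        then show "M \<xi> * h \<xi> = (\<Sum>j\<in>J. (if j = n then complex_of_real (a j) else 0) * hj j \<xi>)"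
          unfolding h_def sum_distrib_left
          by (intro sum.cong refl) (simp only: mult.left_commute[of "M \<xi>"], simp)
      qed
      with fourier_mult_conv_op[OF h M, of "\<lambda>\<eta>. \<eta> 0" 1 x]
      have "fourier_mult M G x =
          inv_fourier (\<lambda>\<xi>. \<Sum>j\<in>J. (if j = n then complex_of_real (a j) else 0) * hj j \<xi>) (x - 1 * 0)"
        unfolding G_def by simp
      also have "\<dots> = (\<Sum>j\<in>J. (if j = n then complex_of_real (a j) else 0) * inv_fourier (hj j) x)"
        using inv_fourier_linear_comb[OF J(1) rapid_multiplier_integrable(1)[OF hj]] by (simp add: one_vec_times)
      also have "\<dots> = (\<Sum>j\<in>J. if j = n then complex_of_real (a j) * inv_fourier (hj j) x else 0)"
        by (intro sum.cong) auto
      finally show "fourier_mult M G x = (if n \<in> J then complex_of_real (a n) * inv_fourier (hj n) x else 0)"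
        using J(1) by simp
    qed
    have tG: "tempered G"
      unfolding G_def by (rule tempered_rapid_conv_op[OF tempered_delta h]) simp
    have iso: "fourier_mult (\<lambda>x. complex_of_real (iso_piece \<psi>0 n x)) G =
        (\<lambda>x. if n \<in> J then complex_of_real (a n) * inv_fourier (hj n) x else 0)" for n
    proof (rule piece[OF iso_piece_integrable[OF \<psi>]])
      show "complex_of_real (iso_piece \<psi>0 n \<xi>) = (if j = n then 1 else 0)" if "1 \<le> j" "hj j \<xi> \<noteq> 0" for j \<xi>
        using iso_piece_window[OF \<psi> that(1) hj_supp[OF that(2)]] by simp
    qed
    have "(\<lambda>n. ennreal (2 powr (real n * t)) * Lp_qnorm p (fourier_mult (\<lambda>x. complex_of_real (iso_piece \<psi>0 n x)) G)) =
        (\<lambda>n. if n \<in> J then ennreal (2 powr (- \<delta> * real n) * N p) else 0)"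
      using Lp_piece[OF pos(1)] Lp_qnorm_zero[OF pos(1)]
      by (auto simp: iso fun_eq_iff \<delta>_def algebra_simps)
    then have bG: "besov_qnorm \<psi>0 t p q G = lq_qnorm q (\<lambda>n. if n \<in> J then ennreal (2 powr (- \<delta> * real n) * N p) else 0)"
      by (simp add: besov_qnorm_def)
    have mixed: "ennreal (2 powr (real (\<Sum>i\<in>UNIV. k $ i) * t0)) *
        Lp_qnorm p0 (fourier_mult (\<lambda>x. complex_of_real (mixed_piece \<phi>0 k x)) G) =
        (if k \<in> coord_index i1 ` J then ennreal (N p0) else 0)" for k
    proof (cases "k \<in> range (coord_index i1)")
      case True
      then obtain n where n: "k = coord_index i1 n" by blast
      have "fourier_mult (\<lambda>x. complex_of_real (mixed_piece \<phi>0 k x)) G =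
          (\<lambda>x. if n \<in> J then complex_of_real (a n) * inv_fourier (hj n) x else 0)"
      proof (rule piece[OF mixed_piece_integrable[OF \<phi>]])
        show "complex_of_real (mixed_piece \<phi>0 k \<xi>) = (if j = n then 1 else 0)" if "1 \<le> j" "hj j \<xi> \<noteq> 0" for j \<xi>
          using mixed_piece_window[OF \<phi> that(1) hj_supp[OF that(2)], of k] by (auto simp: n coord_index_inj)
      qed
      moreover have "k \<in> coord_index i1 ` J \<longleftrightarrow> n \<in> J"
        by (auto simp: n coord_index_inj)
      ultimately show ?thesis
        using Lp_piece[OF pos(3), of n t0] Lp_qnorm_zero[OF pos(3)] coord_index_sum[of i1 n]
        by (cases "n \<in> J") (simp_all add: n)
    next
      case False
      have "fourier_mult (\<lambda>x. complex_of_real (mixed_piece \<phi>0 k x)) G = (\<lambda>_. 0)"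
        unfolding G_def
      proof (rule fourier_mult_conv_op_zero[OF tempered_delta h _ mixed_piece_integrable[OF \<phi>]])
        fix \<xi> assume "h \<xi> \<noteq> 0"
        then obtain j where j: "j \<in> J" "hj j \<xi> \<noteq> 0"
          unfolding h_def by (metis (no_types, lifting) mult_zero_right sum.neutral)
        then have "1 \<le> j" using J(3) by blast
        from mixed_piece_window[OF \<phi> this hj_supp[OF j(2)], of k] False
        show "complex_of_real (mixed_piece \<phi>0 k \<xi>) = 0" by auto
      qed simp
      with False show ?thesis
        using Lp_qnorm_zero[OF pos(3)] by auto
    qed
    have mG: "mixed_qnorm \<phi>0 t0 p0 q0 G = ennreal (N p0) * ennreal (real (card J) powr (1 / enn2real q0))"
      unfolding mixed_qnorm_def mixed
      using J by (subst lq_qnorm_indicator[OF pos(4)])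
        (auto simp: card_image inj_on_def coord_index_inj)
    have "G \<in> mixed_space \<phi>0 t0 p0 q0"
      unfolding mixed_space_def using tG mG by (simp add: ennreal_mult_less_top)
    from C[OF this] show ?thesis by (simp add: bG mG)
  qed
  show ?thesis
  proof (rule that[of "N p" "(\<bar>C\<bar> + 1) * N p0"])
    show "0 < N p" "0 < (\<bar>C\<bar> + 1) * N p0" using N(2)[OF pos(1)] N(2)[OF pos(3)] by auto
    fix J :: "nat set" assume J: "finite J" "J \<noteq> {}" "\<forall>j\<in>J. 1 \<le> j"
    have "ennreal (N p) * lq_qnorm q (\<lambda>n. if n \<in> J then ennreal (2 powr (- \<delta> * real n)) else 0) =
        lq_qnorm q (\<lambda>n. if n \<in> J then ennreal (2 powr (- \<delta> * real n) * N p) else 0)"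
      unfolding lq_qnorm_cmult[OF pos(2), symmetric] using N(2)[OF pos(1)]
      by (intro arg_cong[where f = "lq_qnorm q"]) (auto simp: fun_eq_iff ennreal_mult mult.commute)
    also have "\<dots> \<le> ennreal C * (ennreal (N p0) * ennreal (real (card J) powr (1 / enn2real q0)))"
      by (rule main[OF J])
    also have "\<dots> \<le> ennreal (\<bar>C\<bar> + 1) * (ennreal (N p0) * ennreal (real (card J) powr (1 / enn2real q0)))"
      by (intro mult_right_mono ennreal_leI) auto
    also have "\<dots> = ennreal ((\<bar>C\<bar> + 1) * N p0 * real (card J) powr (1 / enn2real q0))"
      using N(2)[OF pos(3)] by (simp add: ennreal_mult mult.assoc)
    finally show "ennreal (N p) * lq_qnorm q (\<lambda>n. if n \<in> J then ennreal (2 powr (- \<delta> * real n)) else 0) \<le>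
        ennreal ((\<bar>C\<bar> + 1) * N p0 * real (card J) powr (1 / enn2real q0))" .
  qed
qed

lemma embedding_exponents:
  fixes \<psi>0 :: "real^'d::finite \<Rightarrow> real"
  assumes \<psi>: "iso_admissible \<psi>0" and \<phi>: "mixed_admissible \<phi>0"
    and pos: "0 < p" "0 < q" "0 < p0" "0 < q0"
    and C: "\<And>g. g \<in> mixed_space \<phi>0 t0 p0 q0 \<Longrightarrow>
      besov_qnorm \<psi>0 t p q g \<le> ennreal C * mixed_qnorm \<phi>0 t0 p0 q0 g"
  defines "\<delta> \<equiv> (t0 - 1 / enn2real p0) - (t - 1 / enn2real p)"
  shows "\<delta> \<ge> 0" and "q < q0 \<Longrightarrow> \<delta> > 0"
proof -
  obtain A B where AB: "0 < A" "0 < B"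
    "\<And>J. finite J \<Longrightarrow> J \<noteq> {} \<Longrightarrow> (\<forall>j\<in>J. 1 \<le> j) \<Longrightarrow>
      ennreal A * lq_qnorm q (\<lambda>n. if n \<in> J then ennreal (2 powr (- \<delta> * real n)) else 0) \<le>
      ennreal (B * real (card J) powr (1 / enn2real q0))"
    using embedding_test[OF \<psi> \<phi> pos C] unfolding \<delta>_def by blast
  show \<delta>0: "\<delta> \<ge> 0"
  proof (rule ccontr)
    assume "\<not> \<delta> \<ge> 0"
    then have d: "- \<delta> > 0" by simp
    have le: "A * 2 powr (- \<delta> * real n) \<le> B" if "1 \<le> n" for n
    proof -
      have "ennreal A * ennreal (2 powr (- \<delta> * real n)) \<le>
          ennreal A * lq_qnorm q (\<lambda>n'. if n' \<in> {n} then ennreal (2 powr (- \<delta> * real n')) else 0)"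
        using lq_qnorm_upper[OF pos(2), of "\<lambda>n'. if n' \<in> {n} then ennreal (2 powr (- \<delta> * real n')) else 0" n]
        by (intro mult_left_mono) auto
      also have "\<dots> \<le> ennreal (B * real (card {n}) powr (1 / enn2real q0))"
        by (rule AB(3)) (use that in auto)
      finally show ?thesis
        using AB(1,2) by (simp add: ennreal_mult[symmetric])
    qed
    obtain n where n: "1 \<le> n" "B < A * real n powr (- \<delta>)"
      using powr_unbounded[OF AB(1) d] by blast
    have "real n powr (- \<delta>) \<le> (2 powr real n) powr (- \<delta>)"
      using d n(1) less_exp[of n] by (intro powr_mono2) (auto simp: powr_realpow less_imp_le of_nat_less_two_power)
    then have "A * real n powr (- \<delta>) \<le> A * 2 powr (- \<delta> * real n)"
      using AB(1) by (intro mult_left_mono) (auto simp: powr_powr mult.commute)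
    with le[OF n(1)] n(2) show False by linarith
  qed
  show "\<delta> > 0" if qq: "q < q0"
  proof (rule ccontr)
    assume "\<not> \<delta> > 0"
    with \<delta>0 have d: "\<delta> = 0" by simp
    have rr: "0 < 1 / enn2real q - 1 / enn2real q0"
      using enn_inverse_less[OF pos(2) qq] by simp
    obtain n where n: "1 \<le> n" "B < A * real n powr (1 / enn2real q - 1 / enn2real q0)"
      using powr_unbounded[OF AB(1) rr] by blast
    have "ennreal (A * real n powr (1 / enn2real q)) =
        ennreal A * lq_qnorm q (\<lambda>n'. if n' \<in> {1..n} then ennreal (2 powr (- \<delta> * real n')) else 0)"
      using n(1) AB(1) lq_qnorm_indicator[OF pos(2), of "{1..n}" 1]
      by (simp add: d ennreal_mult cong: if_cong)
    also have "\<dots> \<le> ennreal (B * real (card {1..n}) powr (1 / enn2real q0))"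
      by (rule AB(3)) (use n(1) in auto)
    finally have "A * real n powr (1 / enn2real q) \<le> B * real n powr (1 / enn2real q0)"
      using AB(2) by (simp add: ennreal_le_iff)
    then have "A * real n powr (1 / enn2real q - 1 / enn2real q0) \<le> B"
      using n(1) by (simp add: powr_diff field_simps)
    with n(2) show False by linarith
  qed
qed

theorem theorem3p4:
  fixes \<psi>0 :: "real^'d::finite \<Rightarrow> real" and \<phi>0 :: "real \<Rightarrow> real"
    and p q p0 q0 :: ennreal and t t0 :: real
  assumes "iso_admissible \<psi>0" and "mixed_admissible \<phi>0"
    and "0 < p" and "0 < q" and "0 < p0" and "0 < q0"
    and "cont_embed (mixed_space \<phi>0 t0 p0 q0) (mixed_qnorm \<phi>0 t0 p0 q0)
                    (besov_space \<psi>0 t p q) (besov_qnorm \<psi>0 t p q)"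
  shows "cont_embed (mixed_space \<phi>0 t0 p0 q0) (mixed_qnorm \<phi>0 t0 p0 q0)
                    (mixed_space \<phi>0 t p q) (mixed_qnorm \<phi>0 t p q)"
proof -
  obtain C where C: "\<And>g. g \<in> mixed_space \<phi>0 t0 p0 q0 \<Longrightarrow>
      besov_qnorm \<psi>0 t p q g \<le> ennreal C * mixed_qnorm \<phi>0 t0 p0 q0 g"
    using assms(7) unfolding cont_embed_def by blast
  note E = assms(1-6) C
  show ?thesis
    by (rule mixed_embedding[OF assms(2-6) embedding_integrability[OF E] embedding_exponents[OF E]])
qed

end
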